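(* Let $X$ be a real Banach space, let $A,B:\mathbb{R}\to L(X)$, and let $\{U(t,s)\}_{t\ge s}$, $t,s\in\mathbb{R}$, be the evolution family generated by $A(\cdot)$. Suppose that $U(t,s)$ admits a nonuniform exponential dichotomy on $\mathbb{R}$ with projections $P(s)$, exponent $\alpha>0$ and bound $Ke^{\epsilon|s|}$ ($K>0$), and let $\beta>0$ be such that $0\le\epsilon<\alpha-\beta$. Put $b(t)=\|B(t)\|e^{\epsilon|t|}$ and suppose that $$\theta:=\sup_{t\in\mathbb{R}}\int_{-\infty}^{+\infty}e^{-(\alpha-\beta)|t-\tau|}\,b(\tau)\,d\tau<\frac1K .$$ Then the perturbed equation $x'(t)=A(t)x(t)+B(t)x(t)$ admits a nonuniform exponential dichotomy on $\mathbb{R}$.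
   Context: $L(X)$ is the Banach algebra of bounded linear operators on $X$; $\mathrm{Id}$ is the identity. Evolution family on an interval $J$ ($J=\mathbb{R},\mathbb{R}_+,\mathbb{R}_-$): operators $U(t,s)\in L(X)$, $t\ge s$ in $J$, with $U(t,t)=\mathrm{Id}$, $U(t,s)=U(t,r)U(r,s)$ for $t\ge r\ge s$, and $(t,s)\mapsto U(t,s)x$ continuous for every $x\in X$. It is generated by $A(\cdot)$ if it is the solution operator of $x'=A(t)x$, i.e. $\partial_tU(t,s)=A(t)U(t,s)$ in $L(X)$. Nonuniform exponential dichotomy: an evolution family $U(t,s)$ on $J$ admits a nonuniform exponential dichotomy on $J$ if there is a strongly continuous $P:J\to L(X)$ with $P(t)^2=P(t)$ for all $t$ such that, with $Q(t)=\mathrm{Id}-P(t)$ and $N(P(t))$ the null space of $P(t)$: (i) $U(t,s)P(s)=P(t)U(t,s)$ for $t\ge s$; (ii) $U(t,s)|_{N(P(s))}:N(P(s))\to N(P(t))$ is invertible for $t\ge s$; (iii) there are constants $\alpha,K>0$ and $\epsilon\ge0$ with $$\|U(t,s)P(s)\|\le Ke^{-\alpha(t-s)+\epsilon|s|}\ (t\ge s),\qquad \|U(t,s)Q(s)\|\le Ke^{-\alpha(s-t)+\epsilon|s|}\ (s\ge t),$$ where for $s\ge t$, $U(t,s):=(U(s,t)|_{N(P(t))})^{-1}:N(P(s))\to N(P(t))$. Then $\alpha$ is called the exponent and $Ke^{\epsilon|s|}$ the bound of the dichotomy. The map $B$ is such that $t\mapsto B(t)x$ is strongly measurable for each $x\in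 X$ and $t\mapsto\|B(t)\|$ is measurable. The perturbed equation $x'=A(t)x+B(t)x$ on $J$ admits a nonuniform exponential dichotomy on $J$ if its evolution family $\{U_B(t,s)\}_{t\ge s}$ on $J$ does (with some projections, exponent and bound), where $U_B$ is the evolution family satisfying $$U_B(t,s)x=U(t,s)x+\int_s^tU(t,\tau)B(\tau)U_B(\tau,s)x\,d\tau,\qquad t\ge s,\ x\in X.$$ *)

theory Defs
  imports "HOL-Analysis.Analysis"
begin

section \<open>Strong measurability and the Bochner integral in arbitrary normed spaces\<close>

text \<open>
  The library's \<^const>\<open>has_bochner_integral\<close> requires a second countable, hence separable,
  range space, and for nonseparable range spaces Borel measurability is not strong measurability.
  The second definition below is \<^const>\<open>has_bochner_integral\<close> without that restriction, with Borel
  measurability replaced by strong measurability; \<^const>\<open>Bochner_Integration.simple_bochner_integrable\<close> and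
  \<^const>\<open>Bochner_Integration.simple_bochner_integral\<close> are the library's.  Both definitions are meant for complete
  measures, such as Lebesgue measure, where the norm of a strongly measurable function is
  measurable even though the limit is only taken almost everywhere.
\<close>

definition strongly_measurable :: "'a measure \<Rightarrow> ('a \<Rightarrow> 'b::real_normed_vector) \<Rightarrow> bool" where
  "strongly_measurable M f \<longleftrightarrow>
    (\<exists>s :: nat \<Rightarrow> 'a \<Rightarrow> 'b. (\<forall>i. simple_function M (s i)) \<and> (AE x in M. (\<lambda>i. s i x) \<longlonglongrightarrow> f x))"

definition has_strong_bochner_integral ::
    "'a measure \<Rightarrow> ('a \<Rightarrow> 'b::real_normed_vector) \<Rightarrow> 'b \<Rightarrow> bool" where
  "has_strong_bochner_integral M f y \<longleftrightarrow>
    strongly_measurable M f \<and>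
    (\<exists>s :: nat \<Rightarrow> 'a \<Rightarrow> 'b.
      (\<forall>i. Bochner_Integration.simple_bochner_integrable M (s i)) \<and>
      (\<lambda>i. \<integral>\<^sup>+x. ennreal (norm (f x - s i x)) \<partial>M) \<longlonglongrightarrow> 0 \<and>
      (\<lambda>i. Bochner_Integration.simple_bochner_integral M (s i)) \<longlonglongrightarrow> y)"

section \<open>Evolution families\<close>

text \<open>
  Evolution families are total functions; only their values at \<open>t \<ge> s\<close> in \<open>J\<close> are meaningful.
\<close>

definition evolution_family ::
    "real set \<Rightarrow> (real \<Rightarrow> real \<Rightarrow> 'a::real_normed_vector \<Rightarrow>\<^sub>L 'a) \<Rightarrow> bool" where
  "evolution_family J U \<longleftrightarrow>
    (\<forall>t\<in>J. U t t = id_blinfun) \<and>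
    (\<forall>t\<in>J. \<forall>r\<in>J. \<forall>s\<in>J. s \<le> r \<and> r \<le> t \<longrightarrow> U t s = U t r o\<^sub>L U r s) \<and>
    (\<forall>x. continuous_on {(t, s). t \<in> J \<and> s \<in> J \<and> s \<le> t} (\<lambda>(t, s). U t s x))"

text \<open>
  The derivative is taken in the operator norm; it is one-sided at \<open>t = s\<close>.
\<close>

definition generates_on ::
    "real set \<Rightarrow> (real \<Rightarrow> 'a::real_normed_vector \<Rightarrow>\<^sub>L 'a) \<Rightarrow> (real \<Rightarrow> real \<Rightarrow> 'a \<Rightarrow>\<^sub>L 'a) \<Rightarrow> bool" where
  "generates_on J A U \<longleftrightarrow>
    (\<forall>t\<in>J. \<forall>s\<in>J. s \<le> t \<longrightarrow>
      ((\<lambda>r. U r s) has_vector_derivative (A t o\<^sub>L U t s)) (at t within {r\<in>J. s \<le> r}))"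

section \<open>Nonuniform exponential dichotomies\<close>

definition null_space :: "('a::real_normed_vector \<Rightarrow>\<^sub>L 'a) \<Rightarrow> 'a set" where
  "null_space T = {x. T x = 0}"

text \<open>
  For \<open>s \<ge> t\<close>, the map \<open>N(P(s)) \<rightarrow> N(P(t))\<close> inverse to the restriction of \<open>U(s,t)\<close>
  to \<open>N(P(t))\<close>.
\<close>

definition backward_evolution ::
    "(real \<Rightarrow> real \<Rightarrow> 'a::real_normed_vector \<Rightarrow>\<^sub>L 'a) \<Rightarrow> (real \<Rightarrow> 'a \<Rightarrow>\<^sub>L 'a) \<Rightarrow> real \<Rightarrow> real \<Rightarrow> 'a \<Rightarrow> 'a"
  where "backward_evolution U P t s = inv_into (null_space (P t)) (U s t)"

text \<open>
  The operator norm bound on \<open>U(t,s)Q(s)\<close> for \<open>s \<ge> t\<close> is written out pointwise, since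
  \<^const>\<open>backward_evolution\<close> is a plain function; it contains the boundedness of that operator.
\<close>

definition nonuniform_exp_dichotomy_with ::
    "real set \<Rightarrow> (real \<Rightarrow> real \<Rightarrow> 'a::real_normed_vector \<Rightarrow>\<^sub>L 'a) \<Rightarrow> (real \<Rightarrow> 'a \<Rightarrow>\<^sub>L 'a) \<Rightarrow>
      real \<Rightarrow> real \<Rightarrow> real \<Rightarrow> bool" where
  "nonuniform_exp_dichotomy_with J U P \<alpha> K \<epsilon> \<longleftrightarrow>
    \<alpha> > 0 \<and> K > 0 \<and> \<epsilon> \<ge> 0 \<and>
    (\<forall>x. continuous_on J (\<lambda>t. P t x)) \<and>
    (\<forall>t\<in>J. P t o\<^sub>L P t = P t) \<and>
    (\<forall>t\<in>J. \<forall>s\<in>J. s \<le> t \<longrightarrow> U t s o\<^sub>L P s = P t o\<^sub>L U t s) \<and>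
    (\<forall>t\<in>J. \<forall>s\<in>J. s \<le> t \<longrightarrow> bij_betw (U t s) (null_space (P s)) (null_space (P t))) \<and>
    (\<forall>t\<in>J. \<forall>s\<in>J. s \<le> t \<longrightarrow>
      norm (U t s o\<^sub>L P s) \<le> K * exp (- \<alpha> * (t - s) + \<epsilon> * \<bar>s\<bar>)) \<and>
    (\<forall>t\<in>J. \<forall>s\<in>J. t \<le> s \<longrightarrow>
      (\<forall>x. norm (backward_evolution U P t s ((id_blinfun - P s) x))
            \<le> K * exp (- \<alpha> * (s - t) + \<epsilon> * \<bar>s\<bar>) * norm x))"

definition admits_nonuniform_exp_dichotomy ::
    "real set \<Rightarrow> (real \<Rightarrow> real \<Rightarrow> 'a::real_normed_vector \<Rightarrow>\<^sub>L 'a) \<Rightarrow> bool" where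
  "admits_nonuniform_exp_dichotomy J U \<longleftrightarrow>
    (\<exists>P \<alpha> K \<epsilon>. nonuniform_exp_dichotomy_with J U P \<alpha> K \<epsilon>)"

section \<open>The perturbed equation\<close>

definition perturbed_evolution_family ::
    "real set \<Rightarrow> (real \<Rightarrow> real \<Rightarrow> 'a::real_normed_vector \<Rightarrow>\<^sub>L 'a) \<Rightarrow> (real \<Rightarrow> 'a \<Rightarrow>\<^sub>L 'a) \<Rightarrow>
      (real \<Rightarrow> real \<Rightarrow> 'a \<Rightarrow>\<^sub>L 'a) \<Rightarrow> bool" where
  "perturbed_evolution_family J U B V \<longleftrightarrow>
    evolution_family J V \<and>
    (\<forall>t\<in>J. \<forall>s\<in>J. \<forall>x. s \<le> t \<longrightarrow>
      has_strong_bochner_integral (lebesgue_on {s..t}) (\<lambda>\<tau>. U t \<tau> (B \<tau> (V \<tau> s x)))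
        (V t s x - U t s x))"

text \<open>
  "The evolution family satisfying the variation of constants formula" is rendered as: there is
  such a family, and every such family has the dichotomy.
\<close>

definition perturbed_admits_nonuniform_exp_dichotomy ::
    "real set \<Rightarrow> (real \<Rightarrow> real \<Rightarrow> 'a::real_normed_vector \<Rightarrow>\<^sub>L 'a) \<Rightarrow> (real \<Rightarrow> 'a \<Rightarrow>\<^sub>L 'a) \<Rightarrow> bool" where
  "perturbed_admits_nonuniform_exp_dichotomy J U B \<longleftrightarrow>
    (\<exists>V. perturbed_evolution_family J U B V) \<and>
    (\<forall>V. perturbed_evolution_family J U B V \<longrightarrow> admits_nonuniform_exp_dichotomy J V)"

end

theory Submission
  imports Defs
begin

text \<open>
  Write \<open>V\<close> for the perturbed evolution family, \<open>G(t,s) = U(t,s)P(s)\<close> for \<open>t \<ge> s\<close> and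
  \<open>G(t,s) = -U(t,s)Q(s)\<close> for \<open>t < s\<close>; this Green function satisfies
  \<open>\<parallel>G(t,s)\<parallel> \<le> K exp(-\<alpha>|t-s| + \<epsilon>|s|)\<close>.  The Green operator
  \<open>(\<Gamma>f)(t) = \<integral> G(t,\<tau>) B(\<tau>) f(\<tau>) d\<tau>\<close> over the whole line is the engine of the proof.  If \<open>w\<close> is a positive
  weight with \<open>w(\<tau>) \<le> exp(\<beta>|t-\<tau>|) w(t)\<close>, then the factor \<open>exp(\<beta>|t-\<tau>|)\<close> is absorbed by \<open>G\<close> and \<open>\<Gamma>\<close> has norm
  at most \<open>q = K\<theta> < 1\<close> in the weighted supremum norm (\<open>green_op_bound\<close>).  Two weights are used: the
  constant \<open>1\<close> and \<open>exp(-\<beta>|t-s|)\<close>.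

  \<^item> The weight \<open>exp(-\<beta>|t-s|)\<close> gives a unique solution \<open>y\<close> of \<open>y = G(\<cdot>,s)x + \<Gamma>y\<close>: the perturbed Green
    function \<open>\<hat>G(t,s)x\<close>, bounded by \<open>K/(1-q) exp(\<epsilon>|s|) exp(-\<beta>|t-s|) \<parallel>x\<parallel>\<close>.  Because
    \<open>G(t,\<tau>) - U(t,r)G(r,\<tau>)\<close> equals \<open>U(t,\<tau>)\<close> for \<open>r < \<tau> \<le> t\<close> and vanishes otherwise (\<open>green_evolve\<close>), \<open>\<Gamma>y\<close> obeys
    the variation of constants formula, so \<open>\<hat>G(\<cdot>,s)x\<close> is an orbit of \<open>V\<close> on \<open>[s,\<infinity>)\<close> and on \<open>(-\<infinity>,s)\<close>, with
    jump \<open>x\<close> at \<open>s\<close>.  Hence \<open>x\<close> is the sum of \<open>\<hat>P(s)x = \<hat>G(s,s)x\<close>, which starts a decaying forward orbit,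
    and \<open>x - \<hat>P(s)x\<close>, which ends a decaying backward orbit.

  \<^item> The weight \<open>1\<close> shows that an orbit of \<open>V\<close> that is bounded on the whole line is zero
    (\<open>bounded_orbit_zero\<close>), since it is a bounded fixed point of \<open>\<Gamma>\<close>.  Hence the spaces of initial values
    of bounded forward orbits and of end values of bounded backward orbits meet only in \<open>0\<close>, and \<open>\<hat>P(s)\<close>
    is the projection onto the former along the latter.  Both families of spaces are mapped into
    themselves by \<open>V\<close>, which gives the commutation relation, and \<open>V(t,s)\<close> is bijective between the
    backward spaces.  The norm estimates are those of \<open>\<hat>G\<close>, so \<open>V\<close> has a dichotomy with exponent \<open>\<beta>\<close> and
    bound \<open>K/(1-q) exp(\<epsilon>|s|)\<close>.

  Existence and uniqueness for the Volterra equation that defines \<open>V\<close> come from the same contraction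
  scheme with a weight that grows with the mass of \<open>\<parallel>B\<parallel>\<close>.  The first two parts supply the theory of the
  strong Bochner integral in a Banach space that may be nonseparable.
\<close>

section \<open>Strong measurability\<close>

text \<open>
  Completeness of the measure is what allows a measurable function to be changed on a null set.
\<close>

lemma (in complete_measure) borel_measurable_cong_AE_complete:
  assumes f: "f \<in> borel_measurable M" and eq: "AE x in M. f x = g x"
  shows "g \<in> borel_measurable M"
proof (rule measurableI)
  fix A :: "'b set" assume A: "A \<in> sets borel"
  show "g -` A \<inter> space M \<in> sets M"
  proof (rule in_sets_AE)
    show "AE x in M. x \<in> f -` A \<inter> space M \<longleftrightarrow> x \<in> g -` A \<inter> space M"
      using eq by eventually_elim auto
    show "f -` A \<inter> space M \<in> sets M"
      using f A by (rule measurable_sets)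
  qed auto
qed auto

lemma (in complete_measure) borel_measurable_LIMSEQ_AE:
  fixes f :: "nat \<Rightarrow> 'a \<Rightarrow> real"
  assumes f: "\<And>i. f i \<in> borel_measurable M" and lim: "AE x in M. (\<lambda>i. f i x) \<longlonglongrightarrow> g x"
  shows "g \<in> borel_measurable M"
proof (rule borel_measurable_cong_AE_complete)
  show "(\<lambda>x. lim (\<lambda>i. f i x)) \<in> borel_measurable M"
    using f by (rule borel_measurable_lim_metric)
  show "AE x in M. lim (\<lambda>i. f i x) = g x"
    using lim by eventually_elim (rule limI)
qed

lemma strongly_measurable_simple_function:
  "simple_function M f \<Longrightarrow> strongly_measurable M f"
  unfolding strongly_measurable_def by (intro exI[of _ "\<lambda>_. f"]) auto

lemma strongly_measurable_const [simp]: "strongly_measurable M (\<lambda>_. c)"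
  by (intro strongly_measurable_simple_function simple_function_const)

lemma strongly_measurable_cong_AE:
  assumes "strongly_measurable M f" "AE x in M. f x = g x"
  shows "strongly_measurable M g"
proof -
  from assms(1) obtain s where s: "\<And>i. simple_function M (s i)" "AE x in M. (\<lambda>i. s i x) \<longlonglongrightarrow> f x"
    unfolding strongly_measurable_def by auto
  have "AE x in M. (\<lambda>i. s i x) \<longlonglongrightarrow> g x"
    using s(2) assms(2) by eventually_elim auto
  with s(1) show ?thesis unfolding strongly_measurable_def by blast
qed

lemma strongly_measurable_continuous2:
  assumes f: "strongly_measurable M f" and g: "strongly_measurable M g"
    and h: "continuous_on UNIV (\<lambda>p. h (fst p) (snd p))"
  shows "strongly_measurable M (\<lambda>x. h (f x) (g x))"
proof -
  from f obtain s where s: "\<And>i. simple_function M (s i)" "AE x in M. (\<lambda>i. s i x) \<longlonglongrightarrow> f x"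
    unfolding strongly_measurable_def by auto
  from g obtain r where r: "\<And>i. simple_function M (r i)" "AE x in M. (\<lambda>i. r i x) \<longlonglongrightarrow> g x"
    unfolding strongly_measurable_def by auto
  have h': "(\<lambda>i. h (a i) (b i)) \<longlonglongrightarrow> h u v" if "a \<longlonglongrightarrow> u" "b \<longlonglongrightarrow> v" for a b u v
    using continuous_on_tendsto_compose[OF h tendsto_Pair[OF that]] by auto
  have "AE x in M. (\<lambda>i. h (s i x) (r i x)) \<longlonglongrightarrow> h (f x) (g x)"
    using s(2) r(2) by eventually_elim (rule h')
  moreover have "simple_function M (\<lambda>x. h (s i x) (r i x))" for i
    using s(1) r(1) by (rule simple_function_compose2)
  ultimately show ?thesis unfolding strongly_measurable_def by (intro exI[of _ "\<lambda>i x. h (s i x) (r i x)"]) auto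
qed

lemma strongly_measurable_continuous:
  fixes f :: "'a \<Rightarrow> 'b::real_normed_vector"
  assumes "strongly_measurable M f" and "continuous_on UNIV h"
  shows "strongly_measurable M (\<lambda>x. h (f x))"
proof (rule strongly_measurable_continuous2[OF assms(1) assms(1), of "\<lambda>a b. h a"])
  show "continuous_on UNIV (\<lambda>p::'b \<times> 'b. h (fst p))"
    by (rule continuous_on_compose2[OF assms(2)]) (auto intro: continuous_intros)
qed

lemma strongly_measurable_add:
  "strongly_measurable M f \<Longrightarrow> strongly_measurable M g \<Longrightarrow> strongly_measurable M (\<lambda>x. f x + g x)"
  by (rule strongly_measurable_continuous2) (auto intro!: continuous_intros)

lemma strongly_measurable_diff:
  "strongly_measurable M f \<Longrightarrow> strongly_measurable M g \<Longrightarrow> strongly_measurable M (\<lambda>x. f x - g x)"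
  by (rule strongly_measurable_continuous2) (auto intro!: continuous_intros)

lemma strongly_measurable_minus:
  "strongly_measurable M f \<Longrightarrow> strongly_measurable M (\<lambda>x. - f x)"
  by (rule strongly_measurable_continuous) (auto intro!: continuous_intros)

lemma strongly_measurable_bounded_linear:
  "strongly_measurable M f \<Longrightarrow> bounded_linear h \<Longrightarrow> strongly_measurable M (\<lambda>x. h (f x))"
  by (rule strongly_measurable_continuous) (auto intro!: linear_continuous_on)

lemma strongly_measurable_indicator:
  assumes "strongly_measurable M f" "A \<in> sets M"
  shows "strongly_measurable M (\<lambda>x. indicator A x *\<^sub>R f x)"
  by (rule strongly_measurable_continuous2[OF strongly_measurable_simple_function[OF simple_function_indicator] assms(1)])
    (use assms in \<open>auto intro!: continuous_intros\<close>)

lemma (in complete_measure) borel_measurable_norm_strongly_measurable: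
  assumes "strongly_measurable M f"
  shows "(\<lambda>x. norm (f x)) \<in> borel_measurable M"
proof -
  from assms obtain s where s: "\<And>i. simple_function M (s i)" "AE x in M. (\<lambda>i. s i x) \<longlonglongrightarrow> f x"
    unfolding strongly_measurable_def by auto
  show ?thesis
  proof (rule borel_measurable_LIMSEQ_AE)
    show "(\<lambda>x. norm (s i x)) \<in> borel_measurable M" for i
      by (rule borel_measurable_simple_function[OF simple_function_compose1[OF s(1)]])
    show "AE x in M. (\<lambda>i. norm (s i x)) \<longlonglongrightarrow> norm (f x)"
      using s(2) by eventually_elim (rule tendsto_norm)
  qed
qed

text \<open>
  Up to a null set a strongly measurable function has separable range, and there it is determined by
  its distances to fixed points.  Conversely, the best approximation of \<open>f x\<close> among the first \<open>n\<close> points of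
  a countable dense subset of the range is a simple function of \<open>x\<close>.  Both conditions pass to
  almost everywhere limits, which is hard to see from approximating sequences alone.
\<close>

lemma (in complete_measure) strongly_measurable_iff_separable:
  fixes f :: "'a \<Rightarrow> 'b::real_normed_vector"
  shows "strongly_measurable M f \<longleftrightarrow>
    (\<exists>D. countable D \<and> (AE x in M. f x \<in> closure D)) \<and>
    (\<forall>c. (\<lambda>x. norm (f x - c)) \<in> borel_measurable M)"
proof safe
  assume sm: "strongly_measurable M f"
  then obtain s where s: "\<And>i. simple_function M (s i)" "AE x in M. (\<lambda>i. s i x) \<longlonglongrightarrow> f x"
    unfolding strongly_measurable_def by auto
  show "\<exists>D. countable D \<and> (AE x in M. f x \<in> closure D)"
  proof (intro exI conjI)
    show "countable (\<Union>i. s i ` space M)"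
      using s(1) by (intro countable_UN) (auto intro!: countable_finite simple_functionD(1))
    show "AE x in M. f x \<in> closure (\<Union>i. s i ` space M)"
      using s(2) AE_space
    proof eventually_elim
      fix x assume "(\<lambda>i. s i x) \<longlonglongrightarrow> f x" "x \<in> space M"
      then show "f x \<in> closure (\<Union>i. s i ` space M)"
        unfolding closure_sequential by (intro exI[of _ "\<lambda>i. s i x"]) blast
    qed
  qed
  show "(\<lambda>x. norm (f x - c)) \<in> borel_measurable M" for c
    using sm by (intro borel_measurable_norm_strongly_measurable strongly_measurable_diff) auto
next
  fix D assume D: "countable D" "AE x in M. f x \<in> closure D"
    and m: "\<forall>c. (\<lambda>x. norm (f x - c)) \<in> borel_measurable M"
  have [measurable]: "(\<lambda>x. norm (f x - c)) \<in> borel_measurable M" for c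
    using m by auto
  define e where "e = from_nat_into (insert 0 D)"
  have e: "range e = insert 0 D"
    unfolding e_def using D(1) by (intro range_from_nat_into) auto
  define best where "best n x k \<longleftrightarrow> k \<le> n \<and> (\<forall>i\<in>{..n}. norm (f x - e k) \<le> norm (f x - e i))" for n k :: nat and x
  define j where "j n x = (LEAST k. best n x k)" for n x
  have best: "best n x (j n x)" for n x
  proof -
    obtain k where "k \<in> {..n}" "\<And>i. i \<in> {..n} \<Longrightarrow> norm (f x - e k) \<le> norm (f x - e i)"
      using arg_min_if_finite[of "{..n}" "\<lambda>k. norm (f x - e k)"] by (metis atMost_iff empty_iff finite_atMost le0 not_less)
    then have "best n x k"
      unfolding best_def by auto
    then show ?thesis
      unfolding j_def by (rule LeastI)
  qed
  have sf: "simple_function M (\<lambda>x. e (j n x))" for n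
  proof -
    have "Measurable.pred M (\<lambda>x. best n x k)" for k
      unfolding best_def by measurable
    then have "j n \<in> measurable M (count_space UNIV)"
      unfolding j_def[abs_def] by (intro measurable_Least)
    moreover have "j n ` space M \<subseteq> {..n}"
      using best unfolding best_def by auto
    ultimately have "simple_function M (j n)"
      by (auto simp: simple_function_eq_measurable intro: finite_subset)
    then show ?thesis
      by (rule simple_function_compose1)
  qed
  have "AE x in M. (\<lambda>n. e (j n x)) \<longlonglongrightarrow> f x"
    using D(2)
  proof eventually_elim
    fix x assume x: "f x \<in> closure D"
    show "(\<lambda>n. e (j n x)) \<longlonglongrightarrow> f x"
    proof (rule LIMSEQ_I)
      fix r :: real assume "0 < r"
      with x obtain d where "d \<in> D" "dist d (f x) < r"
        unfolding closure_approachable by blast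
      then obtain k where k: "norm (f x - e k) < r"
        using e by (metis dist_commute dist_norm imageE insertI2)
      have "norm (e (j n x) - f x) < r" if "n \<ge> k" for n
        using best[of n x] k that unfolding best_def by (force simp: norm_minus_commute)
      then show "\<exists>no. \<forall>n\<ge>no. norm (e (j n x) - f x) < r" by blast
    qed
  qed
  with sf show "strongly_measurable M f"
    unfolding strongly_measurable_def by (intro exI[of _ "\<lambda>n x. e (j n x)"]) simp
qed

lemma (in complete_measure) strongly_measurable_LIMSEQ:
  fixes f :: "nat \<Rightarrow> 'a \<Rightarrow> 'b::real_normed_vector"
  assumes f: "\<And>i. strongly_measurable M (f i)" and lim: "AE x in M. (\<lambda>i. f i x) \<longlonglongrightarrow> g x"
  shows "strongly_measurable M g"
  unfolding strongly_measurable_iff_separable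
proof (intro conjI allI)
  have "\<forall>i. \<exists>D. countable D \<and> (AE x in M. f i x \<in> closure D)"
    using f unfolding strongly_measurable_iff_separable by auto
  then obtain D where D: "\<And>i. countable (D i)" "\<And>i. AE x in M. f i x \<in> closure (D i)"
    by metis
  have "AE x in M. \<forall>i. f i x \<in> closure (D i)"
    unfolding AE_all_countable using D(2) by blast
  then have "AE x in M. g x \<in> closure (\<Union>i. D i)"
    using lim
  proof eventually_elim
    fix x assume x: "\<forall>i. f i x \<in> closure (D i)" "(\<lambda>i. f i x) \<longlonglongrightarrow> g x"
    have "f i x \<in> closure (\<Union>i. D i)" for i
      using x(1) closure_mono[of "D i" "\<Union>i. D i"] by auto
    then show "g x \<in> closure (\<Union>i. D i)"
      by (rule closed_sequentially[OF closed_closure _ x(2)])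
  qed
  then show "\<exists>D. countable D \<and> (AE x in M. g x \<in> closure D)"
    using D(1) by (intro exI[of _ "\<Union>i. D i"]) auto
  fix c
  show "(\<lambda>x. norm (g x - c)) \<in> borel_measurable M"
  proof (rule borel_measurable_LIMSEQ_AE)
    show "(\<lambda>x. norm (f i x - c)) \<in> borel_measurable M" for i
      using f unfolding strongly_measurable_iff_separable by auto
    show "AE x in M. (\<lambda>i. norm (f i x - c)) \<longlonglongrightarrow> norm (g x - c)"
      using lim by eventually_elim (intro tendsto_intros)
  qed
qed

lemma (in complete_measure) strongly_measurable_If:
  fixes f g :: "'a \<Rightarrow> 'b::real_normed_vector"
  assumes f: "strongly_measurable M f" and g: "strongly_measurable M g"
    and P: "Measurable.pred M P"
  shows "strongly_measurable M (\<lambda>x. if P x then f x else g x)"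
  unfolding strongly_measurable_iff_separable
proof (intro conjI allI)
  obtain D where D: "countable D" "AE x in M. f x \<in> closure D"
    using f unfolding strongly_measurable_iff_separable by auto
  obtain E where E: "countable E" "AE x in M. g x \<in> closure E"
    using g unfolding strongly_measurable_iff_separable by auto
  have "AE x in M. (if P x then f x else g x) \<in> closure (D \<union> E)"
    using D(2) E(2) by eventually_elim (auto simp: closure_Un)
  then show "\<exists>D. countable D \<and> (AE x in M. (if P x then f x else g x) \<in> closure D)"
    using D(1) E(1) by (intro exI[of _ "D \<union> E"]) auto
  fix c
  have "(\<lambda>x. if P x then norm (f x - c) else norm (g x - c)) \<in> borel_measurable M"
    using f g P unfolding strongly_measurable_iff_separable by (intro measurable_If) auto
  then show "(\<lambda>x. norm ((if P x then f x else g x) - c)) \<in> borel_measurable M"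
    by (simp add: if_distrib if_distribR cong: if_cong)
qed

lemma strongly_measurable_continuous_on_real:
  fixes f :: "real \<Rightarrow> 'b::real_normed_vector"
  assumes f: "continuous_on UNIV f"
  shows "strongly_measurable lebesgue f"
  unfolding completion.strongly_measurable_iff_separable
proof (intro conjI allI)
  have "f ` closure \<rat> \<subseteq> closure (f ` \<rat>)"
    by (rule image_closure_subset) (auto intro: continuous_on_subset[OF f] subsetD[OF closure_subset])
  then have "f x \<in> closure (f ` \<rat>)" for x
    by (auto simp: Rats_closure_real)
  then show "\<exists>D. countable D \<and> (AE x in lebesgue. f x \<in> closure D)"
    by (intro exI[of _ "f ` \<rat>"]) (auto intro: countable_rat)
  fix c
  have "(\<lambda>x. norm (f x - c)) \<in> borel_measurable lborel"
    using f by (auto intro!: borel_measurable_continuous_onI continuous_intros)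
  then show "(\<lambda>x. norm (f x - c)) \<in> borel_measurable lebesgue"
    by (rule measurable_completion)
qed

text \<open>
  For simple \<open>f\<close> the function is a finite sum of functions \<open>T x v\<close> cut off to measurable sets; the general
  case is a limit of such functions.  Only pointwise strong measurability of \<open>T\<close> is assumed, as for \<open>B\<close>
  in the perturbed equation.
\<close>

lemma (in complete_measure) strongly_measurable_blinfun_apply:
  fixes T :: "'a \<Rightarrow> 'b::real_normed_vector \<Rightarrow>\<^sub>L 'c::real_normed_vector"
  assumes T: "\<And>v. strongly_measurable M (\<lambda>x. T x v)" and f: "strongly_measurable M f"
  shows "strongly_measurable M (\<lambda>x. T x (f x))"
proof -
  from f obtain s where s: "\<And>i. simple_function M (s i)" "AE x in M. (\<lambda>i. s i x) \<longlonglongrightarrow> f x"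
    unfolding strongly_measurable_def by auto
  show ?thesis
  proof (rule strongly_measurable_LIMSEQ)
    show "AE x in M. (\<lambda>i. T x (s i x)) \<longlonglongrightarrow> T x (f x)"
      using s(2) by eventually_elim (intro tendsto_intros)
    fix i
    have fin: "finite (s i ` space M)"
      using s(1) by (auto simp: simple_function_def)
    have meas: "{x\<in>space M. s i x = v} \<in> sets M" for v
    proof -
      have "s i \<in> measurable M (count_space UNIV)"
        using s(1) by (rule measurable_simple_function)
      from measurable_sets[OF this, of "{v}"] show ?thesis
        by (auto simp: vimage_def Int_def conj_commute)
    qed
    have "strongly_measurable M (\<lambda>x. \<Sum>v\<in>V. indicator {x\<in>space M. s i x = v} x *\<^sub>R T x v)"
      if "finite V" for V
      using that
    proof (induction V)
      case (insert v V)
      show ?case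
        unfolding sum.insert[OF insert.hyps(1,2)]
        by (intro strongly_measurable_add strongly_measurable_indicator T meas insert.IH)
    qed simp
    from this[OF fin]
    show "strongly_measurable M (\<lambda>x. T x (s i x))"
    proof (rule strongly_measurable_cong_AE)
      show "AE x in M. (\<Sum>v\<in>s i ` space M. indicator {x\<in>space M. s i x = v} x *\<^sub>R T x v) = T x (s i x)"
      proof (rule AE_I2)
        fix x assume x: "x \<in> space M"
        have "(\<Sum>v\<in>s i ` space M. indicator {x\<in>space M. s i x = v} x *\<^sub>R T x v) =
          (\<Sum>v\<in>s i ` space M. if v = s i x then T x v else 0)"
          using x by (intro sum.cong) auto
        also have "\<dots> = T x (s i x)"
          using x fin by (simp add: sum.delta')
        finally show "(\<Sum>v\<in>s i ` space M. indicator {x\<in>space M. s i x = v} x *\<^sub>R T x v) = T x (s i x)" .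
      qed
    qed
  qed
qed


section \<open>The strong Bochner integral\<close>

abbreviation L1_norm :: "'a measure \<Rightarrow> ('a \<Rightarrow> 'b::real_normed_vector) \<Rightarrow> ennreal" where
  "L1_norm M f \<equiv> \<integral>\<^sup>+x. ennreal (norm (f x)) \<partial>M"

lemma simple_bochner_integral_norm_le_nn_integral:
  fixes s :: "'a \<Rightarrow> 'b::real_normed_vector"
  assumes s: "Bochner_Integration.simple_bochner_integrable M s"
  shows "ennreal (norm (Bochner_Integration.simple_bochner_integral M s)) \<le> L1_norm M s"
proof -
  have "Bochner_Integration.simple_bochner_integral M (\<lambda>x. norm (s x)) = L1_norm M s"
    using simple_bochner_integrable_compose2[of "\<lambda>x y. norm x" M s s] s
    by (intro simple_bochner_integral_eq_nn_integral) auto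
  with simple_bochner_integral_norm_bound[OF s] show ?thesis
    by (metis ennreal_leI)
qed

lemma (in complete_measure) nn_integral_norm_add_le:
  fixes f g :: "'a \<Rightarrow> 'b::real_normed_vector"
  assumes "strongly_measurable M f" "strongly_measurable M g"
  shows "L1_norm M (\<lambda>x. f x + g x) \<le>
    L1_norm M f + L1_norm M g"
proof -
  have [measurable]: "(\<lambda>x. norm (f x)) \<in> borel_measurable M" "(\<lambda>x. norm (g x)) \<in> borel_measurable M"
    using assms by (auto intro: borel_measurable_norm_strongly_measurable)
  have "L1_norm M (\<lambda>x. f x + g x) \<le>
      (\<integral>\<^sup>+x. ennreal (norm (f x)) + ennreal (norm (g x)) \<partial>M)"
    by (intro nn_integral_mono) (simp flip: ennreal_plus add: norm_triangle_ineq)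
  then show ?thesis
    by (subst (asm) nn_integral_add) auto
qed

lemma has_strong_bochner_integral_strongly_measurable:
  "has_strong_bochner_integral M f y \<Longrightarrow> strongly_measurable M f"
  by (simp add: has_strong_bochner_integral_def)

text \<open>
  Holds for the approximating simple functions up to their \<open>L\<^sup>1\<close>-distance from \<open>f\<close>.  Together with
  additivity it makes the integral unique.
\<close>

lemma (in complete_measure) norm_has_strong_bochner_integral_le:
  fixes f :: "'a \<Rightarrow> 'b::real_normed_vector"
  assumes "has_strong_bochner_integral M f y"
  shows "ennreal (norm y) \<le> L1_norm M f"
proof -
  from assms obtain s where f: "strongly_measurable M f"
    and s: "\<And>i. Bochner_Integration.simple_bochner_integrable M (s i)"
    and lim: "(\<lambda>i. L1_norm M (\<lambda>x. f x - s i x)) \<longlonglongrightarrow> 0"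
    and y: "(\<lambda>i. Bochner_Integration.simple_bochner_integral M (s i)) \<longlonglongrightarrow> y"
    unfolding has_strong_bochner_integral_def by blast
  have sm: "strongly_measurable M (s i)" for i
    using s by (auto intro: strongly_measurable_simple_function elim: Bochner_Integration.simple_bochner_integrable.cases)
  show ?thesis
  proof (rule LIMSEQ_le)
    show "(\<lambda>i. ennreal (norm (Bochner_Integration.simple_bochner_integral M (s i)))) \<longlonglongrightarrow> ennreal (norm y)"
      using y by (intro tendsto_ennrealI tendsto_norm)
    show "(\<lambda>i. L1_norm M f + L1_norm M (\<lambda>x. f x - s i x))
        \<longlonglongrightarrow> L1_norm M f"
      using tendsto_add[OF tendsto_const lim, of "L1_norm M f"] by simp
    have "ennreal (norm (Bochner_Integration.simple_bochner_integral M (s i))) \<le>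
        L1_norm M f + L1_norm M (\<lambda>x. f x - s i x)" for i
      using simple_bochner_integral_norm_le_nn_integral[OF s, of i]
        nn_integral_norm_add_le[OF f strongly_measurable_diff[OF sm[of i] f]]
      by (simp add: norm_minus_commute)
    then show "\<exists>N. \<forall>i\<ge>N. ennreal (norm (Bochner_Integration.simple_bochner_integral M (s i))) \<le>
        L1_norm M f + L1_norm M (\<lambda>x. f x - s i x)"
      by blast
  qed
qed

lemma (in complete_measure) has_strong_bochner_integral_add:
  fixes f g :: "'a \<Rightarrow> 'b::real_normed_vector"
  assumes "has_strong_bochner_integral M f y" "has_strong_bochner_integral M g z"
  shows "has_strong_bochner_integral M (\<lambda>x. f x + g x) (y + z)"
proof -
  from assms obtain s r where f: "strongly_measurable M f" and g: "strongly_measurable M g"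
    and s: "\<And>i. Bochner_Integration.simple_bochner_integrable M (s i)" and r: "\<And>i. Bochner_Integration.simple_bochner_integrable M (r i)"
    and lim: "(\<lambda>i. L1_norm M (\<lambda>x. f x - s i x)) \<longlonglongrightarrow> 0"
      "(\<lambda>i. L1_norm M (\<lambda>x. g x - r i x)) \<longlonglongrightarrow> 0"
    and y: "(\<lambda>i. Bochner_Integration.simple_bochner_integral M (s i)) \<longlonglongrightarrow> y"
      "(\<lambda>i. Bochner_Integration.simple_bochner_integral M (r i)) \<longlonglongrightarrow> z"
    unfolding has_strong_bochner_integral_def by blast
  have sm: "strongly_measurable M (s i)" "strongly_measurable M (r i)" for i
    using s r by (auto intro: strongly_measurable_simple_function elim: Bochner_Integration.simple_bochner_integrable.cases)
  have "(\<lambda>i. L1_norm M (\<lambda>x. f x + g x - (s i x + r i x))) \<longlonglongrightarrow> 0"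
  proof (rule tendsto_sandwich[where f="\<lambda>_. 0"])
    show "(\<lambda>i. L1_norm M (\<lambda>x. f x - s i x) + L1_norm M (\<lambda>x. g x - r i x)) \<longlonglongrightarrow> 0"
      using tendsto_add[OF lim] by simp
    show "\<forall>\<^sub>F i in sequentially. L1_norm M (\<lambda>x. f x + g x - (s i x + r i x)) \<le>
       L1_norm M (\<lambda>x. f x - s i x) + L1_norm M (\<lambda>x. g x - r i x)"
    proof (rule always_eventually, rule allI)
      fix i
      show "L1_norm M (\<lambda>x. f x + g x - (s i x + r i x)) \<le>
       L1_norm M (\<lambda>x. f x - s i x) + L1_norm M (\<lambda>x. g x - r i x)"
        using nn_integral_norm_add_le[OF strongly_measurable_diff[OF f sm(1)[of i]] strongly_measurable_diff[OF g sm(2)[of i]]]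
        by (simp add: add_diff_add)
    qed
  qed auto
  moreover have "(\<lambda>i. Bochner_Integration.simple_bochner_integral M (\<lambda>x. s i x + r i x)) \<longlonglongrightarrow> y + z"
    using tendsto_add[OF y] s r by (simp add: simple_bochner_integral_add)
  moreover have "Bochner_Integration.simple_bochner_integrable M (\<lambda>x. s i x + r i x)" for i
    using simple_bochner_integrable_compose2[of "(+)", OF _ s r] by simp
  ultimately show ?thesis
    unfolding has_strong_bochner_integral_def
    by (intro conjI strongly_measurable_add f g exI[of _ "\<lambda>i x. s i x + r i x"] allI) auto
qed

lemma (in complete_measure) has_strong_bochner_integral_bounded_linear:
  fixes f :: "'a \<Rightarrow> 'b::real_normed_vector" and h :: "'b \<Rightarrow> 'c::real_normed_vector"
  assumes h: "bounded_linear h" and int: "has_strong_bochner_integral M f y"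
  shows "has_strong_bochner_integral M (\<lambda>x. h (f x)) (h y)"
proof -
  interpret h: bounded_linear h by fact
  from int obtain s where f: "strongly_measurable M f"
    and s: "\<And>i. Bochner_Integration.simple_bochner_integrable M (s i)"
    and lim: "(\<lambda>i. L1_norm M (\<lambda>x. f x - s i x)) \<longlonglongrightarrow> 0"
    and y: "(\<lambda>i. Bochner_Integration.simple_bochner_integral M (s i)) \<longlonglongrightarrow> y"
    unfolding has_strong_bochner_integral_def by blast
  have sm: "strongly_measurable M (s i)" for i
    using s by (auto intro: strongly_measurable_simple_function elim: Bochner_Integration.simple_bochner_integrable.cases)
  obtain C where C: "C > 0" "\<And>v. norm (h v) \<le> norm v * C"
    using h.pos_bounded by blast
  have "(\<lambda>i. L1_norm M (\<lambda>x. h (f x) - h (s i x))) \<longlonglongrightarrow> 0"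
  proof (rule tendsto_sandwich[where f="\<lambda>_. 0"])
    show "(\<lambda>i. ennreal C * L1_norm M (\<lambda>x. f x - s i x)) \<longlonglongrightarrow> 0"
      using ennreal_tendsto_cmult[OF _ lim, of "ennreal C"] by simp
    show "\<forall>\<^sub>F i in sequentially. L1_norm M (\<lambda>x. h (f x) - h (s i x)) \<le>
       ennreal C * L1_norm M (\<lambda>x. f x - s i x)"
    proof (rule always_eventually, rule allI)
      fix i
      have [measurable]: "(\<lambda>x. norm (f x - s i x)) \<in> borel_measurable M"
        using f sm by (intro borel_measurable_norm_strongly_measurable strongly_measurable_diff)
      have "L1_norm M (\<lambda>x. h (f x) - h (s i x)) \<le> (\<integral>\<^sup>+x. ennreal C * ennreal (norm (f x - s i x)) \<partial>M)"
        using C by (intro nn_integral_mono) (simp add: h.diff[symmetric] ennreal_mult[symmetric] mult.commute)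
      also have "\<dots> = ennreal C * L1_norm M (\<lambda>x. f x - s i x)"
        by (rule nn_integral_cmult) simp
      finally show "L1_norm M (\<lambda>x. h (f x) - h (s i x)) \<le> ennreal C * L1_norm M (\<lambda>x. f x - s i x)" .
    qed
  qed auto
  moreover have "(\<lambda>i. Bochner_Integration.simple_bochner_integral M (\<lambda>x. h (s i x))) \<longlonglongrightarrow> h y"
    using h.tendsto[OF y] s by (simp add: simple_bochner_integral_linear[OF h.linear_axioms])
  moreover have "Bochner_Integration.simple_bochner_integrable M (\<lambda>x. h (s i x))" for i
    using simple_bochner_integrable_compose2[of "\<lambda>x y. h x" M "s i" "s i"] s h.zero by simp
  ultimately show ?thesis
    unfolding has_strong_bochner_integral_def
    by (intro conjI strongly_measurable_bounded_linear[OF f h] exI[of _ "\<lambda>i x. h (s i x)"] allI) auto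
qed

lemma has_strong_bochner_integral_cong_AE:
  assumes "has_strong_bochner_integral M f y" and eq: "AE x in M. f x = g x"
  shows "has_strong_bochner_integral M g y"
proof -
  from assms obtain s where f: "strongly_measurable M f"
    and s: "\<And>i. Bochner_Integration.simple_bochner_integrable M (s i)"
    and lim: "(\<lambda>i. L1_norm M (\<lambda>x. f x - s i x)) \<longlonglongrightarrow> 0"
    and y: "(\<lambda>i. Bochner_Integration.simple_bochner_integral M (s i)) \<longlonglongrightarrow> y"
    unfolding has_strong_bochner_integral_def by blast
  have "L1_norm M (\<lambda>x. f x - s i x) = L1_norm M (\<lambda>x. g x - s i x)" for i
    using eq by (intro nn_integral_cong_AE) auto
  with s lim y strongly_measurable_cong_AE[OF f eq] show ?thesis
    unfolding has_strong_bochner_integral_def by auto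
qed

lemma (in complete_measure) has_strong_bochner_integral_unique:
  fixes f :: "'a \<Rightarrow> 'b::real_normed_vector"
  assumes "has_strong_bochner_integral M f y" "has_strong_bochner_integral M f z"
  shows "y = z"
proof -
  have "has_strong_bochner_integral M (\<lambda>x. f x + - f x) (y + - z)"
    by (intro has_strong_bochner_integral_add assms
        has_strong_bochner_integral_bounded_linear[where h=uminus] bounded_linear_minus bounded_linear_ident)
  from norm_has_strong_bochner_integral_le[OF this] show ?thesis
    by simp
qed

definition strongly_integrable :: "'a measure \<Rightarrow> ('a \<Rightarrow> 'b::real_normed_vector) \<Rightarrow> bool" where
  "strongly_integrable M f \<longleftrightarrow> strongly_measurable M f \<and> L1_norm M f < \<infinity>"

definition strong_integral :: "'a measure \<Rightarrow> ('a \<Rightarrow> 'b::real_normed_vector) \<Rightarrow> 'b" where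
  "strong_integral M f = (THE y. has_strong_bochner_integral M f y)"

text \<open>
  Truncating the approximating simple functions where their norm exceeds \<open>2 \<parallel>f\<parallel>\<close> keeps the pointwise limit
  and makes \<open>3 \<parallel>f\<parallel>\<close> a dominating function, so they converge to \<open>f\<close> in \<open>L\<^sup>1\<close> and their integrals form a
  Cauchy sequence.
\<close>

lemma (in complete_measure) strongly_integrable_has_integral:
  fixes f :: "'a \<Rightarrow> 'b::banach"
  assumes "strongly_integrable M f"
  shows "has_strong_bochner_integral M f (strong_integral M f)"
proof -
  from assms have f: "strongly_measurable M f" and fin: "L1_norm M f < \<infinity>"
    unfolding strongly_integrable_def by auto
  have [measurable]: "(\<lambda>x. norm (f x)) \<in> borel_measurable M"
    using f by (rule borel_measurable_norm_strongly_measurable)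
  from f obtain s where s: "\<And>i. simple_function M (s i)" "AE x in M. (\<lambda>i. s i x) \<longlonglongrightarrow> f x"
    unfolding strongly_measurable_def by auto
  \<comment> \<open>where \<open>f\<close> vanishes, \<open>r\<close> vanishes too, so the limit is kept there as well\<close>
  define r where "r i x = (if norm (s i x) \<le> 2 * norm (f x) then s i x else 0)" for i x
  have r_sf: "simple_function M (r i)" for i
  proof -
    have [measurable]: "(\<lambda>x. norm (s i x)) \<in> borel_measurable M"
      by (rule borel_measurable_simple_function[OF simple_function_compose1[OF s(1)]])
    show ?thesis
      unfolding r_def by (rule simple_function_If[OF s(1) simple_function_const]) measurable
  qed
  have r_bound: "norm (r i x) \<le> 2 * norm (f x)" for i x
    by (auto simp: r_def)
  have r_lim: "AE x in M. (\<lambda>i. r i x) \<longlonglongrightarrow> f x"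
    using s(2)
  proof eventually_elim
    fix x assume x: "(\<lambda>i. s i x) \<longlonglongrightarrow> f x"
    show "(\<lambda>i. r i x) \<longlonglongrightarrow> f x"
    proof (cases "f x = 0")
      case True
      then have "r i x = 0" for i by (simp add: r_def)
      with True show ?thesis by simp
    next
      case False
      then have "\<forall>\<^sub>F i in sequentially. norm (s i x) < 2 * norm (f x)"
        using order_tendstoD(2)[OF tendsto_norm[OF x], of "2 * norm (f x)"] by auto
      then have "\<forall>\<^sub>F i in sequentially. s i x = r i x"
        by eventually_elim (auto simp: r_def)
      then show ?thesis
        using x by (rule Lim_transform_eventually[rotated])
    qed
  qed
  have r_sm: "strongly_measurable M (r i)" for i
    using r_sf by (rule strongly_measurable_simple_function)
  have r_int: "Bochner_Integration.simple_bochner_integrable M (r i)" for i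
  proof (rule simple_bochner_integrableI_bounded[OF r_sf])
    have "L1_norm M (\<lambda>x. r i x) \<le> (\<integral>\<^sup>+x. 2 * ennreal (norm (f x)) \<partial>M)"
      using r_bound by (intro nn_integral_mono) (metis ennreal_leI ennreal_mult' ennreal_numeral zero_le_numeral)
    also have "\<dots> = 2 * L1_norm M f"
      by (rule nn_integral_cmult) simp
    also have "\<dots> < \<infinity>"
      using fin by (simp add: ennreal_mult_less_top)
    finally show "L1_norm M (\<lambda>x. r i x) < \<infinity>" .
  qed
  have lim: "(\<lambda>i. L1_norm M (\<lambda>x. f x - r i x)) \<longlonglongrightarrow> 0"
  proof -
    have "(\<lambda>i. L1_norm M (\<lambda>x. f x - r i x)) \<longlonglongrightarrow> (\<integral>\<^sup>+x. 0 \<partial>M)"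
    proof (rule nn_integral_dominated_convergence[where w="\<lambda>x. 3 * ennreal (norm (f x))"])
      show "(\<lambda>x. ennreal (norm (f x - r i x))) \<in> borel_measurable M" for i
        using borel_measurable_norm_strongly_measurable[OF strongly_measurable_diff[OF f r_sm]] by measurable
      show "AE x in M. ennreal (norm (f x - r i x)) \<le> 3 * ennreal (norm (f x))" for i
      proof (rule AE_I2)
        fix x
        have "norm (f x - r i x) \<le> 3 * norm (f x)"
          using norm_triangle_ineq4[of "f x" "r i x"] r_bound[of i x] by linarith
        then show "ennreal (norm (f x - r i x)) \<le> 3 * ennreal (norm (f x))"
          by (metis ennreal_leI ennreal_mult' ennreal_numeral zero_le_numeral)
      qed
      show "(\<integral>\<^sup>+x. 3 * ennreal (norm (f x)) \<partial>M) < \<infinity>"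
        using fin by (subst nn_integral_cmult) (auto simp: ennreal_mult_less_top)
      show "AE x in M. (\<lambda>i. ennreal (norm (f x - r i x))) \<longlonglongrightarrow> 0"
        using r_lim
      proof eventually_elim
        fix x assume "(\<lambda>i. r i x) \<longlonglongrightarrow> f x"
        then have "(\<lambda>i. norm (f x - r i x)) \<longlonglongrightarrow> norm (f x - f x)"
          by (intro tendsto_intros)
        then show "(\<lambda>i. ennreal (norm (f x - r i x))) \<longlonglongrightarrow> 0"
          using tendsto_ennrealI by fastforce
      qed
    qed auto
    then show ?thesis by simp
  qed
  have "Cauchy (\<lambda>i. Bochner_Integration.simple_bochner_integral M (r i))"
  proof (rule metric_CauchyI)
    fix e :: real assume "0 < e"
    then have "\<forall>\<^sub>F i in sequentially. L1_norm M (\<lambda>x. f x - r i x) < ennreal (e / 2)"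
      by (intro order_tendstoD(2)[OF lim]) auto
    then obtain N where N: "\<And>i. i \<ge> N \<Longrightarrow> L1_norm M (\<lambda>x. f x - r i x) < ennreal (e / 2)"
      unfolding eventually_sequentially by blast
    have "dist (Bochner_Integration.simple_bochner_integral M (r i)) (Bochner_Integration.simple_bochner_integral M (r j)) < e" if ij: "i \<ge> N" "j \<ge> N" for i j
    proof -
      have "ennreal (norm (Bochner_Integration.simple_bochner_integral M (r i) - Bochner_Integration.simple_bochner_integral M (r j))) =
          ennreal (norm (Bochner_Integration.simple_bochner_integral M (\<lambda>x. r i x - r j x)))"
        using r_int by (simp add: simple_bochner_integral_diff)
      also have "\<dots> \<le> L1_norm M (\<lambda>x. r i x - r j x)"
        using simple_bochner_integrable_compose2[of "(-)", OF _ r_int r_int]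
        by (intro simple_bochner_integral_norm_le_nn_integral) simp
      also have "\<dots> \<le> L1_norm M (\<lambda>x. r i x - f x) + L1_norm M (\<lambda>x. f x - r j x)"
        using nn_integral_norm_add_le[OF strongly_measurable_diff[OF r_sm[of i] f] strongly_measurable_diff[OF f r_sm[of j]]]
        by simp
      also have "\<dots> < ennreal (e / 2) + ennreal (e / 2)"
        using N[OF ij(1)] N[OF ij(2)] by (intro add_strict_mono) (auto simp: norm_minus_commute)
      also have "\<dots> = ennreal e"
        using \<open>0 < e\<close> by (simp flip: ennreal_plus)
      finally show ?thesis
        using \<open>0 < e\<close> by (simp add: dist_norm ennreal_less_iff)
    qed
    then show "\<exists>N. \<forall>i\<ge>N. \<forall>j\<ge>N. dist (Bochner_Integration.simple_bochner_integral M (r i)) (Bochner_Integration.simple_bochner_integral M (r j)) < e"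
      by blast
  qed
  then obtain y where "(\<lambda>i. Bochner_Integration.simple_bochner_integral M (r i)) \<longlonglongrightarrow> y"
    using Cauchy_convergent_iff convergent_def by blast
  then have y: "has_strong_bochner_integral M f y"
    unfolding has_strong_bochner_integral_def using f r_int lim by blast
  then show ?thesis
    unfolding strong_integral_def by (rule theI) (rule has_strong_bochner_integral_unique[OF _ y])
qed

lemma (in complete_measure) strong_integral_eq:
  fixes f :: "'a \<Rightarrow> 'b::banach"
  shows "has_strong_bochner_integral M f y \<Longrightarrow> strong_integral M f = y"
  unfolding strong_integral_def by (blast intro: has_strong_bochner_integral_unique)

lemma (in complete_measure) norm_strong_integral_le:
  fixes f :: "'a \<Rightarrow> 'b::banach"
  assumes f: "strongly_measurable M f" and le: "L1_norm M f \<le> ennreal c" and "0 \<le> c"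
  shows "strongly_integrable M f" "norm (strong_integral M f) \<le> c"
proof -
  show int: "strongly_integrable M f"
    unfolding strongly_integrable_def using f le by (auto simp: less_top[symmetric] top_unique)
  show "norm (strong_integral M f) \<le> c"
    using order_trans[OF norm_has_strong_bochner_integral_le[OF strongly_integrable_has_integral[OF int]] le] \<open>0 \<le> c\<close>
    by simp
qed

lemma (in complete_measure) strongly_integrable_bounded_linear:
  fixes f :: "'a \<Rightarrow> 'b::banach" and h :: "'b \<Rightarrow> 'c::banach"
  assumes h: "bounded_linear h" and f: "strongly_integrable M f"
  shows "strongly_integrable M (\<lambda>x. h (f x))"
    "strong_integral M (\<lambda>x. h (f x)) = h (strong_integral M f)"
proof -
  interpret h: bounded_linear h by fact
  obtain C where C: "C > 0" "\<And>v. norm (h v) \<le> norm v * C"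
    using h.pos_bounded by blast
  have [measurable]: "(\<lambda>x. norm (f x)) \<in> borel_measurable M"
    using f unfolding strongly_integrable_def by (auto intro: borel_measurable_norm_strongly_measurable)
  have "L1_norm M (\<lambda>x. h (f x)) \<le> (\<integral>\<^sup>+x. ennreal C * ennreal (norm (f x)) \<partial>M)"
    using C by (intro nn_integral_mono) (simp add: ennreal_mult[symmetric] mult.commute)
  also have "\<dots> < \<infinity>"
    using f unfolding strongly_integrable_def by (subst nn_integral_cmult) (auto simp: ennreal_mult_less_top)
  finally show "strongly_integrable M (\<lambda>x. h (f x))"
    using f h unfolding strongly_integrable_def by (auto intro: strongly_measurable_bounded_linear)
  show "strong_integral M (\<lambda>x. h (f x)) = h (strong_integral M f)"
    by (rule strong_integral_eq[OF has_strong_bochner_integral_bounded_linear[OF h strongly_integrable_has_integral[OF f]]])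
qed

lemma (in complete_measure) strongly_integrable_add:
  fixes f g :: "'a \<Rightarrow> 'b::banach"
  assumes f: "strongly_integrable M f" and g: "strongly_integrable M g"
  shows "strongly_integrable M (\<lambda>x. f x + g x)"
    "strong_integral M (\<lambda>x. f x + g x) = strong_integral M f + strong_integral M g"
proof -
  have "L1_norm M (\<lambda>x. f x + g x) < \<infinity>"
    using f g nn_integral_norm_add_le[of f g] unfolding strongly_integrable_def
    by (auto simp: order_le_less_trans)
  then show "strongly_integrable M (\<lambda>x. f x + g x)"
    using f g unfolding strongly_integrable_def by (auto intro: strongly_measurable_add)
  show "strong_integral M (\<lambda>x. f x + g x) = strong_integral M f + strong_integral M g"
    by (rule strong_integral_eq[OF has_strong_bochner_integral_add[OF strongly_integrable_has_integral[OF f] strongly_integrable_has_integral[OF g]]])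
qed

lemma (in complete_measure) strongly_integrable_diff:
  fixes f g :: "'a \<Rightarrow> 'b::banach"
  assumes f: "strongly_integrable M f" and g: "strongly_integrable M g"
  shows "strongly_integrable M (\<lambda>x. f x - g x)"
    "strong_integral M (\<lambda>x. f x - g x) = strong_integral M f - strong_integral M g"
  using strongly_integrable_add[OF f strongly_integrable_bounded_linear(1)[OF bounded_linear_minus[OF bounded_linear_ident] g]]
    strongly_integrable_bounded_linear(2)[OF bounded_linear_minus[OF bounded_linear_ident] g]
  by auto

lemma (in complete_measure) strong_integral_cong_AE:
  fixes f g :: "'a \<Rightarrow> 'b::banach"
  assumes f: "strongly_integrable M f" and eq: "AE x in M. f x = g x"
  shows "strongly_integrable M g" "strong_integral M g = strong_integral M f"
proof -
  have "L1_norm M f = L1_norm M g"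
    using eq by (intro nn_integral_cong_AE) auto
  then show "strongly_integrable M g"
    using f strongly_measurable_cong_AE[OF _ eq] unfolding strongly_integrable_def by auto
  show "strong_integral M g = strong_integral M f"
    by (rule strong_integral_eq[OF has_strong_bochner_integral_cong_AE[OF strongly_integrable_has_integral[OF f] eq]])
qed

lemma (in complete_measure) strong_integral_dominated_convergence:
  fixes f :: "nat \<Rightarrow> 'a \<Rightarrow> 'b::banach"
  assumes f: "\<And>i. strongly_measurable M (f i)" and lim: "AE x in M. (\<lambda>i. f i x) \<longlonglongrightarrow> g x"
    and h: "h \<in> borel_measurable M" "(\<integral>\<^sup>+x. ennreal (h x) \<partial>M) < \<infinity>"
    and bound: "\<And>i. AE x in M. norm (f i x) \<le> h x"
  shows "(\<lambda>i. strong_integral M (f i)) \<longlonglongrightarrow> strong_integral M g"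
proof -
  have g: "strongly_measurable M g"
    using f lim by (rule strongly_measurable_LIMSEQ)
  have bound_all: "AE x in M. \<forall>i. norm (f i x) \<le> h x"
    unfolding AE_all_countable using bound by blast
  have gb: "AE x in M. norm (g x) \<le> h x"
    using bound_all lim
  proof eventually_elim
    fix x assume "\<forall>i. norm (f i x) \<le> h x" "(\<lambda>i. f i x) \<longlonglongrightarrow> g x"
    then show "norm (g x) \<le> h x"
      by (intro LIMSEQ_le_const2[OF tendsto_norm]) auto
  qed
  have fi: "strongly_integrable M (f i)" for i
  proof -
    have "L1_norm M (\<lambda>x. f i x) \<le> (\<integral>\<^sup>+x. ennreal (h x) \<partial>M)"
      using bound[of i] by (intro nn_integral_mono_AE) (auto intro: ennreal_leI)
    with h f show ?thesis unfolding strongly_integrable_def by auto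
  qed
  have gi: "strongly_integrable M g"
  proof -
    have "L1_norm M g \<le> (\<integral>\<^sup>+x. ennreal (h x) \<partial>M)"
      using gb by (intro nn_integral_mono_AE) (auto intro: ennreal_leI)
    with h g show ?thesis unfolding strongly_integrable_def by auto
  qed
  have "(\<lambda>i. L1_norm M (\<lambda>x. f i x - g x)) \<longlonglongrightarrow> (\<integral>\<^sup>+x. 0 \<partial>M)"
  proof (rule nn_integral_dominated_convergence[where w="\<lambda>x. 2 * ennreal (h x)"])
    show "(\<lambda>x. ennreal (norm (f i x - g x))) \<in> borel_measurable M" for i
      using borel_measurable_norm_strongly_measurable[OF strongly_measurable_diff[OF f g]] by measurable
    show "(\<lambda>x. 2 * ennreal (h x)) \<in> borel_measurable M"
      using h(1) by measurable
    show "AE x in M. ennreal (norm (f i x - g x)) \<le> 2 * ennreal (h x)" for i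
      using bound[of i] gb
    proof eventually_elim
      fix x assume "norm (f i x) \<le> h x" "norm (g x) \<le> h x"
      then have "norm (f i x - g x) \<le> 2 * h x"
        using norm_triangle_ineq4[of "f i x" "g x"] by linarith
      then show "ennreal (norm (f i x - g x)) \<le> 2 * ennreal (h x)"
        by (metis ennreal_leI ennreal_mult' ennreal_numeral zero_le_numeral)
    qed
    show "(\<integral>\<^sup>+x. 2 * ennreal (h x) \<partial>M) < \<infinity>"
      using h by (subst nn_integral_cmult) (auto simp: ennreal_mult_less_top)
    show "AE x in M. (\<lambda>i. ennreal (norm (f i x - g x))) \<longlonglongrightarrow> 0"
      using lim
    proof eventually_elim
      fix x assume "(\<lambda>i. f i x) \<longlonglongrightarrow> g x"
      then have "(\<lambda>i. norm (f i x - g x)) \<longlonglongrightarrow> norm (g x - g x)"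
        by (intro tendsto_intros)
      then show "(\<lambda>i. ennreal (norm (f i x - g x))) \<longlonglongrightarrow> 0"
        using tendsto_ennrealI by fastforce
    qed
  qed auto
  then have lim0: "(\<lambda>i. L1_norm M (\<lambda>x. f i x - g x)) \<longlonglongrightarrow> 0"
    by simp
  have le: "ennreal (norm (strong_integral M (f i) - strong_integral M g)) \<le>
      L1_norm M (\<lambda>x. f i x - g x)" for i
    using norm_has_strong_bochner_integral_le[OF strongly_integrable_has_integral[OF strongly_integrable_diff(1)[OF fi[of i] gi]]]
    by (simp add: strongly_integrable_diff(2)[OF fi gi])
  have "(\<lambda>i. ennreal (norm (strong_integral M (f i) - strong_integral M g))) \<longlonglongrightarrow> 0"
    by (rule tendsto_sandwich[OF _ _ tendsto_const lim0]) (auto intro!: always_eventually le)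
  then have "(\<lambda>i. norm (strong_integral M (f i) - strong_integral M g)) \<longlonglongrightarrow> 0"
    by (subst (asm) ennreal_tendsto_0_iff) auto
  then show ?thesis
    using LIM_zero_iff tendsto_norm_zero_iff by blast
qed

lemma complete_measure_lebesgue_on:
  assumes S: "S \<in> sets lebesgue"
  shows "complete_measure (lebesgue_on S)"
proof
  fix A B :: "'a set"
  assume "A \<subseteq> B" "B \<in> null_sets (lebesgue_on S)"
  then have "A \<subseteq> S" "B \<in> null_sets lebesgue"
    using S by (auto simp: null_sets_restrict_space)
  moreover from this(2) have "A \<in> sets lebesgue"
    using completion.complete[OF \<open>A \<subseteq> B\<close>] by auto
  ultimately show "A \<in> sets (lebesgue_on S)"
    using S by (simp add: sets_restrict_space_iff)
qed

lemma has_strong_bochner_integral_lebesgue_on: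
  fixes f :: "'a::euclidean_space \<Rightarrow> 'b::real_normed_vector"
  assumes S: "S \<in> sets lebesgue" and int: "has_strong_bochner_integral (lebesgue_on S) f y"
  shows "has_strong_bochner_integral lebesgue (\<lambda>x. indicator S x *\<^sub>R f x) y"
proof -
  have S': "S \<inter> space lebesgue \<in> sets lebesgue"
    using S by simp
  have ind: "ennreal (norm (indicator S x *\<^sub>R s x - indicator S x *\<^sub>R r x)) = ennreal (norm (s x - r x)) * indicator S x" for x and s r :: "'a \<Rightarrow> 'b"
    by (auto simp: indicator_def)
  have norm_eq: "L1_norm (lebesgue_on S) (\<lambda>x. f x - s x) =
      L1_norm lebesgue (\<lambda>x. indicator S x *\<^sub>R f x - indicator S x *\<^sub>R s x)" for s
    unfolding nn_integral_restrict_space[OF S'] ind ..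
  from has_strong_bochner_integral_strongly_measurable[OF int]
  obtain a where a: "\<And>i. simple_function (lebesgue_on S) (a i)"
      "AE x in lebesgue_on S. (\<lambda>i. a i x) \<longlonglongrightarrow> f x"
    unfolding strongly_measurable_def by auto
  from int obtain s where s: "\<And>i. Bochner_Integration.simple_bochner_integrable (lebesgue_on S) (s i)"
    and lim: "(\<lambda>i. L1_norm (lebesgue_on S) (\<lambda>x. f x - s i x)) \<longlonglongrightarrow> 0"
    and y: "(\<lambda>i. Bochner_Integration.simple_bochner_integral (lebesgue_on S) (s i)) \<longlonglongrightarrow> y"
    unfolding has_strong_bochner_integral_def by blast
  have "AE x in lebesgue. (\<lambda>i. indicator S x *\<^sub>R a i x) \<longlonglongrightarrow> indicator S x *\<^sub>R f x"
    using a(2) unfolding AE_restrict_space_iff[OF S'] by eventually_elim (auto simp: indicator_def)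
  moreover have "simple_function lebesgue (\<lambda>x. indicator S x *\<^sub>R a i x)" for i
    using a(1) unfolding simple_function_restrict_space[OF S'] .
  ultimately have "strongly_measurable lebesgue (\<lambda>x. indicator S x *\<^sub>R f x)"
    unfolding strongly_measurable_def by (intro exI[of _ "\<lambda>i x. indicator S x *\<^sub>R a i x"]) auto
  moreover have "Bochner_Integration.simple_bochner_integrable lebesgue (\<lambda>x. indicator S x *\<^sub>R s i x)" for i
    using s unfolding simple_bochner_integrable_restrict_space[OF S'] .
  moreover have "(\<lambda>i. Bochner_Integration.simple_bochner_integral lebesgue (\<lambda>x. indicator S x *\<^sub>R s i x)) \<longlonglongrightarrow> y"
    using y unfolding simple_bochner_integral_restrict_space[OF S' s] .
  ultimately show ?thesis
    unfolding has_strong_bochner_integral_def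
    using lim[unfolded norm_eq] by (intro conjI exI[of _ "\<lambda>i x. indicator S x *\<^sub>R s i x"]) auto
qed

text \<open>
  Together with the preceding lemma this reduces integrals over a set to integrals over the whole
  space, where all computations below are done.
\<close>

lemma strongly_integrable_lebesgue_on:
  fixes f :: "'a::euclidean_space \<Rightarrow> 'b::banach"
  assumes S: "S \<in> sets lebesgue" and int: "strongly_integrable lebesgue (\<lambda>x. indicator S x *\<^sub>R f x)"
  shows "has_strong_bochner_integral (lebesgue_on S) f (strong_integral lebesgue (\<lambda>x. indicator S x *\<^sub>R f x))"
proof -
  interpret S: complete_measure "lebesgue_on S"
    using S by (rule complete_measure_lebesgue_on)
  have S': "S \<inter> space lebesgue \<in> sets lebesgue"
    using S by simp
  from int obtain a where a: "\<And>i. simple_function lebesgue (a i)"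
      "AE x in lebesgue. (\<lambda>i. a i x) \<longlonglongrightarrow> indicator S x *\<^sub>R f x"
    unfolding strongly_integrable_def strongly_measurable_def by blast
  have "simple_function (lebesgue_on S) (a i)" for i
    unfolding simple_function_restrict_space[OF S']
    by (rule simple_function_compose2[OF simple_function_indicator[OF S] a(1)])
  moreover have "AE x in lebesgue_on S. (\<lambda>i. a i x) \<longlonglongrightarrow> f x"
    unfolding AE_restrict_space_iff[OF S'] using a(2) by eventually_elim (auto simp: indicator_def)
  ultimately have "strongly_measurable (lebesgue_on S) f"
    unfolding strongly_measurable_def by blast
  moreover have "ennreal (norm (indicator S x *\<^sub>R f x)) = ennreal (norm (f x)) * indicator S x" for x
    by (auto simp: indicator_def)
  then have "L1_norm (lebesgue_on S) f = L1_norm lebesgue (\<lambda>x. indicator S x *\<^sub>R f x)"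
    unfolding nn_integral_restrict_space[OF S'] by simp
  ultimately have "strongly_integrable (lebesgue_on S) f"
    using int unfolding strongly_integrable_def by simp
  then have *: "has_strong_bochner_integral (lebesgue_on S) f (strong_integral (lebesgue_on S) f)"
    by (rule S.strongly_integrable_has_integral)
  with completion.strong_integral_eq[OF has_strong_bochner_integral_lebesgue_on[OF S *]] show ?thesis
    by simp
qed

section \<open>Uniform boundedness\<close>

text \<open>
  The Banach--Steinhaus theorem: by Baire's theorem one of the closed sets \<open>{x. \<forall>i\<in>I. \<parallel>F i x\<parallel> \<le> n}\<close> contains a
  ball, and linearity carries the bound from that ball to the unit ball.
\<close>

theorem uniform_boundedness:
  fixes F :: "'i \<Rightarrow> 'a::banach \<Rightarrow>\<^sub>L 'b::real_normed_vector"
  assumes bdd: "\<And>x. \<exists>c. \<forall>i\<in>I. norm (F i x) \<le> c"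
  shows "\<exists>C. \<forall>i\<in>I. norm (F i) \<le> C"
proof -
  define T where "T n = {x. \<forall>i\<in>I. norm (F i x) \<le> real n}" for n
  have closed: "closed (T n)" for n
  proof -
    have "T n = (\<Inter>i\<in>I. {x. norm (F i x) \<le> real n})"
      by (auto simp: T_def)
    then show ?thesis
      by (auto intro!: closed_INT closed_Collect_le continuous_intros)
  qed
  have cover: "(\<Union>n. T n) = UNIV"
  proof -
    have "x \<in> (\<Union>n. T n)" for x
    proof -
      obtain c where "\<forall>i\<in>I. norm (F i x) \<le> c" using bdd by blast
      moreover obtain n where "c \<le> real n" using real_arch_simple by blast
      ultimately have "x \<in> T n" by (auto simp: T_def intro: order_trans)
      then show ?thesis by blast
    qed
    then show ?thesis by blast
  qed
  have "\<exists>n. interior (T n) \<noteq> {}"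
  proof (rule ccontr)
    assume *: "\<not> (\<exists>n. interior (T n) \<noteq> {})"
    have "euclidean interior_of (\<Union>(range T)) = {}"
      by (rule Baire_category_alt)
        (use * closed in \<open>auto simp: completely_metrizable_space_euclidean\<close>)
    then show False
      by (simp add: cover)
  qed
  then obtain n x0 where "x0 \<in> interior (T n)" by blast
  then obtain r where r: "r > 0" "cball x0 r \<subseteq> T n"
    by (meson mem_interior_cball)
  have "norm (F i) \<le> 2 * real n / r" if i: "i \<in> I" for i
  proof (rule norm_blinfun_bound)
    show "0 \<le> 2 * real n / r" using r by simp
    fix v
    show "norm (F i v) \<le> 2 * real n / r * norm v"
    proof (cases "v = 0")
      case False
      define u where "u = (r / norm v) *\<^sub>R v"
      have "norm u = r" using False r by (simp add: u_def)
      then have "x0 + u \<in> T n" "x0 \<in> T n"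
        using r by (auto simp: dist_norm)
      then have "norm (F i (x0 + u)) \<le> n" "norm (F i x0) \<le> n"
        using i by (auto simp: T_def)
      moreover have Fu: "F i u = F i (x0 + u) - F i x0"
        by (simp add: blinfun.add_right)
      ultimately have "norm (F i u) \<le> 2 * real n"
        using norm_triangle_ineq4[of "F i (x0 + u)" "F i x0"] unfolding Fu by linarith
      then have "r / norm v * norm (F i v) \<le> 2 * real n"
        using r by (simp add: u_def blinfun.scaleR_right)
      then show ?thesis
        using False r by (simp add: field_simps)
    qed simp
  qed
  then show ?thesis by blast
qed

lemma strongly_continuous_bounded_on_compact:
  fixes F :: "'p::topological_space \<Rightarrow> 'a::banach \<Rightarrow>\<^sub>L 'b::real_normed_vector"
  assumes "compact S" and cont: "\<And>x. continuous_on S (\<lambda>p. F p x)"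
  obtains C where "C \<ge> 0" "\<And>p. p \<in> S \<Longrightarrow> norm (F p) \<le> C"
proof -
  have "\<exists>c. \<forall>p\<in>S. norm (F p x) \<le> c" for x
    using compact_imp_bounded[OF compact_continuous_image[OF cont[of x] \<open>compact S\<close>]]
    unfolding bounded_iff by auto
  from uniform_boundedness[OF this] obtain C where "\<forall>p\<in>S. norm (F p) \<le> C" by blast
  then show thesis
    by (intro that[of "max C 0"]) auto
qed

lemma tendsto_blinfun_apply_strong:
  fixes T :: "'i \<Rightarrow> 'a::real_normed_vector \<Rightarrow>\<^sub>L 'b::real_normed_vector"
  assumes T: "((\<lambda>i. T i x) \<longlongrightarrow> S x) F" and f: "(f \<longlongrightarrow> x) F"
    and bound: "\<forall>\<^sub>F i in F. norm (T i) \<le> C"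
  shows "((\<lambda>i. T i (f i)) \<longlongrightarrow> S x) F"
proof -
  have "((\<lambda>i. T i (f i - x)) \<longlongrightarrow> 0) F"
  proof (rule Lim_null_comparison)
    show "((\<lambda>i. C * norm (f i - x)) \<longlongrightarrow> 0) F"
      using tendsto_mult_right_zero[OF tendsto_norm_zero[OF LIM_zero[OF f]]] by simp
    show "\<forall>\<^sub>F i in F. norm (T i (f i - x)) \<le> C * norm (f i - x)"
      using bound
      by eventually_elim (meson norm_blinfun mult_right_mono norm_ge_zero order_trans)
  qed
  from tendsto_add[OF this T] show ?thesis
    by (simp add: blinfun.diff_right)
qed

section \<open>Contractions in weighted norms\<close>

text \<open>
  The best constant \<open>m\<close> in \<open>\<parallel>y\<parallel> \<le> m w\<close> satisfies \<open>m \<le> a + q m\<close>.  The existence of some constant is assumed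
  because it makes \<open>m\<close> finite.  With \<open>a = 0\<close> this is a uniqueness statement.
\<close>

lemma weighted_bound_improve:
  fixes y :: "'p \<Rightarrow> 'a::real_normed_vector" and w :: "'p \<Rightarrow> real"
  assumes w: "\<And>p. p \<in> S \<Longrightarrow> w p > 0" and q: "q < 1"
    and y: "\<And>p. p \<in> S \<Longrightarrow> norm (y p) \<le> C0 * w p"
    and step: "\<And>C p. 0 \<le> C \<Longrightarrow> (\<And>p. p \<in> S \<Longrightarrow> norm (y p) \<le> C * w p) \<Longrightarrow> p \<in> S \<Longrightarrow> norm (y p) \<le> (a + q * C) * w p"
    and p: "p \<in> S"
  shows "norm (y p) \<le> a / (1 - q) * w p"
proof -
  define m where "m = (SUP p\<in>S. norm (y p) / w p)"
  have bdd: "bdd_above ((\<lambda>p. norm (y p) / w p) ` S)"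
    using y w by (intro bdd_aboveI[of _ C0]) (auto simp: pos_divide_le_eq)
  have le: "norm (y p) \<le> m * w p" if "p \<in> S" for p
  proof -
    have "norm (y p) / w p \<le> m"
      unfolding m_def using that bdd by (rule cSUP_upper)
    then show ?thesis using w[OF that] by (simp add: pos_divide_le_eq)
  qed
  have "0 \<le> m * w p"
    using le[OF p] norm_ge_zero order_trans by blast
  then have "0 \<le> m"
    using w[OF p] by (simp add: zero_le_mult_iff)
  have "m \<le> a + q * m"
    unfolding m_def
  proof (rule cSUP_least)
    fix p assume "p \<in> S"
    with step[OF \<open>0 \<le> m\<close> le] w show "norm (y p) / w p \<le> a + q * (SUP p\<in>S. norm (y p) / w p)"
      by (simp add: pos_divide_le_eq m_def)
  qed (use p in auto)
  then have "m \<le> a / (1 - q)"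
    using q by (simp add: field_simps)
  then show ?thesis
    using le[OF p] w[OF p] by (meson less_imp_le mult_right_mono order_trans)
qed

text \<open>
  Banach's fixed point theorem for \<open>k \<mapsto> h + T k\<close> in the weighted supremum norm; dividing by \<open>w\<close> turns it into
  a contraction of the space of bounded continuous functions.  Additivity of \<open>T\<close> is asked only on the
  functions bounded by a multiple of \<open>w\<close>, as an integral operator has no good properties elsewhere.
\<close>

lemma weighted_contraction_fixpoint:
  fixes T :: "('p::metric_space \<Rightarrow> 'a::banach) \<Rightarrow> 'p \<Rightarrow> 'a" and w :: "'p \<Rightarrow> real"
  assumes w: "continuous_on UNIV w" "\<And>p. w p > 0" and q: "0 \<le> q" "q < 1"
    and T: "\<And>k C. continuous_on UNIV k \<Longrightarrow> 0 \<le> C \<Longrightarrow> (\<And>p. norm (k p) \<le> C * w p) \<Longrightarrow>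
        continuous_on UNIV (T k) \<and> (\<forall>p. norm (T k p) \<le> q * C * w p)"
    and diff: "\<And>k l C p. continuous_on UNIV k \<Longrightarrow> continuous_on UNIV l \<Longrightarrow> 0 \<le> C \<Longrightarrow>
        (\<And>p. norm (k p) \<le> C * w p) \<Longrightarrow> (\<And>p. norm (l p) \<le> C * w p) \<Longrightarrow>
        T (\<lambda>p. k p - l p) p = T k p - T l p"
    and h: "continuous_on UNIV h" "0 \<le> C0" "\<And>p. norm (h p) \<le> C0 * w p"
  obtains k C where "0 \<le> C" "continuous_on UNIV k" "\<And>p. norm (k p) \<le> C * w p" "\<And>p. k p = h p + T k p"
proof -
  define E where "E \<phi> p = w p *\<^sub>R apply_bcontfun \<phi> p" for \<phi> :: "'p \<Rightarrow>\<^sub>C 'a" and p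
  define \<Phi> where "\<Phi> \<phi> = Bcontfun (\<lambda>p. (h p + T (E \<phi>) p) /\<^sub>R w p)" for \<phi>
  have E_cont: "continuous_on UNIV (E \<phi>)" for \<phi>
    unfolding E_def using w by (intro continuous_intros) auto
  have E_bound: "\<exists>C\<ge>0. \<forall>p. norm (E \<phi> p) \<le> C * w p" for \<phi>
  proof -
    obtain C where "\<And>p. norm (apply_bcontfun \<phi> p) \<le> C"
      using bounded_apply_bcontfun[of \<phi>] unfolding bounded_iff by blast
    moreover from this have "0 \<le> C" using norm_ge_zero order_trans by blast
    ultimately show ?thesis
      using w by (intro exI[of _ C]) (auto simp: E_def abs_of_pos mult.commute intro!: mult_right_mono less_imp_le)
  qed
  have \<Phi>: "apply_bcontfun (\<Phi> \<phi>) p = (h p + T (E \<phi>) p) /\<^sub>R w p" for \<phi> p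
  proof -
    obtain C where C: "C \<ge> 0" "\<And>p. norm (E \<phi> p) \<le> C * w p" using E_bound by blast
    note TE = T[OF E_cont C]
    have "norm ((h p + T (E \<phi>) p) /\<^sub>R w p) \<le> C0 + q * C" for p
    proof -
      have "norm (h p + T (E \<phi>) p) \<le> (C0 + q * C) * w p"
        using norm_triangle_ineq[of "h p" "T (E \<phi>) p"] h(3)[of p] TE by (smt (verit) distrib_right)
      then show ?thesis
        using w(2)[of p] by (simp add: divide_inverse_commute[symmetric] pos_divide_le_eq)
    qed
    then have "bounded (range (\<lambda>p. (h p + T (E \<phi>) p) /\<^sub>R w p))"
      unfolding bounded_iff by blast
    moreover have "continuous_on UNIV (\<lambda>p. (h p + T (E \<phi>) p) /\<^sub>R w p)"
      using TE h(1) w by (intro continuous_intros) (auto simp: less_imp_neq[THEN not_sym])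
    ultimately show ?thesis
      unfolding \<Phi>_def by (subst Bcontfun_inverse) (auto simp: bcontfun_def)
  qed
  have "\<exists>!\<phi>. \<Phi> \<phi> = \<phi>"
  proof (rule banach_fix_type[OF q], intro allI)
    fix \<phi> \<psi>
    show "dist (\<Phi> \<phi>) (\<Phi> \<psi>) \<le> q * dist \<phi> \<psi>"
    proof (rule dist_bound)
      fix p
      obtain C D where CD: "C \<ge> 0" "\<And>p. norm (E \<phi> p) \<le> C * w p" "D \<ge> 0" "\<And>p. norm (E \<psi> p) \<le> D * w p"
        using E_bound by metis
      have "norm (E \<phi> p) \<le> max C D * w p" "norm (E \<psi> p) \<le> max C D * w p" for p
        using CD(2,4)[of p] w(2)[of p] by (meson less_imp_le max.cobounded1 max.cobounded2 mult_right_mono order_trans)+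
      then have d: "T (\<lambda>p. E \<phi> p - E \<psi> p) p = T (E \<phi>) p - T (E \<psi>) p"
        using CD(1) by (intro diff[where C="max C D"] E_cont) auto
      have "norm (E \<phi> p - E \<psi> p) \<le> dist \<phi> \<psi> * w p" for p
        using dist_bounded[of \<phi> p \<psi>] w(2)[of p]
        by (simp add: E_def scaleR_diff_right[symmetric] dist_norm abs_of_pos mult.commute)
      then have "norm (T (E \<phi>) p - T (E \<psi>) p) \<le> q * dist \<phi> \<psi> * w p"
        using T[OF continuous_on_diff[OF E_cont E_cont] zero_le_dist, of \<phi> \<psi> \<phi> \<psi>] unfolding d[symmetric] by blast
      moreover have "\<Phi> \<phi> p - \<Phi> \<psi> p = (T (E \<phi>) p - T (E \<psi>) p) /\<^sub>R w p"
        by (simp add: \<Phi> scaleR_diff_right[symmetric])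
      ultimately show "dist (\<Phi> \<phi> p) (\<Phi> \<psi> p) \<le> q * dist \<phi> \<psi>"
        using w(2)[of p] by (simp add: dist_norm divide_inverse_commute[symmetric] pos_divide_le_eq)
    qed
  qed
  then obtain \<phi> where \<phi>: "\<Phi> \<phi> = \<phi>" by blast
  obtain C where C: "C \<ge> 0" "\<And>p. norm (E \<phi> p) \<le> C * w p" using E_bound by blast
  show thesis
  proof (rule that[OF C(1) E_cont C(2)])
    fix p
    have "apply_bcontfun \<phi> p = (h p + T (E \<phi>) p) /\<^sub>R w p"
      using \<Phi>[of \<phi> p] \<phi> by simp
    then show "E \<phi> p = h p + T (E \<phi>) p"
      using w(2)[of p] by (simp add: E_def)
  qed
qed

section \<open>Volterra equations and the perturbed evolution family\<close>

lemma borel_measurable_lebesgue_continuous: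
  fixes f :: "'a::euclidean_space \<Rightarrow> 'b::topological_space"
  shows "continuous_on UNIV f \<Longrightarrow> f \<in> borel_measurable lebesgue"
  by (intro measurable_completion) (simp add: borel_measurable_continuous_onI)

lemma AE_lebesgue_notin_finite:
  fixes S :: "'a::euclidean_space set"
  shows "finite S \<Longrightarrow> AE x in lebesgue. x \<notin> S"
  by (intro AE_not_in null_sets_completionI countable_imp_null_set_lborel countable_finite)

text \<open>
  Local integrability of \<open>\<parallel>B\<parallel>\<close> makes the variation of constants formula solvable.  In the theorem it follows
  from the finiteness of \<open>\<theta>\<close>.
\<close>

locale perturbed_evolution =
  fixes U :: "real \<Rightarrow> real \<Rightarrow> 'a::banach \<Rightarrow>\<^sub>L 'a" and B :: "real \<Rightarrow> 'a \<Rightarrow>\<^sub>L 'a"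
  assumes U: "evolution_family UNIV U"
    and B_strongly_measurable: "\<And>x. strongly_measurable lebesgue (\<lambda>t. B t x)"
    and B_norm_measurable [measurable]: "(\<lambda>t. norm (B t)) \<in> borel_measurable lebesgue"
    and B_locally_integrable: "\<And>a b. (\<integral>\<^sup>+\<tau>. ennreal (norm (B \<tau>)) * indicator {a..b} \<tau> \<partial>lebesgue) < \<infinity>"
begin

lemma U_refl [simp]: "U t t = id_blinfun"
  using U by (auto simp: evolution_family_def)

lemma U_comp: "s \<le> r \<Longrightarrow> r \<le> t \<Longrightarrow> U t s x = U t r (U r s x)"
  using U unfolding evolution_family_def by (metis UNIV_I blinfun_apply_blinfun_compose)

lemma U_continuous:
  assumes "continuous_on S f" "continuous_on S g" "\<And>p. p \<in> S \<Longrightarrow> g p \<le> f p"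
  shows "continuous_on S (\<lambda>p. U (f p) (g p) x)"
proof -
  have "continuous_on {(t, s). s \<le> t} (\<lambda>(t, s). U t s x)"
    using U by (auto simp: evolution_family_def)
  from continuous_on_compose2[OF this continuous_on_Pair[OF assms(1,2)]] assms(3)
  show ?thesis by auto
qed

lemma U_bounded:
  obtains L where "0 \<le> L" "\<And>t s. a \<le> s \<Longrightarrow> s \<le> t \<Longrightarrow> t \<le> b \<Longrightarrow> norm (U t s) \<le> L"
proof -
  define S where "S = ({a..b} \<times> {a..b}) \<inter> {p::real \<times> real. snd p \<le> fst p}"
  have "compact S"
    unfolding S_def by (intro compact_Int_closed compact_Times closed_Collect_le continuous_intros) auto
  moreover have "continuous_on S (\<lambda>p. U (fst p) (snd p) x)" for x
    unfolding S_def by (intro U_continuous continuous_intros) auto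
  ultimately obtain L where "0 \<le> L" "\<And>p. p \<in> S \<Longrightarrow> norm (U (fst p) (snd p)) \<le> L"
    using strongly_continuous_bounded_on_compact[of S "\<lambda>p. U (fst p) (snd p)"] by blast
  from this(1) this(2)[of "(t, s)" for t s] show thesis
    by (intro that[of L]) (auto simp: S_def)
qed

lemma B_weight_measurable:
  assumes [measurable]: "w \<in> borel_measurable lebesgue"
  shows "(\<lambda>\<tau>. ennreal (c * norm (B \<tau>) * w \<tau>) * indicator {s..t} \<tau>) \<in> borel_measurable lebesgue"
    and "(\<lambda>\<tau>. ennreal (norm (B \<tau>)) * indicator {s..t} \<tau>) \<in> borel_measurable lebesgue"
    and "(\<lambda>\<tau>. c * (norm (B \<tau>) * indicator {s..t} \<tau>)) \<in> borel_measurable lebesgue"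
proof -
  define n where "n \<tau> = norm (B \<tau>)" for \<tau>
  have [measurable]: "n \<in> borel_measurable lebesgue"
    unfolding n_def[abs_def] by (rule B_norm_measurable)
  have [measurable]: "{s..t} \<in> sets lebesgue"
    by simp
  show "(\<lambda>\<tau>. ennreal (c * norm (B \<tau>) * w \<tau>) * indicator {s..t} \<tau>) \<in> borel_measurable lebesgue"
    "(\<lambda>\<tau>. ennreal (norm (B \<tau>)) * indicator {s..t} \<tau>) \<in> borel_measurable lebesgue"
    "(\<lambda>\<tau>. c * (norm (B \<tau>) * indicator {s..t} \<tau>)) \<in> borel_measurable lebesgue"
    unfolding n_def[symmetric] by measurable
qed

lemma strongly_measurable_B_apply:
  "strongly_measurable lebesgue f \<Longrightarrow> strongly_measurable lebesgue (\<lambda>\<tau>. B \<tau> (f \<tau>))"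
  by (rule completion.strongly_measurable_blinfun_apply[where T=B, OF B_strongly_measurable])

definition volterra :: "real \<Rightarrow> (real \<Rightarrow> 'a) \<Rightarrow> real \<Rightarrow> 'a" where
  "volterra s y t = strong_integral lebesgue (\<lambda>\<tau>. indicator {s..t} \<tau> *\<^sub>R U t \<tau> (B \<tau> (y \<tau>)))"

text \<open>
  The assumption speaks of \<open>y\<close> on \<open>[s,t]\<close> only, since solutions are defined, or known to be continuous, only
  there.
\<close>

lemma volterra_integrand_measurable:
  assumes "strongly_measurable lebesgue (\<lambda>\<tau>. indicator {s..t} \<tau> *\<^sub>R y \<tau>)"
  shows "strongly_measurable lebesgue (\<lambda>\<tau>. indicator {s..t} \<tau> *\<^sub>R U t \<tau> (B \<tau> (y \<tau>)))"
proof -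
  have "strongly_measurable lebesgue (\<lambda>\<tau>. U t (min t \<tau>) v)" for v
    by (intro strongly_measurable_continuous_on_real U_continuous continuous_intros) auto
  then have "strongly_measurable lebesgue (\<lambda>\<tau>. U t (min t \<tau>) (B \<tau> (indicator {s..t} \<tau> *\<^sub>R y \<tau>)))"
    by (rule completion.strongly_measurable_blinfun_apply[where T="\<lambda>\<tau>. U t (min t \<tau>)", OF _ strongly_measurable_B_apply[OF assms]])
  moreover have "U t (min t \<tau>) (B \<tau> (indicator {s..t} \<tau> *\<^sub>R y \<tau>)) = indicator {s..t} \<tau> *\<^sub>R U t \<tau> (B \<tau> (y \<tau>))" for \<tau>
    by (auto simp: indicator_def)
  ultimately show ?thesis by simp
qed

lemma strongly_measurable_continuous_on_interval:
  fixes y :: "real \<Rightarrow> 'b::real_normed_vector"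
  assumes "continuous_on {s..t} y"
  shows "strongly_measurable lebesgue (\<lambda>\<tau>. indicator {s..t} \<tau> *\<^sub>R y \<tau>)"
proof (cases "s \<le> t")
  case True
  have "continuous_on UNIV (\<lambda>\<tau>. y (max s (min t \<tau>)))"
    using True by (intro continuous_on_compose2[OF assms]) (auto intro!: continuous_intros)
  then have "strongly_measurable lebesgue (\<lambda>\<tau>. indicator {s..t} \<tau> *\<^sub>R y (max s (min t \<tau>)))"
    by (intro strongly_measurable_indicator strongly_measurable_continuous_on_real) auto
  moreover have "indicator {s..t} \<tau> *\<^sub>R y (max s (min t \<tau>)) = indicator {s..t} \<tau> *\<^sub>R y \<tau>" for \<tau>
    by (auto simp: indicator_def min_def max_def)
  ultimately show ?thesis by simp
qed simp

text \<open>
  The weight is \<open>w = exp(\<mu> F)\<close>, where \<open>F(t)\<close> is the integral of \<open>\<parallel>B\<parallel>\<close> over \<open>[a,t]\<close> and \<open>\<mu>\<close> is large.  It makes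
  the Volterra operator of a kernel bounded by \<open>L\<close> a contraction with constant 1/2: the part of \<open>[s,t]\<close>
  next to \<open>t\<close> that carries a small amount \<open>\<delta>\<close> of mass of \<open>\<parallel>B\<parallel>\<close> contributes little because of that mass, and
  on the rest \<open>w \<le> exp(-\<mu>\<delta>) w(t)\<close>.
\<close>

lemma volterra_weight:
  assumes ab: "a \<le> b" and L: "0 \<le> L"
  obtains w W where "continuous_on UNIV w" "\<And>t. 1 \<le> w t" "\<And>t. w t \<le> W"
    "\<And>s t. a \<le> s \<Longrightarrow> s \<le> t \<Longrightarrow> t \<le> b \<Longrightarrow>
      (\<integral>\<^sup>+\<tau>. ennreal (L * norm (B \<tau>) * w \<tau>) * indicator {s..t} \<tau> \<partial>lebesgue) \<le> ennreal (w t / 2)"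
proof -
  define n where "n \<tau> = norm (B \<tau>)" for \<tau>
  have [measurable]: "n \<in> borel_measurable lebesgue"
    unfolding n_def[abs_def] by measurable
  have n0: "0 \<le> n \<tau>" for \<tau> by (simp add: n_def)
  have ind: "(\<lambda>\<tau>. n \<tau> * indicator {c..t} \<tau>) \<in> borel_measurable lebesgue" for c t
    using B_weight_measurable(3)[of "\<lambda>_. 1" 1] by (simp add: n_def)
  have ind2: "(\<lambda>\<tau>. ennreal (n \<tau>) * indicator {c..t} \<tau>) \<in> borel_measurable lebesgue" for c t
    using B_weight_measurable(2)[of "\<lambda>_. 1"] by (simp add: n_def)
  have eqU: "(\<lambda>\<tau>. if \<tau> \<in> {c..t} then n \<tau> else 0) = (\<lambda>\<tau>. n \<tau> * indicator {c..t} \<tau>)" for c t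
    by (auto simp: indicator_def)
  have nnI: "(\<integral>\<^sup>+\<tau>. ennreal (n \<tau> * indicator {c..t} \<tau>) \<partial>lebesgue) = (\<integral>\<^sup>+\<tau>. ennreal (n \<tau>) * indicator {c..t} \<tau> \<partial>lebesgue)" for c t
    by (intro nn_integral_cong) (auto simp: indicator_def)
  have int: "n integrable_on {c..t}" for c t
  proof -
    have "((\<lambda>\<tau>. n \<tau> * indicator {c..t} \<tau>) has_integral
        enn2real (\<integral>\<^sup>+\<tau>. ennreal (n \<tau>) * indicator {c..t} \<tau> \<partial>lebesgue)) UNIV"
      using B_locally_integrable[of c t, folded n_def] n0 ind
      by (subst has_integral_iff_nn_integral_lebesgue) (auto simp: nnI)
    then show ?thesis
      unfolding eqU[symmetric] has_integral_restrict_UNIV by blast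
  qed
  have nn: "(\<integral>\<^sup>+\<tau>. ennreal (n \<tau>) * indicator {c..t} \<tau> \<partial>lebesgue) = ennreal (integral {c..t} n)" for c t
  proof -
    have "((\<lambda>\<tau>. n \<tau> * indicator {c..t} \<tau>) has_integral (integral {c..t} n)) UNIV"
      unfolding eqU[symmetric] has_integral_restrict_UNIV using int by blast
    then show ?thesis
      using n0 by (subst (asm) has_integral_iff_nn_integral_lebesgue) (auto simp: nnI)
  qed
  define F where "F t = integral {a..t} n" for t
  have F_diff: "integral {c..t} n = F t - F c" if "a \<le> c" "c \<le> t" for c t
    using Henstock_Kurzweil_Integration.integral_combine[OF that int] by (simp add: F_def)
  have F_mono: "F c \<le> F t" if "a \<le> c" "c \<le> t" for c t
    using F_diff[OF that] integral_nonneg[OF int, of c t] n0 by simp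
  have F_cont: "continuous_on {a..b} F"
    unfolding F_def by (rule indefinite_integral_continuous_1[OF int])
  have Fa: "F a = 0" by (simp add: F_def)
  \<comment> \<open>\<open>L \<delta> \<le> 1/4\<close> bounds the part next to \<open>t\<close>, \<open>L F(b) exp(-\<mu>\<delta>) \<le> 1/4\<close> the rest\<close>
  define \<delta> where "\<delta> = 1 / (4 * (L + 1))"
  have \<delta>: "\<delta> > 0" "L * \<delta> \<le> 1 / 4"
    using L by (auto simp: \<delta>_def field_simps)
  define \<mu> where "\<mu> = 4 * L * F b / \<delta>"
  have Fb: "0 \<le> F b" using F_mono[of a b] ab Fa by simp
  have \<mu>: "0 \<le> \<mu>" using L Fb \<delta> by (simp add: \<mu>_def)
  have \<mu>_exp: "L * F b * exp (- (\<mu> * \<delta>)) \<le> 1 / 4"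
  proof -
    have "1 + 4 * L * F b \<le> exp (\<mu> * \<delta>)"
      using exp_ge_add_one_self[of "\<mu> * \<delta>"] \<delta> by (simp add: \<mu>_def)
    then have "4 * (L * F b) \<le> exp (\<mu> * \<delta>)" by linarith
    then show ?thesis
      by (simp add: exp_minus field_simps)
  qed
  define w where "w t = exp (\<mu> * F (max a (min b t)))" for t
  have step: "(\<integral>\<^sup>+\<tau>. ennreal (L * n \<tau> * w \<tau>) * indicator {c..t} \<tau> \<partial>lebesgue) \<le> ennreal (L * w t * (F t - F c))"
    if "a \<le> c" "c \<le> t" "t \<le> b" for c t
  proof -
    have "(\<integral>\<^sup>+\<tau>. ennreal (L * n \<tau> * w \<tau>) * indicator {c..t} \<tau> \<partial>lebesgue) \<le>
        (\<integral>\<^sup>+\<tau>. ennreal (L * w t) * (ennreal (n \<tau>) * indicator {c..t} \<tau>) \<partial>lebesgue)"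
    proof (intro nn_integral_mono)
      fix \<tau>
      show "ennreal (L * n \<tau> * w \<tau>) * indicator {c..t} \<tau> \<le> ennreal (L * w t) * (ennreal (n \<tau>) * indicator {c..t} \<tau>)"
      proof (cases "\<tau> \<in> {c..t}")
        case True
        then have "w \<tau> \<le> w t"
          using that F_mono[of \<tau> t] \<mu> by (auto simp: w_def intro!: mult_left_mono)
        then have "L * n \<tau> * w \<tau> \<le> L * w t * n \<tau>"
          using L n0[of \<tau>] by (simp add: mult.commute mult.left_commute mult_left_mono)
        moreover have "0 \<le> L * w t" using L by (simp add: w_def)
        ultimately show ?thesis
          using True n0[of \<tau>] by (simp add: ennreal_mult[symmetric] ennreal_leI)
      qed simp
    qed
    also have "\<dots> = ennreal (L * w t) * ennreal (F t - F c)"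
      using that by (subst nn_integral_cmult) (auto simp: nn F_diff ind2)
    also have "\<dots> = ennreal (L * w t * (F t - F c))"
      using L F_mono[OF that(1,2)] by (simp add: ennreal_mult w_def)
    finally show ?thesis .
  qed
  show thesis
  proof (rule that)
    show "continuous_on UNIV w"
      unfolding w_def using ab
      by (intro continuous_intros continuous_on_compose2[OF F_cont]) auto
    show "1 \<le> w t" for t
      using F_mono[of a "max a (min b t)"] Fa \<mu> by (simp add: w_def)
    show "w t \<le> exp (\<mu> * F b)" for t
      using F_mono[of "max a (min b t)" b] ab \<mu> by (simp add: w_def mult_left_mono)
    fix s t assume st: "a \<le> s" "s \<le> t" "t \<le> b"
    \<comment> \<open>\<open>c\<close> is where the mass of \<open>\<parallel>B\<parallel>\<close> on \<open>[c,t]\<close> reaches \<open>\<delta>\<close>, or \<open>s\<close> if the mass on \<open>[s,t]\<close> is at most \<open>\<delta>\<close>\<close>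
    obtain c where c: "s \<le> c" "c \<le> t" "F t - F c \<le> \<delta>" "c = s \<or> F c = F t - \<delta>"
    proof (cases "F t - F s \<le> \<delta>")
      case True
      then show thesis using st by (intro that[of s]) auto
    next
      case False
      have "continuous_on {s..t} F"
        using F_cont st by (auto intro: continuous_on_subset)
      then obtain c where "s \<le> c" "c \<le> t" "F c = F t - \<delta>"
        using IVT'[of F s "F t - \<delta>" t] False \<delta> st by auto
      then show thesis by (intro that) auto
    qed
    have w_cl: "w r = exp (\<mu> * F r)" if "a \<le> r" "r \<le> b" for r
      using that by (simp add: w_def)
    have first: "L * w c * (F c - F s) \<le> w t / 4"
    proof (cases "c = s")
      case True
      then show ?thesis by (simp add: w_def)
    next
      case False
      then have Fc: "F c = F t - \<delta>" using c by auto
      have "w c = w t * exp (- (\<mu> * \<delta>))"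
        using c st by (simp add: w_cl Fc right_diff_distrib exp_diff exp_minus divide_inverse)
      moreover have "F c - F s \<le> F b"
        using F_mono[of a s] F_mono[of c b] Fa c st by simp
      ultimately have "L * w c * (F c - F s) \<le> L * (w t * exp (- (\<mu> * \<delta>))) * F b"
        using L by (auto intro!: mult_left_mono simp: w_def)
      also have "\<dots> = w t * (L * F b * exp (- (\<mu> * \<delta>)))" by simp
      also have "\<dots> \<le> w t * (1 / 4)"
        using \<mu>_exp by (intro mult_left_mono) (auto simp: w_def)
      finally show ?thesis by simp
    qed
    have second: "L * w t * (F t - F c) \<le> w t / 4"
    proof -
      have "L * w t * (F t - F c) \<le> L * w t * \<delta>"
        using c L by (intro mult_left_mono) (auto simp: w_def)
      also have "\<dots> = w t * (L * \<delta>)" by simp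
      also have "\<dots> \<le> w t * (1 / 4)"
        using \<delta> by (intro mult_left_mono) (auto simp: w_def)
      finally show ?thesis by simp
    qed
    have w_meas: "w \<in> borel_measurable lebesgue"
      using \<open>continuous_on UNIV w\<close> by (rule borel_measurable_lebesgue_continuous)
    have "(\<integral>\<^sup>+\<tau>. ennreal (L * norm (B \<tau>) * w \<tau>) * indicator {s..t} \<tau> \<partial>lebesgue) \<le>
        (\<integral>\<^sup>+\<tau>. ennreal (L * n \<tau> * w \<tau>) * indicator {s..c} \<tau> + ennreal (L * n \<tau> * w \<tau>) * indicator {c..t} \<tau> \<partial>lebesgue)"
      using c by (intro nn_integral_mono) (auto simp: indicator_def n_def)
    also have "\<dots> = (\<integral>\<^sup>+\<tau>. ennreal (L * n \<tau> * w \<tau>) * indicator {s..c} \<tau> \<partial>lebesgue) +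
        (\<integral>\<^sup>+\<tau>. ennreal (L * n \<tau> * w \<tau>) * indicator {c..t} \<tau> \<partial>lebesgue)"
      using B_weight_measurable(1)[OF w_meas] unfolding n_def by (intro nn_integral_add)
    also have "\<dots> \<le> ennreal (L * w c * (F c - F s)) + ennreal (L * w t * (F t - F c))"
      using c st by (intro add_mono step) auto
    also have "\<dots> \<le> ennreal (w t / 4) + ennreal (w t / 4)"
      using first second by (intro add_mono ennreal_leI)
    also have "\<dots> = ennreal (w t / 2)"
      by (subst ennreal_plus[symmetric]) (auto simp: w_def)
    finally show "(\<integral>\<^sup>+\<tau>. ennreal (L * norm (B \<tau>) * w \<tau>) * indicator {s..t} \<tau> \<partial>lebesgue) \<le> ennreal (w t / 2)" .
  qed
qed

lemma volterra_bound:
  assumes y: "strongly_measurable lebesgue (\<lambda>\<tau>. indicator {s..t} \<tau> *\<^sub>R y \<tau>)" "0 \<le> C"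
      "\<And>\<tau>. s \<le> \<tau> \<Longrightarrow> \<tau> \<le> t \<Longrightarrow> norm (y \<tau>) \<le> C * w \<tau>"
    and L: "0 \<le> L" "\<And>\<tau>. s \<le> \<tau> \<Longrightarrow> \<tau> \<le> t \<Longrightarrow> norm (U t \<tau>) \<le> L"
    and w: "w \<in> borel_measurable lebesgue" "\<And>\<tau>. 0 \<le> w \<tau>"
      "(\<integral>\<^sup>+\<tau>. ennreal (L * norm (B \<tau>) * w \<tau>) * indicator {s..t} \<tau> \<partial>lebesgue) \<le> ennreal m" "0 \<le> m"
  shows "strongly_integrable lebesgue (\<lambda>\<tau>. indicator {s..t} \<tau> *\<^sub>R U t \<tau> (B \<tau> (y \<tau>)))"
    and "norm (volterra s y t) \<le> C * m"
proof -
  have "L1_norm lebesgue (\<lambda>\<tau>. indicator {s..t} \<tau> *\<^sub>R U t \<tau> (B \<tau> (y \<tau>))) \<le>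
      (\<integral>\<^sup>+\<tau>. ennreal C * (ennreal (L * norm (B \<tau>) * w \<tau>) * indicator {s..t} \<tau>) \<partial>lebesgue)"
  proof (intro nn_integral_mono)
    fix \<tau>
    show "ennreal (norm (indicator {s..t} \<tau> *\<^sub>R U t \<tau> (B \<tau> (y \<tau>)))) \<le>
        ennreal C * (ennreal (L * norm (B \<tau>) * w \<tau>) * indicator {s..t} \<tau>)"
    proof (cases "\<tau> \<in> {s..t}")
      case True
      have "norm (U t \<tau> (B \<tau> (y \<tau>))) \<le> norm (U t \<tau>) * (norm (B \<tau>) * norm (y \<tau>))"
        by (meson norm_blinfun mult_left_mono norm_ge_zero order_trans)
      also have "\<dots> \<le> L * (norm (B \<tau>) * (C * w \<tau>))"
        using True L y by (intro mult_mono) auto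
      finally show ?thesis
        using True y(2) L(1) w(2)[of \<tau>] by (simp add: ennreal_mult[symmetric] ennreal_leI mult_ac)
    qed simp
  qed
  also have "\<dots> = ennreal C * (\<integral>\<^sup>+\<tau>. ennreal (L * norm (B \<tau>) * w \<tau>) * indicator {s..t} \<tau> \<partial>lebesgue)"
    by (intro nn_integral_cmult B_weight_measurable w(1))
  also have "\<dots> \<le> ennreal C * ennreal m"
    using w(3) by (intro mult_left_mono) auto
  also have "\<dots> = ennreal (C * m)"
    using y w by (simp add: ennreal_mult)
  finally have le: "L1_norm lebesgue (\<lambda>\<tau>. indicator {s..t} \<tau> *\<^sub>R U t \<tau> (B \<tau> (y \<tau>))) \<le> ennreal (C * m)" .
  note * = completion.norm_strong_integral_le[OF volterra_integrand_measurable[OF y(1)] le]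
  show "strongly_integrable lebesgue (\<lambda>\<tau>. indicator {s..t} \<tau> *\<^sub>R U t \<tau> (B \<tau> (y \<tau>)))"
    "norm (volterra s y t) \<le> C * m"
    using * y w by (auto simp: volterra_def)
qed

lemma volterra_integrable:
  assumes y: "strongly_measurable lebesgue (\<lambda>\<tau>. indicator {s..t} \<tau> *\<^sub>R y \<tau>)"
      "\<And>\<tau>. s \<le> \<tau> \<Longrightarrow> \<tau> \<le> t \<Longrightarrow> norm (y \<tau>) \<le> C"
  shows "strongly_integrable lebesgue (\<lambda>\<tau>. indicator {s..t} \<tau> *\<^sub>R U t \<tau> (B \<tau> (y \<tau>)))"
proof -
  obtain L where L: "0 \<le> L" "\<And>\<tau> r. s \<le> r \<Longrightarrow> r \<le> \<tau> \<Longrightarrow> \<tau> \<le> t \<Longrightarrow> norm (U \<tau> r) \<le> L"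
    using U_bounded by blast
  define m where "m = (\<integral>\<^sup>+\<tau>. ennreal (L * norm (B \<tau>) * 1) * indicator {s..t} \<tau> \<partial>lebesgue)"
  have "m = ennreal L * (\<integral>\<^sup>+\<tau>. ennreal (norm (B \<tau>)) * indicator {s..t} \<tau> \<partial>lebesgue)"
    unfolding m_def using L
    by (subst nn_integral_cmult[OF B_weight_measurable(2)[of "\<lambda>_. 1"], symmetric]) (auto simp: ennreal_mult mult.assoc)
  then have "m < \<infinity>"
    using B_locally_integrable[of s t] by (simp add: ennreal_mult_less_top)
  then have "m = ennreal (enn2real m)" by simp
  then show ?thesis
    using L y unfolding m_def
    by (intro volterra_bound(1)[where C="max C 0" and w="\<lambda>_. 1" and L=L and m="enn2real m"])
      (auto simp: m_def le_max_iff_disj)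
qed

lemma volterra_integrable_continuous:
  assumes y: "continuous_on {s..t} y"
  shows "strongly_integrable lebesgue (\<lambda>\<tau>. indicator {s..t} \<tau> *\<^sub>R U t \<tau> (B \<tau> (y \<tau>)))"
proof -
  have "bounded (y ` {s..t})"
    by (intro compact_imp_bounded compact_continuous_image y) simp
  then obtain C where "\<And>\<tau>. \<tau> \<in> {s..t} \<Longrightarrow> norm (y \<tau>) \<le> C"
    unfolding bounded_iff by blast
  then show ?thesis
    by (intro volterra_integrable[where C=C] strongly_measurable_continuous_on_interval y) auto
qed

lemma volterra_linear:
  assumes y: "strongly_integrable lebesgue (\<lambda>\<tau>. indicator {s..t} \<tau> *\<^sub>R U t \<tau> (B \<tau> (y \<tau>)))"
    and z: "strongly_integrable lebesgue (\<lambda>\<tau>. indicator {s..t} \<tau> *\<^sub>R U t \<tau> (B \<tau> (z \<tau>)))"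
  shows "volterra s (\<lambda>\<tau>. c *\<^sub>R y \<tau> + z \<tau>) t = c *\<^sub>R volterra s y t + volterra s z t"
proof -
  have eq: "(\<lambda>\<tau>. indicator {s..t} \<tau> *\<^sub>R U t \<tau> (B \<tau> (c *\<^sub>R y \<tau> + z \<tau>))) =
      (\<lambda>\<tau>. c *\<^sub>R indicator {s..t} \<tau> *\<^sub>R U t \<tau> (B \<tau> (y \<tau>)) + indicator {s..t} \<tau> *\<^sub>R U t \<tau> (B \<tau> (z \<tau>)))"
    by (simp add: blinfun.bilinear_simps scaleR_add_right mult.commute)
  note sc = completion.strongly_integrable_bounded_linear[OF bounded_linear_scaleR_right[of c] y]
  show ?thesis
    unfolding volterra_def eq
    using completion.strongly_integrable_add(2)[OF sc(1) z] sc(2) by simp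
qed

lemma volterra_cong:
  "(\<And>\<tau>. s \<le> \<tau> \<Longrightarrow> \<tau> \<le> t \<Longrightarrow> y \<tau> = z \<tau>) \<Longrightarrow> volterra s y t = volterra s z t"
  unfolding volterra_def by (intro arg_cong[where f="strong_integral lebesgue"] ext) (auto simp: indicator_def)

lemma volterra_bound_improve:
  assumes y: "continuous_on {s..t} y" and L: "0 \<le> L" "\<And>\<tau> r. s \<le> r \<Longrightarrow> r \<le> \<tau> \<Longrightarrow> \<tau> \<le> t \<Longrightarrow> norm (U \<tau> r) \<le> L"
    and w: "continuous_on UNIV w" "\<And>r. 1 \<le> w r"
      "\<And>r. s \<le> r \<Longrightarrow> r \<le> t \<Longrightarrow> (\<integral>\<^sup>+\<tau>. ennreal (L * norm (B \<tau>) * w \<tau>) * indicator {s..r} \<tau> \<partial>lebesgue) \<le> ennreal (w r / 2)"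
    and eq: "\<And>r. s \<le> r \<Longrightarrow> r \<le> t \<Longrightarrow> y r = U r s x + volterra s y r"
    and r: "s \<le> r" "r \<le> t"
  shows "norm (y r) \<le> 2 * L * norm x * w r"
proof -
  have w0: "0 < w p" "0 \<le> w p" for p using w(2)[of p] by auto
  have "bounded (y ` {s..t})"
    by (intro compact_imp_bounded compact_continuous_image y) simp
  then obtain C0 where C0: "\<And>\<tau>. \<tau> \<in> {s..t} \<Longrightarrow> norm (y \<tau>) \<le> C0"
    unfolding bounded_iff by blast
  have "norm (y r) \<le> L * norm x / (1 - 1 / 2) * w r"
  proof (rule weighted_bound_improve[where S="{s..t}" and y=y and w=w and p=r and q="1 / 2" and a="L * norm x" and ?C0.0="max C0 0"])
    show "norm (y p) \<le> max C0 0 * w p" if "p \<in> {s..t}" for p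
      using C0[OF that] mult_mono[of "max C0 0" "max C0 0" 1 "w p"] w(2)[of p] by auto
    show "norm (y p) \<le> (L * norm x + 1 / 2 * C) * w p"
      if C: "0 \<le> C" "\<And>p. p \<in> {s..t} \<Longrightarrow> norm (y p) \<le> C * w p" and p: "p \<in> {s..t}" for C p
    proof -
      have "norm (volterra s y p) \<le> C * (w p / 2)"
      proof (rule volterra_bound(2)[where w=w and L=L])
        show "strongly_measurable lebesgue (\<lambda>\<tau>. indicator {s..p} \<tau> *\<^sub>R y \<tau>)"
          using y p by (intro strongly_measurable_continuous_on_interval) (auto intro: continuous_on_subset)
        show "w \<in> borel_measurable lebesgue"
          using w(1) by (rule borel_measurable_lebesgue_continuous)
      qed (use C p L w w0 in auto)
      moreover have "norm (U p s x) \<le> L * norm x * w p"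
      proof -
        have "norm (U p s x) \<le> L * norm x"
          using L(2)[of s p] p by (auto intro!: order_trans[OF norm_blinfun] mult_right_mono)
        also have "\<dots> \<le> L * norm x * w p"
          using L w(2)[of p] mult_left_mono[of 1 "w p" "L * norm x"] by auto
        finally show ?thesis .
      qed
      ultimately show ?thesis
        using eq[of p] p norm_triangle_ineq[of "U p s x" "volterra s y p"] by (simp add: algebra_simps)
    qed
  qed (use w0 r in auto)
  then show ?thesis by simp
qed

lemma volterra_unique:
  assumes y: "continuous_on {s..t} y" "\<And>r. s \<le> r \<Longrightarrow> r \<le> t \<Longrightarrow> y r = U r s x + volterra s y r"
    and z: "continuous_on {s..t} z" "\<And>r. s \<le> r \<Longrightarrow> r \<le> t \<Longrightarrow> z r = U r s x + volterra s z r"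
    and r: "s \<le> r" "r \<le> t"
  shows "y r = z r"
proof -
  obtain L where L: "0 \<le> L" "\<And>\<tau> r. s \<le> r \<Longrightarrow> r \<le> \<tau> \<Longrightarrow> \<tau> \<le> t \<Longrightarrow> norm (U \<tau> r) \<le> L"
    using U_bounded by blast
  have "s \<le> t" using r by simp
  then obtain w W where w: "continuous_on UNIV w" "\<And>t. 1 \<le> w t" "\<And>t. w t \<le> W"
    "\<And>p r. s \<le> p \<Longrightarrow> p \<le> r \<Longrightarrow> r \<le> t \<Longrightarrow>
      (\<integral>\<^sup>+\<tau>. ennreal (L * norm (B \<tau>) * w \<tau>) * indicator {p..r} \<tau> \<partial>lebesgue) \<le> ennreal (w r / 2)"
    using volterra_weight[OF _ L(1)] by blast
  define d where "d r = (-1) *\<^sub>R y r + z r" for r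
  have "norm (d r) \<le> 2 * L * norm (0::'a) * w r"
  proof (rule volterra_bound_improve[where s=s and t=t and w=w])
    show "continuous_on {s..t} d"
      unfolding d_def using y z by (intro continuous_intros)
    show "d p = U p s 0 + volterra s d p" if p: "s \<le> p" "p \<le> t" for p
    proof -
      have "continuous_on {s..p} y" "continuous_on {s..p} z"
        using y z p by (auto intro: continuous_on_subset)
      then have "volterra s d p = (-1) *\<^sub>R volterra s y p + volterra s z p"
        unfolding d_def by (intro volterra_linear volterra_integrable_continuous)
      then show ?thesis
        using y(2)[OF p] z(2)[OF p] by (simp add: d_def)
    qed
  qed (use L w r in auto)
  then show ?thesis by (simp add: d_def)
qed

text \<open>
  The equation is solved for all initial times \<open>s\<close> at once, as a fixed point problem for functions of the
  pair \<open>(t, s)\<close>; this yields joint continuity of the solution without further work.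
\<close>

lemma volterra_exists:
  assumes ab: "a \<le> b"
  obtains k where "continuous_on UNIV k"
    "\<And>s t. a \<le> s \<Longrightarrow> s \<le> t \<Longrightarrow> t \<le> b \<Longrightarrow> k (t, s) = U t s x + volterra s (\<lambda>\<tau>. k (\<tau>, s)) t"
proof -
  obtain L where L: "0 \<le> L" "\<And>\<tau> r. a \<le> r \<Longrightarrow> r \<le> \<tau> \<Longrightarrow> \<tau> \<le> b \<Longrightarrow> norm (U \<tau> r) \<le> L"
    using U_bounded by blast
  obtain w W where w: "continuous_on UNIV w" "\<And>t. 1 \<le> w t" "\<And>t. w t \<le> W"
    "\<And>p r. a \<le> p \<Longrightarrow> p \<le> r \<Longrightarrow> r \<le> b \<Longrightarrow>
      (\<integral>\<^sup>+\<tau>. ennreal (L * norm (B \<tau>) * w \<tau>) * indicator {p..r} \<tau> \<partial>lebesgue) \<le> ennreal (w r / 2)"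
    using volterra_weight[OF ab L(1)] by blast
  have w0: "0 < w r" "0 \<le> w r" for r using w(2)[of r] by auto
  have w_meas: "w \<in> borel_measurable lebesgue"
    using w(1) by (rule borel_measurable_lebesgue_continuous)
  \<comment> \<open>\<open>(t', s')\<close> retracts the plane onto the triangle \<open>a \<le> s \<le> t \<le> b\<close>, so that continuous functions on the
    whole plane can be used\<close>
  define cl where "cl r = max a (min b r)" for r
  define s' where "s' p = cl (snd p)" for p :: "real \<times> real"
  define t' where "t' p = max (cl (fst p)) (cl (snd p))" for p :: "real \<times> real"
  have s't': "a \<le> s' p" "s' p \<le> t' p" "t' p \<le> b" for p
    using ab by (auto simp: s'_def t'_def cl_def)
  have ret: "s' (r, s' p) = s' p" "t' (r, s' p) = r" if "s' p \<le> r" "r \<le> t' p" for p r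
    using that ab by (auto simp: s'_def t'_def cl_def)
  have s'_cont: "continuous_on UNIV s'" and t'_cont: "continuous_on UNIV t'"
    unfolding s'_def t'_def cl_def by (intro continuous_intros)+
  define T where "T k p = volterra (s' p) (\<lambda>\<tau>. k (\<tau>, s' p)) (t' p)" for k :: "real \<times> real \<Rightarrow> 'a" and p
  have k_slice: "continuous_on S (\<lambda>\<tau>. k (\<tau>, r))" if "continuous_on UNIV k" for k :: "real \<times> real \<Rightarrow> 'a" and r S
    by (rule continuous_on_compose2[OF that]) (auto intro!: continuous_intros)
  have T_bound: "norm (T k p) \<le> 1 / 2 * C * w (t' p)"
    if k: "continuous_on UNIV k" "0 \<le> C" "\<And>p. norm (k p) \<le> C * w (t' p)" for k C p
  proof -
    have "norm (T k p) \<le> C * (w (t' p) / 2)"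
      unfolding T_def
    proof (rule volterra_bound(2)[where w=w and L=L])
      show "norm (k (\<tau>, s' p)) \<le> C * w \<tau>" if "s' p \<le> \<tau>" "\<tau> \<le> t' p" for \<tau>
        using k(3)[of "(\<tau>, s' p)"] ret[OF that] by simp
    qed (use k L w w0 w_meas s't'[of p] in \<open>auto intro!: strongly_measurable_continuous_on_interval k_slice\<close>)
    then show ?thesis by simp
  qed
  have T_cont: "continuous_on UNIV (T k)"
    if k: "continuous_on UNIV k" "0 \<le> C" "\<And>p. norm (k p) \<le> C * w (t' p)" for k C
  proof -
    have kW: "norm (k p) \<le> C * W" for p
      using k(3)[of p] mult_left_mono[OF w(3)[of "t' p"] k(2)] by linarith
    have "0 \<le> W" using w(2)[of 0] w(3)[of 0] by linarith
    let ?I = "\<lambda>p \<tau>. indicator {s' p..t' p} \<tau> *\<^sub>R U (t' p) \<tau> (B \<tau> (k (\<tau>, s' p)))"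
    have "(\<lambda>n. T k (p n)) \<longlonglongrightarrow> T k q" if pq: "p \<longlonglongrightarrow> q" for p q
      unfolding T_def volterra_def
    proof (rule completion.strong_integral_dominated_convergence
        [where h="\<lambda>\<tau>. L * (C * W) * (norm (B \<tau>) * indicator {a..b} \<tau>)"])
      have lim: "(\<lambda>n. s' (p n)) \<longlonglongrightarrow> s' q" "(\<lambda>n. t' (p n)) \<longlonglongrightarrow> t' q"
        using continuous_on_tendsto_compose[OF s'_cont pq] continuous_on_tendsto_compose[OF t'_cont pq] by auto
      show "strongly_measurable lebesgue (?I (p n))" for n
        by (intro volterra_integrand_measurable strongly_measurable_continuous_on_interval k_slice k)
      show "(\<lambda>\<tau>. L * (C * W) * (norm (B \<tau>) * indicator {a..b} \<tau>)) \<in> borel_measurable lebesgue"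
        by (rule B_weight_measurable(3)[of "\<lambda>_. 1"]) simp
      have "(\<integral>\<^sup>+\<tau>. ennreal (L * (C * W) * (norm (B \<tau>) * indicator {a..b} \<tau>)) \<partial>lebesgue) =
          ennreal (L * (C * W)) * (\<integral>\<^sup>+\<tau>. ennreal (norm (B \<tau>)) * indicator {a..b} \<tau> \<partial>lebesgue)"
        using L k(2) \<open>0 \<le> W\<close>
        by (subst nn_integral_cmult[OF B_weight_measurable(2)[of "\<lambda>_. 1"], symmetric])
          (auto simp: ennreal_mult indicator_def intro!: nn_integral_cong)
      then show "(\<integral>\<^sup>+\<tau>. ennreal (L * (C * W) * (norm (B \<tau>) * indicator {a..b} \<tau>)) \<partial>lebesgue) < \<infinity>"
        using B_locally_integrable[of a b] by (simp add: ennreal_mult_less_top)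
      show "AE \<tau> in lebesgue. norm (?I (p n) \<tau>) \<le>
          L * (C * W) * (norm (B \<tau>) * indicator {a..b} \<tau>)" for n
      proof (rule AE_I2)
        fix \<tau>
        show "norm (?I (p n) \<tau>) \<le>
          L * (C * W) * (norm (B \<tau>) * indicator {a..b} \<tau>)"
        proof (cases "\<tau> \<in> {s' (p n)..t' (p n)}")
          case True
          then have \<tau>: "a \<le> \<tau>" "\<tau> \<le> b" using s't'[of "p n"] by auto
          have "norm (U (t' (p n)) \<tau> (B \<tau> (k (\<tau>, s' (p n))))) \<le> norm (U (t' (p n)) \<tau>) * (norm (B \<tau>) * norm (k (\<tau>, s' (p n))))"
            by (meson norm_blinfun mult_left_mono norm_ge_zero order_trans)
          also have "\<dots> \<le> L * (norm (B \<tau>) * (C * W))"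
            using True L s't'[of "p n"] kW by (intro mult_mono) auto
          finally show ?thesis using True \<tau> by (simp add: mult_ac)
        qed (use L k \<open>0 \<le> W\<close> in auto)
      qed
      have "AE \<tau> in lebesgue. \<tau> \<notin> {s' q, t' q}"
        by (rule AE_lebesgue_notin_finite) simp
      then show "AE \<tau> in lebesgue. (\<lambda>n. ?I (p n) \<tau>) \<longlonglongrightarrow>
          ?I q \<tau>"
      proof eventually_elim
        fix \<tau> assume \<tau>: "\<tau> \<notin> {s' q, t' q}"
        show "(\<lambda>n. ?I (p n) \<tau>) \<longlonglongrightarrow>
          ?I q \<tau>"
        proof (cases "s' q < \<tau> \<and> \<tau> < t' q")
          case True
          have ev: "\<forall>\<^sub>F n in sequentially. s' (p n) < \<tau> \<and> \<tau> < t' (p n)"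
            using order_tendstoD(2)[OF lim(1), of \<tau>] order_tendstoD(1)[OF lim(2), of \<tau>] True
            by (auto intro: eventually_conj)
          have U_lim: "(\<lambda>n. U (max (t' (p n)) \<tau>) \<tau> v) \<longlonglongrightarrow> U (max (t' q) \<tau>) \<tau> v" for v
            by (rule continuous_on_tendsto_compose[OF _ lim(2), of UNIV "\<lambda>t. U (max t \<tau>) \<tau> v"])
              (intro U_continuous continuous_intros, auto)
          have "(\<lambda>n. U (max (t' (p n)) \<tau>) \<tau> (B \<tau> (k (\<tau>, s' (p n))))) \<longlonglongrightarrow> U (max (t' q) \<tau>) \<tau> (B \<tau> (k (\<tau>, s' q)))"
          proof (rule tendsto_blinfun_apply_strong[OF U_lim])
            have "(\<lambda>n. k (\<tau>, s' (p n))) \<longlonglongrightarrow> k (\<tau>, s' q)"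
              by (rule continuous_on_tendsto_compose[OF k(1)]) (auto intro!: tendsto_intros lim)
            then show "(\<lambda>n. B \<tau> (k (\<tau>, s' (p n)))) \<longlonglongrightarrow> B \<tau> (k (\<tau>, s' q))"
              by (intro tendsto_intros)
            show "\<forall>\<^sub>F n in sequentially. norm (U (max (t' (p n)) \<tau>) \<tau>) \<le> L"
              using ev
            proof eventually_elim
              fix n assume "s' (p n) < \<tau> \<and> \<tau> < t' (p n)"
              then show "norm (U (max (t' (p n)) \<tau>) \<tau>) \<le> L"
                using s't'[of "p n"] by (intro L) auto
            qed
          qed
          then have "(\<lambda>n. U (max (t' (p n)) \<tau>) \<tau> (B \<tau> (k (\<tau>, s' (p n))))) \<longlonglongrightarrow> ?I q \<tau>"
            using True by (simp add: max_def)
          then show ?thesis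
            by (rule Lim_transform_eventually) (use ev in \<open>eventually_elim, auto simp: max_def\<close>)
        next
          case False
          then have out: "\<tau> < s' q \<or> t' q < \<tau>" using \<tau> by auto
          then have "\<forall>\<^sub>F n in sequentially. \<tau> < s' (p n) \<or> t' (p n) < \<tau>"
            using order_tendstoD(1)[OF lim(1), of \<tau>] order_tendstoD(2)[OF lim(2), of \<tau>]
            by (auto elim: eventually_mono)
          then have ev0: "\<forall>\<^sub>F n in sequentially. 0 = ?I (p n) \<tau>"
            by eventually_elim auto
          have zero: "?I q \<tau> = 0"
            using out by auto
          show ?thesis
            unfolding zero by (rule Lim_transform_eventually[OF tendsto_const ev0])
        qed
      qed
    qed
    then show ?thesis
      unfolding continuous_on_sequentially comp_def by blast
  qed
  obtain k C where k: "continuous_on UNIV k" "\<And>p. k p = U (t' p) (s' p) x + T k p"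
  proof (rule weighted_contraction_fixpoint[where w="\<lambda>p. w (t' p)" and q="1/2" and T=T and
        h="\<lambda>p. U (t' p) (s' p) x" and ?C0.0="L * norm x"])
    show "continuous_on UNIV (\<lambda>p. w (t' p))"
      by (rule continuous_on_compose2[OF w(1) t'_cont]) auto
    show "continuous_on UNIV (T k) \<and> (\<forall>p. norm (T k p) \<le> 1 / 2 * C * w (t' p))"
      if "continuous_on UNIV k" "0 \<le> C" "\<And>p. norm (k p) \<le> C * w (t' p)" for k C
      using T_cont[OF that] T_bound[OF that] by blast
    show "T (\<lambda>p. k p - l p) p = T k p - T l p"
      if kl: "continuous_on UNIV k" "continuous_on UNIV l" for k l p
    proof -
      have "volterra (s' p) (\<lambda>\<tau>. (-1) *\<^sub>R l (\<tau>, s' p) + k (\<tau>, s' p)) (t' p) =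
          (-1) *\<^sub>R volterra (s' p) (\<lambda>\<tau>. l (\<tau>, s' p)) (t' p) + volterra (s' p) (\<lambda>\<tau>. k (\<tau>, s' p)) (t' p)"
        by (intro volterra_linear volterra_integrable_continuous k_slice kl)
      then show ?thesis by (simp add: T_def)
    qed
    show "continuous_on UNIV (\<lambda>p. U (t' p) (s' p) x)"
      using s't' by (intro U_continuous s'_cont t'_cont)
    show "norm (U (t' p) (s' p) x) \<le> L * norm x * w (t' p)" for p
    proof -
      have "norm (U (t' p) (s' p) x) \<le> L * norm x"
        using L(2)[of "s' p" "t' p"] s't'[of p] by (auto intro!: order_trans[OF norm_blinfun] mult_right_mono)
      also have "\<dots> \<le> L * norm x * w (t' p)"
        using L w(2)[of "t' p"] mult_left_mono[of 1 "w (t' p)" "L * norm x"] by auto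
      finally show ?thesis .
    qed
  qed (use w0 L in auto)
  show thesis
  proof (rule that[OF k(1)])
    fix s t assume "a \<le> s" "s \<le> t" "t \<le> b"
    then have "s' (t, s) = s" "t' (t, s) = t"
      by (auto simp: s'_def t'_def cl_def)
    then show "k (t, s) = U t s x + volterra s (\<lambda>\<tau>. k (\<tau>, s)) t"
      using k(2)[of "(t, s)"] by (simp add: T_def)
  qed
qed

lemma perturbed_evolution_family_volterra:
  assumes "perturbed_evolution_family UNIV U B V" "s \<le> t"
  shows "V t s x = U t s x + volterra s (\<lambda>\<tau>. V \<tau> s x) t"
proof -
  have "has_strong_bochner_integral (lebesgue_on {s..t}) (\<lambda>\<tau>. U t \<tau> (B \<tau> (V \<tau> s x))) (V t s x - U t s x)"
    using assms by (auto simp: perturbed_evolution_family_def)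
  then have "has_strong_bochner_integral lebesgue (\<lambda>\<tau>. indicator {s..t} \<tau> *\<^sub>R U t \<tau> (B \<tau> (V \<tau> s x))) (V t s x - U t s x)"
    by (intro has_strong_bochner_integral_lebesgue_on) auto
  then have "volterra s (\<lambda>\<tau>. V \<tau> s x) t = V t s x - U t s x"
    unfolding volterra_def by (rule completion.strong_integral_eq)
  then show ?thesis by simp
qed

lemma volterra_split:
  assumes "s \<le> r" "r \<le> t" and y: "continuous_on {s..t} y"
  shows "volterra s y t = U t r (volterra s y r) + volterra r y t"
proof -
  have int: "strongly_integrable lebesgue (\<lambda>\<tau>. indicator {s..r} \<tau> *\<^sub>R U r \<tau> (B \<tau> (y \<tau>)))"
    "strongly_integrable lebesgue (\<lambda>\<tau>. indicator {r..t} \<tau> *\<^sub>R U t \<tau> (B \<tau> (y \<tau>)))"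
    using assms by (auto intro!: volterra_integrable_continuous intro: continuous_on_subset)
  note Uint = completion.strongly_integrable_bounded_linear[OF blinfun.bounded_linear_right[of "U t r"] int(1)]
  note sum = completion.strongly_integrable_add[OF Uint(1) int(2)]
  have "AE \<tau> in lebesgue. \<tau> \<notin> {r}"
    by (rule AE_lebesgue_notin_finite) simp
  then have "AE \<tau> in lebesgue. U t r (indicator {s..r} \<tau> *\<^sub>R U r \<tau> (B \<tau> (y \<tau>))) + indicator {r..t} \<tau> *\<^sub>R U t \<tau> (B \<tau> (y \<tau>)) =
      indicator {s..t} \<tau> *\<^sub>R U t \<tau> (B \<tau> (y \<tau>))"
  proof eventually_elim
    fix \<tau> assume "\<tau> \<notin> {r}"
    then consider "\<tau> < s" | "s \<le> \<tau>" "\<tau> < r" | "r < \<tau>" "\<tau> \<le> t" | "t < \<tau>"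
      by fastforce
    then show "U t r (indicator {s..r} \<tau> *\<^sub>R U r \<tau> (B \<tau> (y \<tau>))) + indicator {r..t} \<tau> *\<^sub>R U t \<tau> (B \<tau> (y \<tau>)) =
      indicator {s..t} \<tau> *\<^sub>R U t \<tau> (B \<tau> (y \<tau>))"
      using assms U_comp[of \<tau> r t "B \<tau> (y \<tau>)"] by cases (auto simp: indicator_def)
  qed
  from completion.strong_integral_cong_AE(2)[OF sum(1) this] sum(2) Uint(2)
  show ?thesis by (simp add: volterra_def)
qed

text \<open>
  A pair is (current time, initial time), and \<open>N\<close> bounds both; the values do not depend on the choice of a
  large enough \<open>N\<close>, by uniqueness.
\<close>

definition volterra_solution :: "'a \<Rightarrow> real \<Rightarrow> real \<times> real \<Rightarrow> 'a" where
  "volterra_solution x N = (SOME k. continuous_on UNIV k \<and>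
    (\<forall>s t. - N \<le> s \<longrightarrow> s \<le> t \<longrightarrow> t \<le> N \<longrightarrow> k (t, s) = U t s x + volterra s (\<lambda>\<tau>. k (\<tau>, s)) t))"

lemma volterra_solution:
  assumes "0 \<le> N"
  shows "continuous_on UNIV (volterra_solution x N)"
    "- N \<le> s \<Longrightarrow> s \<le> t \<Longrightarrow> t \<le> N \<Longrightarrow>
      volterra_solution x N (t, s) = U t s x + volterra s (\<lambda>\<tau>. volterra_solution x N (\<tau>, s)) t"
proof -
  have "\<exists>k. continuous_on UNIV k \<and>
    (\<forall>s t. - N \<le> s \<longrightarrow> s \<le> t \<longrightarrow> t \<le> N \<longrightarrow> k (t, s) = U t s x + volterra s (\<lambda>\<tau>. k (\<tau>, s)) t)"
  proof -
    have "- N \<le> N" using assms by simp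
    then obtain k where "continuous_on UNIV k"
      "\<And>s t. - N \<le> s \<Longrightarrow> s \<le> t \<Longrightarrow> t \<le> N \<Longrightarrow> k (t, s) = U t s x + volterra s (\<lambda>\<tau>. k (\<tau>, s)) t"
      using volterra_exists[of "- N" N x] by blast
    then show ?thesis by blast
  qed
  from someI_ex[OF this]
  show "continuous_on UNIV (volterra_solution x N)"
    "- N \<le> s \<Longrightarrow> s \<le> t \<Longrightarrow> t \<le> N \<Longrightarrow>
      volterra_solution x N (t, s) = U t s x + volterra s (\<lambda>\<tau>. volterra_solution x N (\<tau>, s)) t"
    unfolding volterra_solution_def[symmetric] by auto
qed

lemma volterra_solution_slice:
  assumes "0 \<le> N"
  shows "continuous_on S (\<lambda>\<tau>. volterra_solution x N (\<tau>, s))"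
  by (rule continuous_on_compose2[OF volterra_solution(1)[OF assms]]) (auto intro!: continuous_intros)

definition perturbed_flow :: "real \<Rightarrow> real \<Rightarrow> 'a \<Rightarrow> 'a" where
  "perturbed_flow t s x = volterra_solution x (\<bar>t\<bar> + \<bar>s\<bar>) (t, s)"

lemma perturbed_flow_eq_solution:
  assumes "- N \<le> s" "s \<le> t" "t \<le> N"
  shows "perturbed_flow t s x = volterra_solution x N (t, s)"
  unfolding perturbed_flow_def
  by (rule volterra_unique[where s=s and t=t and x=x])
    (use assms in \<open>auto intro!: volterra_solution_slice volterra_solution(2)\<close>)

lemma perturbed_flow_continuous:
  "continuous_on {(t, s). s \<le> t} (\<lambda>(t, s). perturbed_flow t s x)"
  unfolding continuous_on_eq_continuous_within
proof
  fix p :: "real \<times> real" assume p: "p \<in> {(t, s). s \<le> t}"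
  define N where "N = \<bar>fst p\<bar> + \<bar>snd p\<bar> + 1"
  have "isCont (volterra_solution x N) p"
    using volterra_solution(1)[of N x] by (simp add: N_def continuous_on_eq_continuous_at del: split_paired_All)
  then have "continuous (at p within {(t, s). s \<le> t}) (volterra_solution x N)"
    by (rule continuous_at_imp_continuous_at_within)
  then show "continuous (at p within {(t, s). s \<le> t}) (\<lambda>(t, s). perturbed_flow t s x)"
  proof (rule continuous_transform_within[where \<delta>=1])
    fix p' :: "real \<times> real" assume p': "p' \<in> {(t, s). s \<le> t}" "dist p' p < 1"
    have "dist (fst p') (fst p) < 1" "dist (snd p') (snd p) < 1"
      using p'(2) dist_fst_le[of p' p] dist_snd_le[of p' p] by linarith+
    then have "perturbed_flow (fst p') (snd p') x = volterra_solution x N (fst p', snd p')"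
      using p'(1) by (intro perturbed_flow_eq_solution) (auto simp: N_def dist_real_def)
    then show "volterra_solution x N p' = (\<lambda>(t, s). perturbed_flow t s x) p'"
      by (simp add: case_prod_beta)
  qed (use p in auto)
qed

lemma perturbed_flow_continuous_slice: "continuous_on {s..t} (\<lambda>\<tau>. perturbed_flow \<tau> s x)"
proof -
  have "continuous_on {s..t} (\<lambda>\<tau>. (\<lambda>(t, s). perturbed_flow t s x) (\<tau>, s))"
    by (rule continuous_on_compose2[OF perturbed_flow_continuous]) (auto intro!: continuous_intros)
  then show ?thesis by simp
qed

lemma perturbed_flow_volterra:
  assumes "s \<le> t"
  shows "perturbed_flow t s x = U t s x + volterra s (\<lambda>\<tau>. perturbed_flow \<tau> s x) t"
proof -
  define N where "N = \<bar>t\<bar> + \<bar>s\<bar>"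
  have "perturbed_flow t s x = U t s x + volterra s (\<lambda>\<tau>. volterra_solution x N (\<tau>, s)) t"
    using assms by (subst perturbed_flow_eq_solution[of N]) (auto simp: N_def intro!: volterra_solution(2))
  also have "volterra s (\<lambda>\<tau>. volterra_solution x N (\<tau>, s)) t = volterra s (\<lambda>\<tau>. perturbed_flow \<tau> s x) t"
    using assms by (intro volterra_cong perturbed_flow_eq_solution[symmetric]) (auto simp: N_def)
  finally show ?thesis .
qed

lemma perturbed_flow_linear:
  assumes "s \<le> t"
  shows "perturbed_flow t s (c *\<^sub>R x + z) = c *\<^sub>R perturbed_flow t s x + perturbed_flow t s z"
proof (rule volterra_unique[where s=s and t=t and x="c *\<^sub>R x + z" and y="\<lambda>t. perturbed_flow t s (c *\<^sub>R x + z)"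
      and z="\<lambda>t. c *\<^sub>R perturbed_flow t s x + perturbed_flow t s z"])
  show "c *\<^sub>R perturbed_flow r s x + perturbed_flow r s z =
      U r s (c *\<^sub>R x + z) + volterra s (\<lambda>\<tau>. c *\<^sub>R perturbed_flow \<tau> s x + perturbed_flow \<tau> s z) r" if "s \<le> r" for r
    using volterra_linear[OF volterra_integrable_continuous[OF perturbed_flow_continuous_slice[of s r x]]
        volterra_integrable_continuous[OF perturbed_flow_continuous_slice[of s r z]], of c]
      perturbed_flow_volterra[OF that, of x] perturbed_flow_volterra[OF that, of z]
    by (simp add: blinfun.bilinear_simps scaleR_add_right)
qed (use assms in \<open>auto intro!: perturbed_flow_continuous_slice perturbed_flow_volterra continuous_intros\<close>)

lemma perturbed_flow_bounded_linear:
  assumes "s \<le> t"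
  shows "bounded_linear (perturbed_flow t s)"
proof -
  obtain L where L: "0 \<le> L" "\<And>\<tau> r. s \<le> r \<Longrightarrow> r \<le> \<tau> \<Longrightarrow> \<tau> \<le> t \<Longrightarrow> norm (U \<tau> r) \<le> L"
    using U_bounded by blast
  obtain w W where w: "continuous_on UNIV w" "\<And>t. 1 \<le> w t" "\<And>t. w t \<le> W"
    "\<And>p r. s \<le> p \<Longrightarrow> p \<le> r \<Longrightarrow> r \<le> t \<Longrightarrow>
      (\<integral>\<^sup>+\<tau>. ennreal (L * norm (B \<tau>) * w \<tau>) * indicator {p..r} \<tau> \<partial>lebesgue) \<le> ennreal (w r / 2)"
    using volterra_weight[OF assms L(1)] by blast
  have lin: "perturbed_flow t s (c *\<^sub>R x + z) = c *\<^sub>R perturbed_flow t s x + perturbed_flow t s z" for c x z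
    using assms by (rule perturbed_flow_linear)
  have zero: "perturbed_flow t s 0 = 0"
    using lin[of 1 0 0] by simp
  show ?thesis
  proof (rule bounded_linear_intro)
    show "perturbed_flow t s (x + z) = perturbed_flow t s x + perturbed_flow t s z" for x z
      using lin[of 1 x z] by simp
    show "perturbed_flow t s (c *\<^sub>R x) = c *\<^sub>R perturbed_flow t s x" for c x
      using lin[of c x 0] zero by simp
    show "norm (perturbed_flow t s x) \<le> norm x * (2 * L * w t)" for x
      using volterra_bound_improve[of s t "\<lambda>t. perturbed_flow t s x" L w x t] L w assms
        perturbed_flow_continuous_slice perturbed_flow_volterra by (auto simp: mult_ac)
  qed
qed

lemma perturbed_flow_comp:
  assumes "s \<le> r" "r \<le> t"
  shows "perturbed_flow t s x = perturbed_flow t r (perturbed_flow r s x)"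
proof (rule volterra_unique[where s=r and t=t and x="perturbed_flow r s x" and y="\<lambda>t. perturbed_flow t s x"
      and z="\<lambda>t. perturbed_flow t r (perturbed_flow r s x)"])
  show "perturbed_flow \<tau> s x = U \<tau> r (perturbed_flow r s x) + volterra r (\<lambda>\<tau>. perturbed_flow \<tau> s x) \<tau>"
    if "r \<le> \<tau>" for \<tau>
    using assms that volterra_split[OF assms(1) that perturbed_flow_continuous_slice[of s \<tau> x]]
      perturbed_flow_volterra[of s \<tau> x] perturbed_flow_volterra[of s r x] U_comp[of s r \<tau> x]
    by (simp add: blinfun.add_right)
  show "continuous_on {r..t} (\<lambda>t. perturbed_flow t s x)"
    using assms by (intro continuous_on_subset[OF perturbed_flow_continuous_slice[of s t x]]) auto
qed (use assms in \<open>auto intro!: perturbed_flow_continuous_slice perturbed_flow_volterra\<close>)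

theorem perturbed_evolution_family_exists: "\<exists>V. perturbed_evolution_family UNIV U B V"
proof
  define V where "V t s = Blinfun (perturbed_flow t s)" for t s
  have V: "V t s x = perturbed_flow t s x" if "s \<le> t" for t s x
    using perturbed_flow_bounded_linear[OF that] by (simp add: V_def bounded_linear_Blinfun_apply)
  have refl: "perturbed_flow t t x = x" for t x
  proof -
    have int: "strongly_integrable lebesgue (\<lambda>_::real. 0::'a)"
      by (simp add: strongly_integrable_def)
    have ae: "AE \<tau> in lebesgue. 0 = indicator {t..t} \<tau> *\<^sub>R U t \<tau> (B \<tau> (perturbed_flow \<tau> t x))"
    proof -
      have "AE \<tau> in lebesgue. \<tau> \<notin> {t}"
        by (rule AE_lebesgue_notin_finite) simp
      then show ?thesis by eventually_elim auto
    qed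
    have "volterra t (\<lambda>\<tau>. perturbed_flow \<tau> t x) t = strong_integral lebesgue (\<lambda>_::real. 0)"
      unfolding volterra_def using completion.strong_integral_cong_AE(2)[OF int ae] .
    also have "\<dots> = 0"
      using completion.norm_strong_integral_le(2)[of lborel "\<lambda>_::real. 0::'a" 0] by simp
    finally show ?thesis
      using perturbed_flow_volterra[of t t x] by simp
  qed
  have "evolution_family UNIV V"
    unfolding evolution_family_def
  proof (intro conjI ballI allI impI)
    show "V t t = id_blinfun" for t
      by (rule blinfun_eqI) (simp add: V refl)
    show "V t s = V t r o\<^sub>L V r s" if "s \<le> r \<and> r \<le> t" for t r s
      using that perturbed_flow_comp[of s r t] by (intro blinfun_eqI) (simp add: V)
    show "continuous_on {(t, s). t \<in> UNIV \<and> s \<in> UNIV \<and> s \<le> t} (\<lambda>(t, s). V t s x)" for x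
      using continuous_on_eq[OF perturbed_flow_continuous[of x], of "\<lambda>(t, s). V t s x"] by (auto simp: V)
  qed
  moreover have "has_strong_bochner_integral (lebesgue_on {s..t}) (\<lambda>\<tau>. U t \<tau> (B \<tau> (V \<tau> s x))) (V t s x - U t s x)"
    if "s \<le> t" for s t x
  proof -
    have "continuous_on {s..t} (\<lambda>\<tau>. V \<tau> s x)"
      using perturbed_flow_continuous_slice[of s t x] by (rule continuous_on_eq) (simp add: V)
    from strongly_integrable_lebesgue_on[OF _ volterra_integrable_continuous[OF this]]
    have "has_strong_bochner_integral (lebesgue_on {s..t}) (\<lambda>\<tau>. U t \<tau> (B \<tau> (V \<tau> s x))) (volterra s (\<lambda>\<tau>. V \<tau> s x) t)"
      by (simp add: volterra_def)
    moreover have "volterra s (\<lambda>\<tau>. V \<tau> s x) t = volterra s (\<lambda>\<tau>. perturbed_flow \<tau> s x) t"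
      by (intro volterra_cong) (simp add: V)
    ultimately show ?thesis
      using perturbed_flow_volterra[OF that, of x] that by (simp add: V)
  qed
  ultimately show "perturbed_evolution_family UNIV U B V"
    by (simp add: perturbed_evolution_family_def)
qed

end

section \<open>The Green function of a dichotomy\<close>

text \<open>
  The constant \<open>q\<close> stands for \<open>K \<theta>\<close>.
\<close>

locale perturbed_dichotomy = perturbed_evolution U B
  for U :: "real \<Rightarrow> real \<Rightarrow> 'a::banach \<Rightarrow>\<^sub>L 'a" and B +
  fixes P :: "real \<Rightarrow> 'a \<Rightarrow>\<^sub>L 'a" and \<alpha> K \<epsilon> \<beta> q :: real
  assumes dichotomy: "nonuniform_exp_dichotomy_with UNIV U P \<alpha> K \<epsilon>"
    and \<beta>: "0 < \<beta>" "\<epsilon> < \<alpha> - \<beta>"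
    and q: "0 \<le> q" "q < 1"
    and B_small: "\<And>t. (\<integral>\<^sup>+\<tau>. ennreal (K * exp (- (\<alpha> - \<beta>) * \<bar>t - \<tau>\<bar>) * (norm (B \<tau>) * exp (\<epsilon> * \<bar>\<tau>\<bar>))) \<partial>lebesgue) \<le> ennreal q"
begin

lemma dichotomy_constants: "0 < \<alpha>" "0 < K" "0 \<le> \<epsilon>"
  using dichotomy by (auto simp: nonuniform_exp_dichotomy_with_def)

lemma P_idem [simp]: "P t (P t x) = P t x"
proof -
  have "P t o\<^sub>L P t = P t"
    using dichotomy by (auto simp: nonuniform_exp_dichotomy_with_def)
  then show ?thesis by (metis blinfun_apply_blinfun_compose)
qed

lemma U_P_commute: "s \<le> t \<Longrightarrow> U t s (P s x) = P t (U t s x)"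
proof -
  assume "s \<le> t"
  then have "U t s o\<^sub>L P s = P t o\<^sub>L U t s"
    using dichotomy by (auto simp: nonuniform_exp_dichotomy_with_def)
  then show ?thesis by (metis blinfun_apply_blinfun_compose)
qed

text \<open>
  The operator \<open>U(t,s)Q(s)\<close> for \<open>t \<le> s\<close>.  As a bounded operator on the whole space it is easier to
  handle than the inverse of a restriction.
\<close>

definition Q_inverse :: "real \<Rightarrow> real \<Rightarrow> 'a \<Rightarrow>\<^sub>L 'a" where
  "Q_inverse t s = Blinfun (\<lambda>x. backward_evolution U P t s ((id_blinfun - P s) x))"

text \<open>
  The third fact characterizes the value as the only preimage of \<open>Q(s)x\<close> in the null space of \<open>P(t)\<close>; all
  algebraic identities for \<open>U(t,s)Q(s)\<close>, including linearity, follow from it.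
\<close>

lemma backward_evolution_unique:
  assumes "t \<le> s"
  shows "P t (backward_evolution U P t s ((id_blinfun - P s) x)) = 0"
    and "U s t (backward_evolution U P t s ((id_blinfun - P s) x)) = x - P s x"
    and "P t z = 0 \<Longrightarrow> U s t z = x - P s x \<Longrightarrow> z = backward_evolution U P t s ((id_blinfun - P s) x)"
proof -
  have bij: "bij_betw (U s t) (null_space (P t)) (null_space (P s))"
    using dichotomy assms by (auto simp: nonuniform_exp_dichotomy_with_def)
  have x: "(id_blinfun - P s) x = x - P s x"
    by (simp add: blinfun.diff_left)
  have mem: "x - P s x \<in> U s t ` null_space (P t)"
    using bij by (simp add: bij_betw_def null_space_def blinfun.diff_right)
  show "P t (backward_evolution U P t s ((id_blinfun - P s) x)) = 0"
    using inv_into_into[OF mem] unfolding x backward_evolution_def by (simp add: null_space_def)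
  show "U s t (backward_evolution U P t s ((id_blinfun - P s) x)) = x - P s x"
    using f_inv_into_f[OF mem] unfolding x backward_evolution_def by simp
  show "z = backward_evolution U P t s ((id_blinfun - P s) x)" if "P t z = 0" "U s t z = x - P s x"
    using that inv_into_f_f[of "U s t" "null_space (P t)" z] bij
    unfolding x backward_evolution_def by (simp add: bij_betw_def null_space_def)
qed

lemma Q_inverse_eq:
  assumes "t \<le> s"
  shows "Q_inverse t s x = backward_evolution U P t s ((id_blinfun - P s) x)"
    and "norm (Q_inverse t s) \<le> K * exp (- \<alpha> * (s - t) + \<epsilon> * \<bar>s\<bar>)"
proof -
  define b where "b x = backward_evolution U P t s ((id_blinfun - P s) x)" for x
  note b = backward_evolution_unique[OF assms, folded b_def]
  have le: "norm (b x) \<le> norm x * (K * exp (- \<alpha> * (s - t) + \<epsilon> * \<bar>s\<bar>))" for x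
    using dichotomy assms unfolding b_def by (auto simp: nonuniform_exp_dichotomy_with_def mult.commute)
  have "bounded_linear b"
  proof (rule bounded_linear_intro[OF _ _ le])
    show "b (x + y) = b x + b y" for x y
      by (rule b(3)[symmetric]) (simp_all add: b(1,2) blinfun.add_right)
    show "b (c *\<^sub>R x) = c *\<^sub>R b x" for c x
      by (rule b(3)[symmetric]) (simp_all add: b(1,2) blinfun.scaleR_right scaleR_diff_right)
  qed
  then have eq: "blinfun_apply (Q_inverse t s) = b"
    unfolding Q_inverse_def b_def[symmetric] by (rule bounded_linear_Blinfun_apply)
  then show "Q_inverse t s x = backward_evolution U P t s ((id_blinfun - P s) x)"
    by (simp add: b_def)
  show "norm (Q_inverse t s) \<le> K * exp (- \<alpha> * (s - t) + \<epsilon> * \<bar>s\<bar>)"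
    using le dichotomy_constants by (intro norm_blinfun_bound) (auto simp: eq mult.commute)
qed

lemma Q_inverse:
  assumes "t \<le> s"
  shows "P t (Q_inverse t s x) = 0" "U s t (Q_inverse t s x) = x - P s x"
    and "P t z = 0 \<Longrightarrow> U s t z = x - P s x \<Longrightarrow> Q_inverse t s x = z"
  using backward_evolution_unique[OF assms] unfolding Q_inverse_eq(1)[OF assms] by auto

lemma Q_inverse_refl: "Q_inverse t t x = x - P t x"
  by (rule Q_inverse(3)) (auto simp: blinfun.diff_right)

lemma Q_inverse_U: "t \<le> r \<Longrightarrow> r \<le> s \<Longrightarrow> Q_inverse t s (U s r x) = Q_inverse t r x"
proof (rule Q_inverse(3))
  assume tr: "t \<le> r" "r \<le> s"
  then show "U s t (Q_inverse t r x) = U s r x - P s (U s r x)"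
    using U_comp[OF tr, of "Q_inverse t r x"] by (simp add: Q_inverse(2) blinfun.diff_right U_P_commute)
qed (auto simp: Q_inverse(1))

lemma U_Q_inverse: "r \<le> t \<Longrightarrow> t \<le> s \<Longrightarrow> U t r (Q_inverse r s x) = Q_inverse t s x"
proof (rule Q_inverse(3)[symmetric])
  assume rt: "r \<le> t" "t \<le> s"
  then show "U s t (U t r (Q_inverse r s x)) = x - P s x"
    using U_comp[OF rt, of "Q_inverse r s x"] by (simp add: Q_inverse(2))
  show "P t (U t r (Q_inverse r s x)) = 0"
    using rt by (simp add: U_P_commute[symmetric] Q_inverse(1))
qed auto

text \<open>
  Near \<open>r\<close> the function equals \<open>U(t,N)Q(N)\<close> applied to \<open>U(N,\<tau>)v\<close> for a fixed \<open>N > r\<close>, which reduces continuity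
  of the backward evolution to that of the forward one.
\<close>

lemma Q_inverse_continuous_right: "continuous_on UNIV (\<lambda>\<tau>. Q_inverse t (max t \<tau>) v)"
  unfolding continuous_on_eq_continuous_at[OF open_UNIV]
proof
  fix r
  define N where "N = max t r + 1"
  have "continuous_on UNIV (\<lambda>\<tau>. Q_inverse t N (U N (min N (max t \<tau>)) v))"
    by (rule continuous_on_compose2[OF linear_continuous_on[OF blinfun.bounded_linear_right, of UNIV]])
      (intro U_continuous continuous_intros, auto)
  then have "isCont (\<lambda>\<tau>. Q_inverse t N (U N (min N (max t \<tau>)) v)) r"
    by (simp add: continuous_on_eq_continuous_at)
  then show "isCont (\<lambda>\<tau>. Q_inverse t (max t \<tau>) v) r"
  proof (rule continuous_transform_within[where \<delta>=1])
    fix \<tau> assume "dist \<tau> r < 1"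
    then have "max t \<tau> \<le> N" by (auto simp: N_def dist_real_def)
    then show "Q_inverse t N (U N (min N (max t \<tau>)) v) = Q_inverse t (max t \<tau>) v"
      by (simp add: Q_inverse_U min_absorb2)
  qed auto
qed

lemma Q_inverse_continuous_left: "continuous_on UNIV (\<lambda>t. Q_inverse (min t s) s v)"
  unfolding continuous_on_eq_continuous_at[OF open_UNIV]
proof
  fix r
  define N where "N = min r s - 1"
  have "continuous_on UNIV (\<lambda>t. U (max N (min t s)) N (Q_inverse N s v))"
    by (intro U_continuous continuous_intros) auto
  then have "isCont (\<lambda>t. U (max N (min t s)) N (Q_inverse N s v)) r"
    by (simp add: continuous_on_eq_continuous_at)
  then show "isCont (\<lambda>t. Q_inverse (min t s) s v) r"
  proof (rule continuous_transform_within[where \<delta>=1])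
    fix t assume "dist t r < 1"
    then have "N \<le> min t s" by (auto simp: N_def dist_real_def)
    then show "U (max N (min t s)) N (Q_inverse N s v) = Q_inverse (min t s) s v"
      by (simp add: U_Q_inverse max_absorb2)
  qed auto
qed

definition green :: "real \<Rightarrow> real \<Rightarrow> 'a \<Rightarrow>\<^sub>L 'a" where
  "green t s = (if s \<le> t then U t s o\<^sub>L P s else - Q_inverse t s)"

lemma norm_green: "norm (green t s) \<le> K * exp (- \<alpha> * \<bar>t - s\<bar> + \<epsilon> * \<bar>s\<bar>)"
proof (cases "s \<le> t")
  case True
  then have "norm (U t s o\<^sub>L P s) \<le> K * exp (- \<alpha> * (t - s) + \<epsilon> * \<bar>s\<bar>)"
    using dichotomy by (auto simp: nonuniform_exp_dichotomy_with_def)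
  with True show ?thesis by (simp add: green_def)
next
  case False
  then show ?thesis using Q_inverse_eq(2)[of t s] by (simp add: green_def abs_if)
qed

lemma green_measurable: "strongly_measurable lebesgue (\<lambda>\<tau>. green t \<tau> v)"
proof -
  have "strongly_measurable lebesgue (\<lambda>\<tau>. P t (U t (min t \<tau>) v))"
    by (intro strongly_measurable_continuous_on_real
        continuous_on_compose2[OF linear_continuous_on[OF blinfun.bounded_linear_right, of UNIV]])
      (intro U_continuous continuous_intros, auto)
  moreover have "strongly_measurable lebesgue (\<lambda>\<tau>. - Q_inverse t (max t \<tau>) v)"
    by (intro strongly_measurable_minus strongly_measurable_continuous_on_real Q_inverse_continuous_right)
  moreover have "Measurable.pred lebesgue (\<lambda>\<tau>. \<tau> \<le> t)"
    by (rule measurable_completion) measurable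
  ultimately have "strongly_measurable lebesgue (\<lambda>\<tau>. if \<tau> \<le> t then P t (U t (min t \<tau>) v) else - Q_inverse t (max t \<tau>) v)"
    by (rule completion.strongly_measurable_If)
  moreover have "(if \<tau> \<le> t then P t (U t (min t \<tau>) v) else - Q_inverse t (max t \<tau>) v) = green t \<tau> v" for \<tau>
    by (auto simp: green_def U_P_commute blinfun.minus_left)
  ultimately show ?thesis by simp
qed

text \<open>
  Continuity fails exactly on the diagonal, where the Green function jumps by the identity.
\<close>

lemma green_tendsto:
  assumes p: "p \<longlonglongrightarrow> t" and "\<tau> \<noteq> t"
  shows "(\<lambda>n. green (p n) \<tau> v) \<longlonglongrightarrow> green t \<tau> v"
proof (cases "\<tau> < t")
  case True
  have "(\<lambda>n. U (max (p n) \<tau>) \<tau> (P \<tau> v)) \<longlonglongrightarrow> U (max t \<tau>) \<tau> (P \<tau> v)"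
    by (rule continuous_on_tendsto_compose[OF _ p, of UNIV "\<lambda>t. U (max t \<tau>) \<tau> (P \<tau> v)"])
      (intro U_continuous continuous_intros, auto)
  then have "(\<lambda>n. U (max (p n) \<tau>) \<tau> (P \<tau> v)) \<longlonglongrightarrow> green t \<tau> v"
    using True by (simp add: green_def max_def)
  moreover have "\<forall>\<^sub>F n in sequentially. U (max (p n) \<tau>) \<tau> (P \<tau> v) = green (p n) \<tau> v"
    using order_tendstoD(1)[OF p True] by eventually_elim (simp add: green_def max_def)
  ultimately show ?thesis
    by (rule Lim_transform_eventually)
next
  case False
  then have "t < \<tau>" using assms by simp
  have "(\<lambda>n. - Q_inverse (min (p n) \<tau>) \<tau> v) \<longlonglongrightarrow> - Q_inverse (min t \<tau>) \<tau> v"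
    by (intro tendsto_minus continuous_on_tendsto_compose[OF Q_inverse_continuous_left p]) auto
  then have "(\<lambda>n. - Q_inverse (min (p n) \<tau>) \<tau> v) \<longlonglongrightarrow> green t \<tau> v"
    using \<open>t < \<tau>\<close> by (simp add: green_def min_def blinfun.minus_left)
  moreover have "\<forall>\<^sub>F n in sequentially. - Q_inverse (min (p n) \<tau>) \<tau> v = green (p n) \<tau> v"
    using order_tendstoD(2)[OF p \<open>t < \<tau>\<close>] by eventually_elim (simp add: green_def min_def blinfun.minus_left)
  ultimately show ?thesis
    by (rule Lim_transform_eventually)
qed

text \<open>
  In the first argument the Green function is an orbit of \<open>U\<close> on either side of \<open>\<tau>\<close>.  Across \<open>\<tau>\<close> it
  jumps by the identity, and \<open>U(t,\<tau>)P(\<tau>) + U(t,\<tau>)Q(\<tau>) = U(t,\<tau>)\<close>.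
\<close>

lemma green_evolve:
  assumes "r \<le> t"
  shows "green t \<tau> v - U t r (green r \<tau> v) = indicator {r<..t} \<tau> *\<^sub>R U t \<tau> v"
proof -
  consider "\<tau> \<le> r" | "r < \<tau>" "\<tau> \<le> t" | "t < \<tau>" by linarith
  then show ?thesis
  proof cases
    case 1
    then show ?thesis using assms U_comp[of \<tau> r t "P \<tau> v"] by (simp add: green_def)
  next
    case 2
    then show ?thesis
      using U_comp[of r \<tau> t "Q_inverse r \<tau> v"]
      by (simp add: green_def blinfun.bilinear_simps Q_inverse(2) U_P_commute)
  next
    case 3
    then show ?thesis using assms by (simp add: green_def blinfun.bilinear_simps U_Q_inverse)
  qed
qed

section \<open>The Green operator\<close>

definition green_op :: "(real \<Rightarrow> 'a) \<Rightarrow> real \<Rightarrow> 'a" where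
  "green_op f t = strong_integral lebesgue (\<lambda>\<tau>. green t \<tau> (B \<tau> (f \<tau>)))"

text \<open>
  The weights that grow and decay at most at the rate \<open>\<beta>\<close>.  For these the decay \<open>\<alpha>\<close> of the Green function
  leaves the rate \<open>\<alpha> - \<beta>\<close> that appears in the smallness condition on \<open>B\<close>.
\<close>

definition slow_weight :: "(real \<Rightarrow> real) \<Rightarrow> bool" where
  "slow_weight w \<longleftrightarrow> (\<forall>t. 0 < w t) \<and> (\<forall>t \<tau>. w \<tau> \<le> exp (\<beta> * \<bar>t - \<tau>\<bar>) * w t)"

lemma slow_weight_const: "slow_weight (\<lambda>_. 1)"
  using \<beta> by (simp add: slow_weight_def)

lemma slow_weight_exp: "slow_weight (\<lambda>t. exp (- \<beta> * \<bar>t - s\<bar>))"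
proof -
  have "- \<beta> * \<bar>\<tau> - s\<bar> \<le> \<beta> * \<bar>t - \<tau>\<bar> + - \<beta> * \<bar>t - s\<bar>" for t \<tau>
  proof -
    have "\<beta> * \<bar>t - s\<bar> \<le> \<beta> * (\<bar>t - \<tau>\<bar> + \<bar>\<tau> - s\<bar>)"
      using \<beta> by (intro mult_left_mono) auto
    then show ?thesis by (simp add: distrib_left)
  qed
  then show ?thesis
    by (simp add: slow_weight_def exp_add[symmetric])
qed

lemma green_integrand_measurable:
  "strongly_measurable lebesgue f \<Longrightarrow> strongly_measurable lebesgue (\<lambda>\<tau>. green t \<tau> (B \<tau> (f \<tau>)))"
  by (rule completion.strongly_measurable_blinfun_apply[where T="green t", OF green_measurable strongly_measurable_B_apply])

lemma green_integrand_bound: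
  assumes w: "slow_weight w" and f: "norm (f \<tau>) \<le> C * w \<tau>" "0 \<le> C"
  shows "norm (green t \<tau> (B \<tau> (f \<tau>))) \<le> C * w t * (K * exp (- (\<alpha> - \<beta>) * \<bar>t - \<tau>\<bar>) * (norm (B \<tau>) * exp (\<epsilon> * \<bar>\<tau>\<bar>)))"
proof -
  have "norm (green t \<tau> (B \<tau> (f \<tau>))) \<le> norm (green t \<tau>) * (norm (B \<tau>) * norm (f \<tau>))"
    by (meson norm_blinfun mult_left_mono norm_ge_zero order_trans)
  also have "\<dots> \<le> (K * exp (- \<alpha> * \<bar>t - \<tau>\<bar> + \<epsilon> * \<bar>\<tau>\<bar>)) * (norm (B \<tau>) * (C * (exp (\<beta> * \<bar>t - \<tau>\<bar>) * w t)))"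
  proof (intro mult_mono norm_green order_refl)
    have "C * w \<tau> \<le> C * (exp (\<beta> * \<bar>t - \<tau>\<bar>) * w t)"
      using w f(2) by (intro mult_left_mono) (auto simp: slow_weight_def)
    then show "norm (f \<tau>) \<le> C * (exp (\<beta> * \<bar>t - \<tau>\<bar>) * w t)"
      using f(1) by linarith
  qed (use dichotomy_constants in auto)
  also have "\<dots> = C * w t * (K * exp (- (\<alpha> - \<beta>) * \<bar>t - \<tau>\<bar>) * (norm (B \<tau>) * exp (\<epsilon> * \<bar>\<tau>\<bar>)))"
    by (simp add: algebra_simps exp_add exp_diff exp_minus divide_inverse)
  finally show ?thesis .
qed

lemma kernel_measurable:
  "(\<lambda>\<tau>. K * exp (- (\<alpha> - \<beta>) * \<bar>t - \<tau>\<bar>) * (norm (B \<tau>) * exp (\<epsilon> * \<bar>\<tau>\<bar>))) \<in> borel_measurable lebesgue"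
proof (intro borel_measurable_times B_norm_measurable)
  show "(\<lambda>\<tau>. exp (- (\<alpha> - \<beta>) * \<bar>t - \<tau>\<bar>)) \<in> borel_measurable lebesgue"
    "(\<lambda>\<tau>. exp (\<epsilon> * \<bar>\<tau>\<bar>)) \<in> borel_measurable lebesgue"
    by (intro borel_measurable_lebesgue_continuous continuous_intros)+
qed simp

lemma green_integrand_nn_integral:
  assumes w: "slow_weight w" and f: "\<And>\<tau>. norm (f \<tau>) \<le> C * w \<tau>" "0 \<le> C"
  shows "L1_norm lebesgue (\<lambda>\<tau>. green t \<tau> (B \<tau> (f \<tau>))) \<le> ennreal (q * C * w t)"
proof -
  let ?k = "\<lambda>\<tau>. K * exp (- (\<alpha> - \<beta>) * \<bar>t - \<tau>\<bar>) * (norm (B \<tau>) * exp (\<epsilon> * \<bar>\<tau>\<bar>))"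
  have w0: "0 \<le> w t" using w by (auto simp: slow_weight_def less_imp_le)
  have "L1_norm lebesgue (\<lambda>\<tau>. green t \<tau> (B \<tau> (f \<tau>))) \<le> (\<integral>\<^sup>+\<tau>. ennreal (C * w t) * ennreal (?k \<tau>) \<partial>lebesgue)"
  proof (intro nn_integral_mono)
    fix \<tau>
    have "norm (green t \<tau> (B \<tau> (f \<tau>))) \<le> C * w t * ?k \<tau>"
      by (rule green_integrand_bound[OF w f])
    then show "ennreal (norm (green t \<tau> (B \<tau> (f \<tau>)))) \<le> ennreal (C * w t) * ennreal (?k \<tau>)"
      using w0 f(2) by (simp add: ennreal_mult'[symmetric] ennreal_leI)
  qed
  also have "\<dots> = ennreal (C * w t) * (\<integral>\<^sup>+\<tau>. ennreal (?k \<tau>) \<partial>lebesgue)"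
    using kernel_measurable by (intro nn_integral_cmult) simp
  also have "\<dots> \<le> ennreal (C * w t) * ennreal q"
    using B_small by (intro mult_left_mono) auto
  also have "\<dots> = ennreal (q * C * w t)"
    using q w0 f(2) by (simp add: ennreal_mult[symmetric] mult_ac)
  finally show ?thesis .
qed

text \<open>
  Comparing \<open>w(\<tau>)\<close> with \<open>w(t)\<close> costs the factor \<open>exp(\<beta>|t-\<tau>|)\<close>, which lowers the decay rate of the kernel from \<open>\<alpha>\<close>
  to \<open>\<alpha> - \<beta>\<close>, the rate for which its integral against \<open>\<parallel>B(\<tau>)\<parallel>\<close> is at most \<open>q\<close>.
\<close>

lemma green_op_bound:
  assumes f: "strongly_measurable lebesgue f" and w: "slow_weight w" and le: "\<And>\<tau>. norm (f \<tau>) \<le> C * w \<tau>" "0 \<le> C"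
  shows "strongly_integrable lebesgue (\<lambda>\<tau>. green t \<tau> (B \<tau> (f \<tau>)))"
    and "norm (green_op f t) \<le> q * C * w t"
proof -
  have "0 \<le> q * C * w t" using q le(2) w by (auto simp: slow_weight_def less_imp_le)
  from completion.norm_strong_integral_le[OF green_integrand_measurable[OF f] green_integrand_nn_integral[OF w le] this]
  show "strongly_integrable lebesgue (\<lambda>\<tau>. green t \<tau> (B \<tau> (f \<tau>)))" "norm (green_op f t) \<le> q * C * w t"
    by (auto simp: green_op_def)
qed

text \<open>
  The image is continuous even if \<open>f\<close> is not, because the kernel is continuous in \<open>t\<close> for almost every
  \<open>\<tau>\<close>.  This matters since \<open>f\<close> will have a jump.
\<close>

lemma green_op_continuous:
  assumes f: "strongly_measurable lebesgue f" and w: "slow_weight w" and le: "\<And>\<tau>. norm (f \<tau>) \<le> C * w \<tau>" "0 \<le> C"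
  shows "continuous_on UNIV (green_op f)"
proof -
  have "(\<lambda>n. green_op f (p n)) \<longlonglongrightarrow> green_op f t" if p: "p \<longlonglongrightarrow> t" for p t
  proof -
    have "bounded (range p)" using p by (rule convergent_imp_bounded)
    then have "bounded (range (\<lambda>n. p n - t))"
      by (rule bounded_minus_comp) (simp add: image_constant_conv)
    then obtain R where R: "\<And>n. \<bar>p n - t\<bar> \<le> R"
      unfolding bounded_iff by auto
    let ?k = "\<lambda>t \<tau>. K * exp (- (\<alpha> - \<beta>) * \<bar>t - \<tau>\<bar>) * (norm (B \<tau>) * exp (\<epsilon> * \<bar>\<tau>\<bar>))"
    \<comment> \<open>moving \<open>t\<close> by at most \<open>R\<close> changes the weight and the kernel by the two exponential factors in \<open>D\<close>\<close>
    define D where "D = C * (exp (\<beta> * R) * w t) * exp ((\<alpha> - \<beta>) * R)"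
    have \<alpha>\<beta>: "0 \<le> \<alpha> - \<beta>" using \<beta> dichotomy_constants by linarith
    have w0: "0 < w t" for t using w by (auto simp: slow_weight_def)
    have D0: "0 \<le> D" using le(2) w0[of t] by (simp add: D_def)
    show ?thesis
      unfolding green_op_def
    proof (rule completion.strong_integral_dominated_convergence[where h="\<lambda>\<tau>. D * ?k t \<tau>"])
      show "strongly_measurable lebesgue (\<lambda>\<tau>. green (p n) \<tau> (B \<tau> (f \<tau>)))" for n
        using f by (rule green_integrand_measurable)
      show "(\<lambda>\<tau>. D * ?k t \<tau>) \<in> borel_measurable lebesgue"
        by (rule borel_measurable_times[OF _ kernel_measurable]) simp
      have "(\<integral>\<^sup>+\<tau>. ennreal (D * ?k t \<tau>) \<partial>lebesgue) = ennreal D * (\<integral>\<^sup>+\<tau>. ennreal (?k t \<tau>) \<partial>lebesgue)"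
        using kernel_measurable[of t] D0 by (subst nn_integral_cmult[symmetric]) (simp_all add: ennreal_mult')
      then show "(\<integral>\<^sup>+\<tau>. ennreal (D * ?k t \<tau>) \<partial>lebesgue) < \<infinity>"
        using B_small[of t] by (simp add: ennreal_mult_less_top order_le_less_trans[OF _ ennreal_less_top])
      have "AE \<tau> in lebesgue. \<tau> \<notin> {t}"
        by (rule AE_lebesgue_notin_finite) simp
      then show "AE \<tau> in lebesgue. (\<lambda>n. green (p n) \<tau> (B \<tau> (f \<tau>))) \<longlonglongrightarrow> green t \<tau> (B \<tau> (f \<tau>))"
        by eventually_elim (auto intro!: green_tendsto p)
      show "AE \<tau> in lebesgue. norm (green (p n) \<tau> (B \<tau> (f \<tau>))) \<le> D * ?k t \<tau>" for n
      proof (rule AE_I2)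
        fix \<tau>
        have "norm (green (p n) \<tau> (B \<tau> (f \<tau>))) \<le> C * w (p n) * ?k (p n) \<tau>"
          by (rule green_integrand_bound[OF w le])
        also have "\<dots> \<le> C * (exp (\<beta> * R) * w t) * (exp ((\<alpha> - \<beta>) * R) * ?k t \<tau>)"
        proof (rule mult_mono)
          have "w (p n) \<le> exp (\<beta> * \<bar>t - p n\<bar>) * w t"
            using w by (auto simp: slow_weight_def)
          also have "\<dots> \<le> exp (\<beta> * R) * w t"
            using R[of n] \<beta> w0[of t] by (intro mult_right_mono) (auto simp: abs_minus_commute)
          finally show "C * w (p n) \<le> C * (exp (\<beta> * R) * w t)"
            using le(2) by (rule mult_left_mono)
          have "(\<alpha> - \<beta>) * \<bar>t - \<tau>\<bar> \<le> (\<alpha> - \<beta>) * (R + \<bar>p n - \<tau>\<bar>)"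
            using R[of n] \<alpha>\<beta> by (intro mult_left_mono) auto
          then have "- (\<alpha> - \<beta>) * \<bar>p n - \<tau>\<bar> \<le> (\<alpha> - \<beta>) * R + - (\<alpha> - \<beta>) * \<bar>t - \<tau>\<bar>"
            by (simp add: algebra_simps)
          then have "exp (- (\<alpha> - \<beta>) * \<bar>p n - \<tau>\<bar>) \<le> exp ((\<alpha> - \<beta>) * R) * exp (- (\<alpha> - \<beta>) * \<bar>t - \<tau>\<bar>)"
            unfolding exp_add[symmetric] by simp
          then have "K * exp (- (\<alpha> - \<beta>) * \<bar>p n - \<tau>\<bar>) * (norm (B \<tau>) * exp (\<epsilon> * \<bar>\<tau>\<bar>)) \<le>
              K * (exp ((\<alpha> - \<beta>) * R) * exp (- (\<alpha> - \<beta>) * \<bar>t - \<tau>\<bar>)) * (norm (B \<tau>) * exp (\<epsilon> * \<bar>\<tau>\<bar>))"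
            using dichotomy_constants by (intro mult_right_mono mult_left_mono) auto
          then show "?k (p n) \<tau> \<le> exp ((\<alpha> - \<beta>) * R) * ?k t \<tau>"
            by (simp add: mult_ac)
        qed (use le(2) w0[of t] dichotomy_constants in auto)
        also have "\<dots> = D * ?k t \<tau>"
          by (simp add: D_def)
        finally show "norm (green (p n) \<tau> (B \<tau> (f \<tau>))) \<le> D * ?k t \<tau>" .
      qed
    qed
  qed
  then show ?thesis
    unfolding continuous_on_sequentially comp_def by blast
qed

lemma green_op_linear:
  assumes f: "strongly_integrable lebesgue (\<lambda>\<tau>. green t \<tau> (B \<tau> (f \<tau>)))"
    and g: "strongly_integrable lebesgue (\<lambda>\<tau>. green t \<tau> (B \<tau> (g \<tau>)))"
  shows "green_op (\<lambda>\<tau>. c *\<^sub>R f \<tau> + g \<tau>) t = c *\<^sub>R green_op f t + green_op g t"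
proof -
  note sc = completion.strongly_integrable_bounded_linear[OF bounded_linear_scaleR_right[of c] f]
  show ?thesis
    unfolding green_op_def
    using completion.strongly_integrable_add(2)[OF sc(1) g] sc(2) by (simp add: blinfun.bilinear_simps)
qed

text \<open>
  Integrating \<open>green_evolve\<close>: the Green operator produces mild solutions of the equation with
  inhomogeneity \<open>B f\<close>.
\<close>

lemma green_op_evolve:
  assumes f: "strongly_measurable lebesgue f" and w: "slow_weight w" and le: "\<And>\<tau>. norm (f \<tau>) \<le> C * w \<tau>" "0 \<le> C"
    and "r \<le> t"
  shows "green_op f t = U t r (green_op f r) + volterra r f t"
proof -
  note int = green_op_bound(1)[OF f w le]
  note Uint = completion.strongly_integrable_bounded_linear[OF blinfun.bounded_linear_right[of "U t r"] int[of r]]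
  note diff = completion.strongly_integrable_diff[OF int[of t] Uint(1)]
  have "AE \<tau> in lebesgue. \<tau> \<notin> {r}"
    by (rule AE_lebesgue_notin_finite) simp
  then have "AE \<tau> in lebesgue. green t \<tau> (B \<tau> (f \<tau>)) - U t r (green r \<tau> (B \<tau> (f \<tau>))) =
      indicator {r..t} \<tau> *\<^sub>R U t \<tau> (B \<tau> (f \<tau>))"
    by eventually_elim (auto simp: green_evolve[OF \<open>r \<le> t\<close>] indicator_def)
  from completion.strong_integral_cong_AE(2)[OF diff(1) this] diff(2) Uint(2)
  show ?thesis by (simp add: volterra_def green_op_def)
qed

section \<open>The perturbed Green function\<close>

lemma green_op_fixpoint_zero:
  assumes f: "strongly_measurable lebesgue f" and w: "slow_weight w" and le: "\<And>\<tau>. norm (f \<tau>) \<le> C * w \<tau>"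
    and eq: "\<And>t. f t = green_op f t"
  shows "f t = 0"
proof -
  have "norm (f t) \<le> 0 / (1 - q) * w t"
  proof (rule weighted_bound_improve[where S=UNIV and y=f and w=w and p=t and q=q and a=0 and ?C0.0=C])
    show "norm (f p) \<le> (0 + q * D) * w p" if "0 \<le> D" "\<And>p. p \<in> UNIV \<Longrightarrow> norm (f p) \<le> D * w p" for D p
      using green_op_bound(2)[OF f w _ that(1), of p] that(2) eq[of p] by simp
  qed (use w q le in \<open>auto simp: slow_weight_def\<close>)
  then show ?thesis by simp
qed

lemma norm_green_apply: "norm (green t s x) \<le> K * exp (\<epsilon> * \<bar>s\<bar>) * norm x * exp (- \<beta> * \<bar>t - s\<bar>)"
proof -
  have "norm (green t s x) \<le> K * exp (- \<alpha> * \<bar>t - s\<bar> + \<epsilon> * \<bar>s\<bar>) * norm x"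
    using norm_green by (meson norm_blinfun mult_right_mono norm_ge_zero order_trans)
  also have "\<dots> \<le> K * exp (- \<beta> * \<bar>t - s\<bar> + \<epsilon> * \<bar>s\<bar>) * norm x"
    using \<beta> dichotomy_constants by (intro mult_right_mono mult_left_mono) (auto intro!: mult_right_mono)
  finally show ?thesis
    unfolding exp_add by (simp add: mult_ac)
qed

lemma green_measurable_left: "strongly_measurable lebesgue (\<lambda>t. green t s x)"
proof -
  have "strongly_measurable lebesgue (\<lambda>t. U (max t s) s (P s x))"
    by (intro strongly_measurable_continuous_on_real U_continuous continuous_intros) auto
  moreover have "strongly_measurable lebesgue (\<lambda>t. - Q_inverse (min t s) s x)"
    by (intro strongly_measurable_minus strongly_measurable_continuous_on_real Q_inverse_continuous_left)
  moreover have "Measurable.pred lebesgue (\<lambda>t. s \<le> t)"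
    by (rule measurable_completion) measurable
  ultimately have "strongly_measurable lebesgue (\<lambda>t. if s \<le> t then U (max t s) s (P s x) else - Q_inverse (min t s) s x)"
    by (rule completion.strongly_measurable_If)
  moreover have "(if s \<le> t then U (max t s) s (P s x) else - Q_inverse (min t s) s x) = green t s x" for t
    by (auto simp: green_def blinfun.minus_left)
  ultimately show ?thesis by simp
qed

text \<open>
  The solution is not continuous at \<open>s\<close>, so the fixed point is sought for the continuous part
  \<open>k = y - G(\<cdot>,s)x\<close>, which solves \<open>k = \<Gamma>(G(\<cdot>,s)x) + \<Gamma>k\<close> for the Green operator \<open>\<Gamma>\<close>.
\<close>

lemma perturbed_green_exists:
  "\<exists>y. strongly_measurable lebesgue y \<and> (\<exists>C\<ge>0. \<forall>t. norm (y t) \<le> C * exp (- \<beta> * \<bar>t - s\<bar>)) \<and>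
    (\<forall>t. y t = green t s x + green_op y t)"
proof -
  define w where "w t = exp (- \<beta> * \<bar>t - s\<bar>)" for t
  have w: "slow_weight w" unfolding w_def[abs_def] by (rule slow_weight_exp)
  define C0 where "C0 = K * exp (\<epsilon> * \<bar>s\<bar>) * norm x"
  have C0: "0 \<le> C0" using dichotomy_constants by (simp add: C0_def)
  have g: "norm (green t s x) \<le> C0 * w t" for t
    unfolding C0_def w_def by (rule norm_green_apply)
  note gm = green_measurable_left[of s x]
  obtain k C where k: "0 \<le> C" "continuous_on UNIV k" "\<And>t. norm (k t) \<le> C * w t"
    "\<And>t. k t = green_op (\<lambda>t. green t s x) t + green_op k t"
  proof (rule weighted_contraction_fixpoint[where w=w and q=q and T=green_op and h="green_op (\<lambda>t. green t s x)" and ?C0.0="q * C0"])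
    show "continuous_on UNIV (green_op k) \<and> (\<forall>p. norm (green_op k p) \<le> q * C * w p)"
      if "continuous_on UNIV k" "0 \<le> C" "\<And>p. norm (k p) \<le> C * w p" for k C
      using green_op_continuous[OF _ w that(3,2)] green_op_bound(2)[OF _ w that(3,2)]
        strongly_measurable_continuous_on_real[OF that(1)] by blast
    show "green_op (\<lambda>p. k p - l p) p = green_op k p - green_op l p"
      if "continuous_on UNIV k" "continuous_on UNIV l" "0 \<le> C" "\<And>p. norm (k p) \<le> C * w p" "\<And>p. norm (l p) \<le> C * w p"
      for k l C p
      using green_op_linear[OF green_op_bound(1)[OF strongly_measurable_continuous_on_real[OF that(2)] w that(5,3), of p]
          green_op_bound(1)[OF strongly_measurable_continuous_on_real[OF that(1)] w that(4,3), of p], of "-1"] by simp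
    show "continuous_on UNIV (green_op (\<lambda>t. green t s x))"
      by (rule green_op_continuous[OF gm w g C0])
    show "norm (green_op (\<lambda>t. green t s x) p) \<le> q * C0 * w p" for p
      by (rule green_op_bound(2)[OF gm w g C0])
    show "continuous_on UNIV w"
      unfolding w_def by (intro continuous_intros)
  qed (use q C0 in \<open>auto simp: w_def\<close>)
  note km = strongly_measurable_continuous_on_real[OF k(2)]
  define y where "y t = green t s x + k t" for t
  show ?thesis
  proof (intro exI[of _ y] conjI allI)
    show "strongly_measurable lebesgue y"
      unfolding y_def by (intro strongly_measurable_add gm km)
    have "norm (y t) \<le> (C0 + C) * w t" for t
      using norm_triangle_ineq[of "green t s x" "k t"] g[of t] k(3)[of t] by (simp add: y_def distrib_right)
    then show "\<exists>C\<ge>0. \<forall>t. norm (y t) \<le> C * exp (- \<beta> * \<bar>t - s\<bar>)"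
      using C0 k(1) by (intro exI[of _ "C0 + C"]) (auto simp: w_def)
    show "y t = green t s x + green_op y t" for t
      using green_op_linear[OF green_op_bound(1)[OF gm w g C0, of t] green_op_bound(1)[OF km w k(3,1), of t], of 1] k(4)[of t]
      unfolding y_def by simp
  qed
qed

definition perturbed_green :: "real \<Rightarrow> real \<Rightarrow> 'a \<Rightarrow> 'a" where
  "perturbed_green t s x = (SOME y. strongly_measurable lebesgue y \<and>
    (\<exists>C\<ge>0. \<forall>t. norm (y t) \<le> C * exp (- \<beta> * \<bar>t - s\<bar>)) \<and> (\<forall>t. y t = green t s x + green_op y t)) t"

lemma perturbed_green:
  shows perturbed_green_measurable: "strongly_measurable lebesgue (\<lambda>t. perturbed_green t s x)"
    and perturbed_green_bounded: "\<exists>C\<ge>0. \<forall>t. norm (perturbed_green t s x) \<le> C * exp (- \<beta> * \<bar>t - s\<bar>)"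
    and perturbed_green_eq: "perturbed_green t s x = green t s x + green_op (\<lambda>t. perturbed_green t s x) t"
proof -
  define Y where "Y = (SOME y. strongly_measurable lebesgue y \<and>
    (\<exists>C\<ge>0. \<forall>t. norm (y t) \<le> C * exp (- \<beta> * \<bar>t - s\<bar>)) \<and> (\<forall>t. y t = green t s x + green_op y t))"
  have Y: "strongly_measurable lebesgue Y" "\<exists>C\<ge>0. \<forall>t. norm (Y t) \<le> C * exp (- \<beta> * \<bar>t - s\<bar>)"
    "\<forall>t. Y t = green t s x + green_op Y t"
    using someI_ex[OF perturbed_green_exists[of s x]] unfolding Y_def[symmetric] by blast+
  have eq: "(\<lambda>t. perturbed_green t s x) = Y"
    by (simp add: Y_def perturbed_green_def)
  then have pointwise: "perturbed_green t s x = Y t" for t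
    by (rule fun_cong)
  show "strongly_measurable lebesgue (\<lambda>t. perturbed_green t s x)"
    unfolding eq by (rule Y(1))
  show "\<exists>C\<ge>0. \<forall>t. norm (perturbed_green t s x) \<le> C * exp (- \<beta> * \<bar>t - s\<bar>)"
    unfolding pointwise by (rule Y(2))
  show "perturbed_green t s x = green t s x + green_op (\<lambda>t. perturbed_green t s x) t"
    unfolding eq pointwise using Y(3) by blast
qed

definition perturbed_bound :: "real \<Rightarrow> real" where
  "perturbed_bound s = K / (1 - q) * exp (\<epsilon> * \<bar>s\<bar>)"

lemma perturbed_bound_pos: "0 < perturbed_bound s"
  using q dichotomy_constants by (simp add: perturbed_bound_def)

lemma norm_perturbed_green:
  "norm (perturbed_green t s x) \<le> perturbed_bound s * norm x * exp (- \<beta> * \<bar>t - s\<bar>)"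
proof -
  define w where "w t = exp (- \<beta> * \<bar>t - s\<bar>)" for t
  have w: "slow_weight w" unfolding w_def[abs_def] by (rule slow_weight_exp)
  obtain C where C: "0 \<le> C" "\<And>t. norm (perturbed_green t s x) \<le> C * w t"
    using perturbed_green_bounded[of s x] unfolding w_def by blast
  have "norm (perturbed_green t s x) \<le> (K * exp (\<epsilon> * \<bar>s\<bar>) * norm x) / (1 - q) * w t"
  proof (rule weighted_bound_improve[where S=UNIV and y="\<lambda>t. perturbed_green t s x" and w=w and p=t and q=q
        and a="K * exp (\<epsilon> * \<bar>s\<bar>) * norm x" and ?C0.0=C])
    show "norm (perturbed_green p s x) \<le> (K * exp (\<epsilon> * \<bar>s\<bar>) * norm x + q * D) * w p"
      if D: "0 \<le> D" "\<And>p. p \<in> UNIV \<Longrightarrow> norm (perturbed_green p s x) \<le> D * w p" for D p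
    proof -
      have "norm (green_op (\<lambda>t. perturbed_green t s x) p) \<le> q * D * w p"
        using green_op_bound(2)[OF perturbed_green_measurable w _ D(1)] D(2) by blast
      moreover have "norm (green p s x) \<le> K * exp (\<epsilon> * \<bar>s\<bar>) * norm x * w p"
        unfolding w_def by (rule norm_green_apply)
      ultimately show ?thesis
        using norm_triangle_ineq[of "green p s x" "green_op (\<lambda>t. perturbed_green t s x) p"]
        unfolding perturbed_green_eq[of p s x, symmetric] by (simp add: distrib_right)
    qed
  qed (use C q in \<open>auto simp: w_def\<close>)
  then show ?thesis by (simp add: perturbed_bound_def w_def mult_ac)
qed

lemma norm_perturbed_green_le: "norm (perturbed_green t s x) \<le> perturbed_bound s * norm x"
proof -
  have "perturbed_bound s * norm x * exp (- \<beta> * \<bar>t - s\<bar>) \<le> perturbed_bound s * norm x * 1"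
    using perturbed_bound_pos[of s] \<beta> by (intro mult_left_mono) auto
  with norm_perturbed_green[of t s x] show ?thesis by linarith
qed

lemma perturbed_green_integrable:
  "strongly_integrable lebesgue (\<lambda>\<tau>. green t \<tau> (B \<tau> (perturbed_green \<tau> s x)))"
  using perturbed_bound_pos[of s]
  by (intro green_op_bound(1)[OF perturbed_green_measurable slow_weight_exp norm_perturbed_green]) (simp add: less_imp_le)

lemma perturbed_green_linear:
  "perturbed_green t s (c *\<^sub>R x + z) = c *\<^sub>R perturbed_green t s x + perturbed_green t s z"
proof -
  define u where "u t = c *\<^sub>R perturbed_green t s x + perturbed_green t s z" for t
  \<comment> \<open>the deviation from linearity is a bounded fixed point of the Green operator, hence zero\<close>
  define f where "f t = (-1) *\<^sub>R u t + perturbed_green t s (c *\<^sub>R x + z)" for t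
  have um: "strongly_measurable lebesgue u"
    unfolding u_def
    by (intro strongly_measurable_add strongly_measurable_bounded_linear[OF _ bounded_linear_scaleR_right] perturbed_green_measurable)
  have bnd: "\<exists>C\<ge>0. \<forall>t. norm (perturbed_green t s v) \<le> C * 1" for v
    using perturbed_bound_pos[of s] norm_perturbed_green_le by (intro exI[of _ "perturbed_bound s * norm v"]) auto
  obtain C1 C2 C3 where C: "0 \<le> C1" "0 \<le> C2" "\<And>t. norm (perturbed_green t s x) \<le> C1" "\<And>t. norm (perturbed_green t s z) \<le> C2"
      "\<And>t. norm (perturbed_green t s (c *\<^sub>R x + z)) \<le> C3"
    using bnd[of x] bnd[of z] bnd[of "c *\<^sub>R x + z"] by auto
  have ub: "norm (u t) \<le> (\<bar>c\<bar> * C1 + C2) * 1" for t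
    using norm_triangle_ineq[of "c *\<^sub>R perturbed_green t s x" "perturbed_green t s z"] C(4)[of t]
      mult_left_mono[OF C(3)[of t] abs_ge_zero[of c]] by (simp add: u_def)
  have C12: "0 \<le> \<bar>c\<bar> * C1 + C2" using C by simp
  have op_u: "green_op u t = c *\<^sub>R green_op (\<lambda>t. perturbed_green t s x) t + green_op (\<lambda>t. perturbed_green t s z) t" for t
    unfolding u_def by (intro green_op_linear perturbed_green_integrable)
  have op_f: "green_op f t = (-1) *\<^sub>R green_op u t + green_op (\<lambda>t. perturbed_green t s (c *\<^sub>R x + z)) t" for t
    unfolding f_def by (intro green_op_linear perturbed_green_integrable green_op_bound(1)[OF um slow_weight_const ub C12])
  have "f t = 0"
  proof (rule green_op_fixpoint_zero[OF _ slow_weight_const])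
    show "strongly_measurable lebesgue f"
      unfolding f_def
      by (intro strongly_measurable_add strongly_measurable_bounded_linear[OF _ bounded_linear_scaleR_right] perturbed_green_measurable um)
    show "norm (f t) \<le> (\<bar>c\<bar> * C1 + C2 + C3) * 1" for t
      using norm_triangle_ineq4[of "perturbed_green t s (c *\<^sub>R x + z)" "u t"] ub[of t] C(5)[of t] by (simp add: f_def)
    show "f t = green_op f t" for t
      unfolding op_f op_u f_def u_def
      using perturbed_green_eq[of t s x] perturbed_green_eq[of t s z] perturbed_green_eq[of t s "c *\<^sub>R x + z"]
      by (simp add: blinfun.bilinear_simps scaleR_add_right)
  qed
  moreover have "perturbed_green t s (c *\<^sub>R x + z) = f t + u t"
    by (simp add: f_def)
  ultimately show ?thesis by (simp add: u_def)
qed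

lemma perturbed_green_op_evolve:
  assumes "r \<le> t"
  shows "green_op (\<lambda>\<tau>. perturbed_green \<tau> s x) t =
    U t r (green_op (\<lambda>\<tau>. perturbed_green \<tau> s x) r) + volterra r (\<lambda>\<tau>. perturbed_green \<tau> s x) t"
  using perturbed_bound_pos[of s] assms
  by (intro green_op_evolve[OF perturbed_green_measurable slow_weight_exp norm_perturbed_green]) (simp_all add: less_imp_le)

lemma perturbed_green_op_continuous: "continuous_on S (green_op (\<lambda>\<tau>. perturbed_green \<tau> s x))"
  using perturbed_bound_pos[of s]
  by (intro continuous_on_subset[OF green_op_continuous[OF perturbed_green_measurable slow_weight_exp norm_perturbed_green]])
    (simp_all add: less_imp_le)

text \<open>
  For \<open>t < s\<close> this is minus the perturbed Green function, and it extends that function continuously from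
  the left to \<open>t = s\<close>.  It turns out to be the perturbed backward evolution from \<open>s\<close> to \<open>t\<close> after the
  complementary projection.
\<close>

definition perturbed_Q_inverse :: "real \<Rightarrow> real \<Rightarrow> 'a \<Rightarrow> 'a" where
  "perturbed_Q_inverse t s x = Q_inverse t s x - green_op (\<lambda>\<tau>. perturbed_green \<tau> s x) t"

lemma perturbed_Q_inverse_less: "t < s \<Longrightarrow> perturbed_Q_inverse t s x = - perturbed_green t s x"
  using perturbed_green_eq[of t s x] by (simp add: perturbed_Q_inverse_def green_def blinfun.minus_left)

lemma perturbed_Q_inverse_refl: "perturbed_Q_inverse s s x = x - perturbed_green s s x"
  using perturbed_green_eq[of s s x] by (simp add: perturbed_Q_inverse_def green_def Q_inverse_refl)

lemma perturbed_Q_inverse_diff: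
  "perturbed_Q_inverse t s (x - z) = perturbed_Q_inverse t s x - perturbed_Q_inverse t s z"
proof -
  have "perturbed_green \<tau> s (x - z) = (-1) *\<^sub>R perturbed_green \<tau> s z + perturbed_green \<tau> s x" for \<tau>
    using perturbed_green_linear[of \<tau> s "-1" z x] by simp
  then have "green_op (\<lambda>\<tau>. perturbed_green \<tau> s (x - z)) t =
      (-1) *\<^sub>R green_op (\<lambda>\<tau>. perturbed_green \<tau> s z) t + green_op (\<lambda>\<tau>. perturbed_green \<tau> s x) t"
    by (simp only: green_op_linear[OF perturbed_green_integrable perturbed_green_integrable])
  then show ?thesis
    by (simp add: perturbed_Q_inverse_def blinfun.diff_right)
qed

lemma norm_perturbed_Q_inverse:
  assumes "t \<le> s"
  shows "norm (perturbed_Q_inverse t s x) \<le> perturbed_bound s * norm x * exp (- \<beta> * (s - t))"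
proof -
  have st: "\<bar>t - s\<bar> = s - t" using assms by simp
  have "norm (Q_inverse t s x) \<le> K * exp (- \<alpha> * (s - t) + \<epsilon> * \<bar>s\<bar>) * norm x"
    using Q_inverse_eq(2)[OF assms] by (meson norm_blinfun mult_right_mono norm_ge_zero order_trans)
  also have "\<dots> \<le> K * exp (- \<beta> * (s - t) + \<epsilon> * \<bar>s\<bar>) * norm x"
    using \<beta> dichotomy_constants assms by (intro mult_right_mono mult_left_mono) (auto intro!: mult_right_mono)
  finally have 1: "norm (Q_inverse t s x) \<le> K * exp (\<epsilon> * \<bar>s\<bar>) * norm x * exp (- \<beta> * (s - t))"
    unfolding exp_add by (simp add: mult_ac)
  have 2: "norm (green_op (\<lambda>\<tau>. perturbed_green \<tau> s x) t) \<le> q * (perturbed_bound s * norm x) * exp (- \<beta> * (s - t))"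
    using green_op_bound(2)[OF perturbed_green_measurable slow_weight_exp norm_perturbed_green, of s x t] perturbed_bound_pos[of s]
    by (simp add: less_imp_le st)
  have bound: "perturbed_bound s = K * exp (\<epsilon> * \<bar>s\<bar>) + q * perturbed_bound s"
    using q by (simp add: perturbed_bound_def field_simps)
  have "perturbed_bound s * norm x * exp (- \<beta> * (s - t)) =
      (K * exp (\<epsilon> * \<bar>s\<bar>) + q * perturbed_bound s) * norm x * exp (- \<beta> * (s - t))"
    using bound by simp
  also have "\<dots> = K * exp (\<epsilon> * \<bar>s\<bar>) * norm x * exp (- \<beta> * (s - t)) + q * (perturbed_bound s * norm x) * exp (- \<beta> * (s - t))"
    by (simp add: distrib_right mult.assoc)
  finally have "perturbed_bound s * norm x * exp (- \<beta> * (s - t)) =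
      K * exp (\<epsilon> * \<bar>s\<bar>) * norm x * exp (- \<beta> * (s - t)) + q * (perturbed_bound s * norm x) * exp (- \<beta> * (s - t))" .
  with 1 2 show ?thesis
    using norm_triangle_ineq4[of "Q_inverse t s x" "green_op (\<lambda>\<tau>. perturbed_green \<tau> s x) t"]
    by (simp add: perturbed_Q_inverse_def)
qed

lemma norm_perturbed_Q_inverse_le:
  assumes "t \<le> s"
  shows "norm (perturbed_Q_inverse t s x) \<le> perturbed_bound s * norm x"
proof -
  have "perturbed_bound s * norm x * exp (- \<beta> * (s - t)) \<le> perturbed_bound s * norm x * 1"
    using perturbed_bound_pos[of s] \<beta> assms by (intro mult_left_mono) auto
  with norm_perturbed_Q_inverse[OF assms, of x] show ?thesis by linarith
qed

lemma perturbed_Q_inverse_continuous: "continuous_on {..s} (\<lambda>t. perturbed_Q_inverse t s x)"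
proof -
  have "continuous_on {..s} (\<lambda>t. Q_inverse (min t s) s x - green_op (\<lambda>\<tau>. perturbed_green \<tau> s x) t)"
    by (intro continuous_on_diff perturbed_green_op_continuous continuous_on_subset[OF Q_inverse_continuous_left]) auto
  then show ?thesis
    by (rule continuous_on_eq) (simp add: perturbed_Q_inverse_def min_def)
qed

end

section \<open>The dichotomy of the perturbed evolution family\<close>

locale perturbed_dichotomy_flow = perturbed_dichotomy U B P \<alpha> K \<epsilon> \<beta> q
  for U :: "real \<Rightarrow> real \<Rightarrow> 'a::banach \<Rightarrow>\<^sub>L 'a" and B P \<alpha> K \<epsilon> \<beta> q +
  fixes V :: "real \<Rightarrow> real \<Rightarrow> 'a \<Rightarrow>\<^sub>L 'a"
  assumes perturbed: "perturbed_evolution_family UNIV U B V"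

text \<open>
  Perturbing \<open>V\<close> by zero makes the facts on the composition and continuity of \<open>U\<close> available for \<open>V\<close>.
\<close>

sublocale perturbed_dichotomy_flow \<subseteq> V: perturbed_evolution V "\<lambda>_. 0"
  using perturbed by unfold_locales (auto simp: perturbed_evolution_family_def)

context perturbed_dichotomy_flow
begin

lemma V_continuous_interval: "continuous_on {r..t} (\<lambda>\<tau>. V \<tau> r x)"
  by (intro V.U_continuous continuous_intros) auto

text \<open>
  Uniqueness for the Volterra equation: mild solutions of the perturbed equation are orbits of \<open>V\<close>.
\<close>

lemma volterra_solution_eq_V:
  assumes "r \<le> t" "continuous_on {r..t} y" "\<And>\<tau>. r \<le> \<tau> \<Longrightarrow> \<tau> \<le> t \<Longrightarrow> y \<tau> = U \<tau> r (y r) + volterra r y \<tau>"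
  shows "y t = V t r (y r)"
proof (rule volterra_unique[where s=r and t=t and x="y r" and z="\<lambda>\<tau>. V \<tau> r (y r)", OF assms(2,3)])
  show "V \<tau> r (y r) = U \<tau> r (y r) + volterra r (\<lambda>\<tau>. V \<tau> r (y r)) \<tau>" if "r \<le> \<tau>" for \<tau>
    using that by (rule perturbed_evolution_family_volterra[OF perturbed])
qed (simp_all add: assms(1) V_continuous_interval)

lemma perturbed_green_forward:
  assumes "s \<le> r" "r \<le> t"
  shows "perturbed_green t s x = V t r (perturbed_green r s x)"
proof (rule volterra_solution_eq_V[OF assms(2), of "\<lambda>t. perturbed_green t s x"])
  have eq: "perturbed_green \<tau> s x = U \<tau> s (P s x) + green_op (\<lambda>t. perturbed_green t s x) \<tau>" if "s \<le> \<tau>" for \<tau>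
    using perturbed_green_eq[of \<tau> s x] that by (simp add: green_def)
  have "continuous_on {r..t} (\<lambda>\<tau>. U \<tau> s (P s x) + green_op (\<lambda>t. perturbed_green t s x) \<tau>)"
    using assms by (intro continuous_on_add U_continuous perturbed_green_op_continuous continuous_intros) auto
  then show "continuous_on {r..t} (\<lambda>\<tau>. perturbed_green \<tau> s x)"
    by (rule continuous_on_eq) (use assms in \<open>simp add: eq\<close>)
  fix \<tau> assume \<tau>: "r \<le> \<tau>" "\<tau> \<le> t"
  show "perturbed_green \<tau> s x = U \<tau> r (perturbed_green r s x) + volterra r (\<lambda>t. perturbed_green t s x) \<tau>"
    using eq[of \<tau>] eq[of r] assms \<tau> perturbed_green_op_evolve[OF \<tau>(1), of s x] U_comp[OF assms(1) \<tau>(1), of "P s x"]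
    by (simp add: blinfun.add_right)
qed

lemma perturbed_Q_inverse_orbit:
  assumes "r \<le> t" "t \<le> s"
  shows "perturbed_Q_inverse t s x = V t r (perturbed_Q_inverse r s x)"
proof (rule volterra_solution_eq_V[OF assms(1), of "\<lambda>t. perturbed_Q_inverse t s x"])
  show "continuous_on {r..t} (\<lambda>\<tau>. perturbed_Q_inverse \<tau> s x)"
    using assms by (intro continuous_on_subset[OF perturbed_Q_inverse_continuous]) auto
  fix \<tau> assume \<tau>: "r \<le> \<tau>" "\<tau> \<le> t"
  have int: "strongly_integrable lebesgue (\<lambda>p. indicator {r..\<tau>} p *\<^sub>R U \<tau> p (B p (perturbed_green p s x)))"
  proof (rule volterra_integrable[where C="perturbed_bound s * norm x"])
    show "strongly_measurable lebesgue (\<lambda>\<tau>'. indicator {r..\<tau>} \<tau>' *\<^sub>R perturbed_green \<tau>' s x)"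
      by (intro strongly_measurable_indicator perturbed_green_measurable) simp
    show "norm (perturbed_green p s x) \<le> perturbed_bound s * norm x" for p
      by (rule norm_perturbed_green_le)
  qed
  note minus = completion.strongly_integrable_bounded_linear[OF bounded_linear_minus[OF bounded_linear_ident] int]
  have "AE p in lebesgue. p \<notin> {s}"
    by (rule AE_lebesgue_notin_finite) simp
  then have "AE p in lebesgue. - (indicator {r..\<tau>} p *\<^sub>R U \<tau> p (B p (perturbed_green p s x))) =
      indicator {r..\<tau>} p *\<^sub>R U \<tau> p (B p (perturbed_Q_inverse p s x))"
  proof eventually_elim
    fix p assume "p \<notin> {s}"
    show "- (indicator {r..\<tau>} p *\<^sub>R U \<tau> p (B p (perturbed_green p s x))) =
      indicator {r..\<tau>} p *\<^sub>R U \<tau> p (B p (perturbed_Q_inverse p s x))"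
    proof (cases "p \<in> {r..\<tau>}")
      case True
      then have "p < s" using \<open>p \<notin> {s}\<close> \<tau> assms by auto
      then show ?thesis by (simp add: perturbed_Q_inverse_less blinfun.minus_right)
    qed simp
  qed
  from completion.strong_integral_cong_AE(2)[OF minus(1) this]
  have "volterra r (\<lambda>p. perturbed_Q_inverse p s x) \<tau> = - volterra r (\<lambda>p. perturbed_green p s x) \<tau>"
    unfolding volterra_def minus(2) .
  moreover have "U \<tau> r (Q_inverse r s x) = Q_inverse \<tau> s x"
    using assms \<tau> by (intro U_Q_inverse) auto
  ultimately show "perturbed_Q_inverse \<tau> s x = U \<tau> r (perturbed_Q_inverse r s x) + volterra r (\<lambda>t. perturbed_Q_inverse t s x) \<tau>"
    using perturbed_green_op_evolve[OF \<tau>(1), of s x] by (simp add: perturbed_Q_inverse_def blinfun.diff_right)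
qed

text \<open>
  Applying \<open>P(t)\<close> to the variation of constants formula on \<open>[r,t]\<close> and \<open>U(t,s)Q(s)\<close> to the one on \<open>[t,s]\<close> expresses
  \<open>u(t)\<close> as \<open>G(t,r)u(r) + U(t,s)Q(s)u(s)\<close> plus the integral of \<open>G(t,\<tau>)B(\<tau>)u(\<tau>)\<close> over \<open>[r,s]\<close>.
  The integral is at most \<open>q C\<close>, and since \<open>\<epsilon> < \<alpha>\<close> the boundary terms vanish as \<open>r \<rightarrow> -\<infinity>\<close> and \<open>s \<rightarrow> \<infinity>\<close>.
\<close>

lemma bounded_orbit_improve:
  assumes orbit: "\<And>r t. r \<le> t \<Longrightarrow> u t = V t r (u r)" and C: "0 \<le> C" "\<And>t. norm (u t) \<le> C"
  shows "norm (u t) \<le> q * C"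
proof -
  have cont: "continuous_on {r..t} u" for r t
    using V_continuous_interval[of r t "u r"] by (rule continuous_on_eq) (auto simp: orbit[symmetric])
  have volt: "u t = U t r (u r) + volterra r u t" if "r \<le> t" for r t
  proof -
    have "volterra r (\<lambda>\<tau>. V \<tau> r (u r)) t = volterra r u t"
      by (intro volterra_cong) (simp add: orbit[symmetric])
    then show ?thesis
      using perturbed_evolution_family_volterra[OF perturbed that, of "u r"] orbit[OF that] by simp
  qed
  have le: "norm (u t) \<le> norm (green t r (u r)) + norm (Q_inverse t s (u s)) + q * C" if rs: "r \<le> t" "t \<le> s" for r s
  proof -
    note int1 = volterra_integrable_continuous[OF cont[of r t]]
    note int2 = volterra_integrable_continuous[OF cont[of t s]]
    note P1 = completion.strongly_integrable_bounded_linear[OF blinfun.bounded_linear_right[of "P t"] int1]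
    note Q2 = completion.strongly_integrable_bounded_linear[OF blinfun.bounded_linear_right[of "Q_inverse t s"] int2]
    note diff = completion.strongly_integrable_diff[OF P1(1) Q2(1)]
    let ?d = "\<lambda>\<tau>. P t (indicator {r..t} \<tau> *\<^sub>R U t \<tau> (B \<tau> (u \<tau>))) - Q_inverse t s (indicator {t..s} \<tau> *\<^sub>R U s \<tau> (B \<tau> (u \<tau>)))"
    have "AE \<tau> in lebesgue. \<tau> \<notin> {t}"
      by (rule AE_lebesgue_notin_finite) simp
    then have "AE \<tau> in lebesgue. ennreal (norm (?d \<tau>)) \<le> ennreal (norm (green t \<tau> (B \<tau> (u \<tau>))))"
    proof eventually_elim
      fix \<tau> assume "\<tau> \<notin> {t}"
      then consider "r \<le> \<tau>" "\<tau> < t" | "t < \<tau>" "\<tau> \<le> s" | "\<tau> < r" | "s < \<tau>" by fastforce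
      then show "ennreal (norm (?d \<tau>)) \<le> ennreal (norm (green t \<tau> (B \<tau> (u \<tau>))))"
        using rs by cases (auto simp: green_def U_P_commute Q_inverse_U blinfun.minus_left)
    qed
    then have "L1_norm lebesgue ?d \<le> L1_norm lebesgue (\<lambda>\<tau>. green t \<tau> (B \<tau> (u \<tau>)))"
      by (rule nn_integral_mono_AE)
    also have "\<dots> \<le> ennreal (q * C * 1)"
      by (rule green_integrand_nn_integral[OF slow_weight_const]) (use C in auto)
    finally have "norm (strong_integral lebesgue ?d) \<le> q * C"
      using completion.norm_strong_integral_le(2)[of _ ?d "q * C"] diff(1) q C by (simp add: strongly_integrable_def)
    then have main: "norm (P t (volterra r u t) - Q_inverse t s (volterra t u s)) \<le> q * C"
      unfolding diff(2) P1(2) Q2(2) volterra_def .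
    have "P t (u t) = green t r (u r) + P t (volterra r u t)"
      using volt[OF rs(1)] rs by (simp add: green_def U_P_commute blinfun.add_right)
    moreover have "Q_inverse t s (u s) = (u t - P t (u t)) + Q_inverse t s (volterra t u s)"
      using volt[OF rs(2)] rs by (simp add: blinfun.add_right Q_inverse_U Q_inverse_refl)
    ultimately have "u t = green t r (u r) + Q_inverse t s (u s) + (P t (volterra r u t) - Q_inverse t s (volterra t u s))"
      by (simp add: algebra_simps)
    with main show ?thesis
      by (smt (verit) norm_triangle_ineq)
  qed
  \<comment> \<open>for \<open>r = t - n\<close> and \<open>s = t + n\<close> each boundary term is at most \<open>E exp(-(\<alpha>-\<epsilon>)n)\<close>\<close>
  define E where "E = K * exp (\<epsilon> * \<bar>t\<bar>) * C"
  have E: "norm (u t) \<le> 2 * E * exp (- (\<alpha> - \<epsilon>)) ^ n + q * C" for n :: nat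
  proof -
    have decay: "K * exp (- \<alpha> * real n + \<epsilon> * \<bar>r\<bar>) * C \<le> E * exp (- (\<alpha> - \<epsilon>)) ^ n" if "\<bar>r\<bar> \<le> \<bar>t\<bar> + real n" for r
    proof -
      have "- \<alpha> * real n + \<epsilon> * \<bar>r\<bar> \<le> \<epsilon> * \<bar>t\<bar> + real n * (- (\<alpha> - \<epsilon>))"
        using mult_left_mono[OF that dichotomy_constants(3)] by (simp add: algebra_simps)
      then have "exp (- \<alpha> * real n + \<epsilon> * \<bar>r\<bar>) \<le> exp (\<epsilon> * \<bar>t\<bar>) * exp (- (\<alpha> - \<epsilon>)) ^ n"
        unfolding exp_of_nat_mult[symmetric] exp_add[symmetric] by simp
      then have "K * exp (- \<alpha> * real n + \<epsilon> * \<bar>r\<bar>) * C \<le> K * (exp (\<epsilon> * \<bar>t\<bar>) * exp (- (\<alpha> - \<epsilon>)) ^ n) * C"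
        using dichotomy_constants C(1) by (intro mult_right_mono mult_left_mono) auto
      then show ?thesis
        unfolding E_def by (simp only: mult_ac)
    qed
    have "norm (green t (t - n) (u (t - n))) \<le> K * exp (- \<alpha> * real n + \<epsilon> * \<bar>t - n\<bar>) * C"
      using norm_green[of t "t - n"] C(2)[of "t - n"] dichotomy_constants
      by (intro order_trans[OF norm_blinfun] mult_mono) auto
    moreover have "norm (Q_inverse t (t + n) (u (t + n))) \<le> K * exp (- \<alpha> * real n + \<epsilon> * \<bar>t + n\<bar>) * C"
      using Q_inverse_eq(2)[of t "t + n"] C(2)[of "t + n"] dichotomy_constants
      by (intro order_trans[OF norm_blinfun] mult_mono) auto
    moreover have "norm (u t) \<le> norm (green t (t - n) (u (t - n))) + norm (Q_inverse t (t + n) (u (t + n))) + q * C"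
      by (rule le) auto
    moreover have "\<bar>t - real n\<bar> \<le> \<bar>t\<bar> + real n" "\<bar>t + real n\<bar> \<le> \<bar>t\<bar> + real n"
      by linarith+
    ultimately show ?thesis
      using decay[of "t - n"] decay[of "t + n"] by linarith
  qed
  have "(\<lambda>n. 2 * E * exp (- (\<alpha> - \<epsilon>)) ^ n + q * C) \<longlonglongrightarrow> 2 * E * 0 + q * C"
    using \<beta> by (intro tendsto_intros LIMSEQ_realpow_zero) auto
  then show ?thesis
    using E by (intro LIMSEQ_le_const[of _ "q * C"]) auto
qed

theorem bounded_orbit_zero:
  assumes orbit: "\<And>r t. r \<le> t \<Longrightarrow> u t = V t r (u r)" and C: "\<And>t. norm (u t) \<le> C"
  shows "u t = 0"
proof -
  have "norm (u t) \<le> 0 / (1 - q) * 1"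
  proof (rule weighted_bound_improve[where S=UNIV and y=u and w="\<lambda>_. 1" and p=t and q=q and a=0 and ?C0.0=C])
    show "norm (u p) \<le> (0 + q * D) * 1" if "0 \<le> D" "\<And>p. p \<in> UNIV \<Longrightarrow> norm (u p) \<le> D * 1" for D p
      using bounded_orbit_improve[OF orbit that(1)] that(2) by simp
  qed (use q C in auto)
  then show ?thesis by simp
qed

definition stable_space :: "real \<Rightarrow> 'a set" where
  "stable_space s = {x. \<exists>C. \<forall>t\<ge>s. norm (V t s x) \<le> C}"

definition unstable_space :: "real \<Rightarrow> 'a set" where
  "unstable_space s = {x. \<exists>z C. z s = x \<and> (\<forall>r t. r \<le> t \<longrightarrow> t \<le> s \<longrightarrow> z t = V t r (z r)) \<and> (\<forall>t\<le>s. norm (z t) \<le> C)}"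

lemma stable_space_diff: "x \<in> stable_space s \<Longrightarrow> y \<in> stable_space s \<Longrightarrow> x - y \<in> stable_space s"
proof -
  assume "x \<in> stable_space s" "y \<in> stable_space s"
  then obtain C D where C: "\<And>t. t \<ge> s \<Longrightarrow> norm (V t s x) \<le> C" "\<And>t. t \<ge> s \<Longrightarrow> norm (V t s y) \<le> D"
    by (auto simp: stable_space_def)
  have "norm (V t s (x - y)) \<le> C + D" if "t \<ge> s" for t
    using norm_triangle_ineq4[of "V t s x" "V t s y"] C[OF that] by (simp add: blinfun.diff_right)
  then show ?thesis by (auto simp: stable_space_def)
qed

lemma unstable_space_diff: "x \<in> unstable_space s \<Longrightarrow> y \<in> unstable_space s \<Longrightarrow> x - y \<in> unstable_space s"
proof -
  assume "x \<in> unstable_space s" "y \<in> unstable_space s"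
  then obtain z C z' D where z: "z s = x" "\<And>r t. r \<le> t \<Longrightarrow> t \<le> s \<Longrightarrow> z t = V t r (z r)" "\<And>t. t \<le> s \<Longrightarrow> norm (z t) \<le> C"
    and z': "z' s = y" "\<And>r t. r \<le> t \<Longrightarrow> t \<le> s \<Longrightarrow> z' t = V t r (z' r)" "\<And>t. t \<le> s \<Longrightarrow> norm (z' t) \<le> D"
    unfolding unstable_space_def by blast
  have "norm (z t - z' t) \<le> C + D" if "t \<le> s" for t
    using norm_triangle_ineq4[of "z t" "z' t"] z(3)[OF that] z'(3)[OF that] by simp
  moreover have "z t - z' t = V t r (z r - z' r)" if "r \<le> t" "t \<le> s" for r t
    using z(2)[OF that] z'(2)[OF that] by (simp add: blinfun.diff_right)
  ultimately show ?thesis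
    unfolding unstable_space_def using z(1) z'(1)
    by (intro CollectI exI[of _ "\<lambda>t. z t - z' t"] exI[of _ "C + D"]) auto
qed

lemma orbit_extend:
  assumes z: "\<forall>r t. r \<le> t \<longrightarrow> t \<le> s \<longrightarrow> z t = V t r (z r)" and "r \<le> t"
    and u: "\<And>t. u t = (if t \<le> s then z t else V t s (z s))"
  shows "u t = V t r (u r)"
proof -
  consider "t \<le> s" | "r \<le> s" "s < t" | "s < r" using assms(2) by linarith
  then show ?thesis
  proof cases
    case 1
    then show ?thesis using assms(2) z by (simp add: u)
  next
    case 2
    then show ?thesis using z V.U_comp[of r s t "z r"] by (simp add: u)
  next
    case 3
    then show ?thesis using assms(2) V.U_comp[of s r t "z s"] by (simp add: u)
  qed
qed

text \<open>
  A backward orbit ending in \<open>x\<close> and the forward orbit of \<open>x\<close> join to an orbit on the whole line.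
\<close>

lemma stable_Int_unstable:
  assumes "x \<in> stable_space s" "x \<in> unstable_space s"
  shows "x = 0"
proof -
  obtain z C where z: "z s = x" "\<And>r t. r \<le> t \<Longrightarrow> t \<le> s \<Longrightarrow> z t = V t r (z r)" "\<And>t. t \<le> s \<Longrightarrow> norm (z t) \<le> C"
    using assms(2) unfolding unstable_space_def by blast
  obtain D where D: "\<And>t. t \<ge> s \<Longrightarrow> norm (V t s x) \<le> D"
    using assms(1) by (auto simp: stable_space_def)
  have z': "\<forall>r t. r \<le> t \<longrightarrow> t \<le> s \<longrightarrow> z t = V t r (z r)"
    using z(2) by blast
  define u where "u t = (if t \<le> s then z t else V t s x)" for t
  have "u s = 0"
  proof (rule bounded_orbit_zero)
    show "u t = V t r (u r)" if "r \<le> t" for r t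
      by (rule orbit_extend[OF z' that]) (simp add: u_def z(1))
    show "norm (u t) \<le> max C D" for t
      using z(3)[of t] D[of t] by (auto simp: u_def le_max_iff_disj)
  qed
  then show ?thesis using z(1) by (simp add: u_def)
qed

lemma stable_space_forward:
  assumes "x \<in> stable_space s" "s \<le> t"
  shows "V t s x \<in> stable_space t"
proof -
  obtain D where D: "\<And>t. t \<ge> s \<Longrightarrow> norm (V t s x) \<le> D"
    using assms(1) by (auto simp: stable_space_def)
  have "norm (V r t (V t s x)) \<le> D" if "t \<le> r" for r
    using V.U_comp[OF assms(2) that, of x] D[of r] assms(2) that by simp
  then show ?thesis by (auto simp: stable_space_def)
qed

lemma unstable_space_forward:
  assumes "x \<in> unstable_space s" "s \<le> t"
  shows "V t s x \<in> unstable_space t"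
proof -
  obtain z C where z: "z s = x" "\<And>r t. r \<le> t \<Longrightarrow> t \<le> s \<Longrightarrow> z t = V t r (z r)" "\<And>t. t \<le> s \<Longrightarrow> norm (z t) \<le> C"
    using assms(1) unfolding unstable_space_def by blast
  from z(2) have z': "\<forall>r t. r \<le> t \<longrightarrow> t \<le> s \<longrightarrow> z t = V t r (z r)"
    by blast
  define u where "u p = (if p \<le> s then z p else V p s x)" for p
  have "bounded ((\<lambda>p. V p s x) ` {s..t})"
    by (intro compact_imp_bounded compact_continuous_image V_continuous_interval) simp
  then obtain D where D: "\<And>p. p \<in> {s..t} \<Longrightarrow> norm (V p s x) \<le> D"
    unfolding bounded_iff by blast
  have "u p = V p r (u r)" if "r \<le> p" for r p
    by (rule orbit_extend[OF z' that]) (simp add: u_def z(1))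
  moreover have "norm (u p) \<le> max C D" if "p \<le> t" for p
    using z(3)[of p] D[of p] that by (auto simp: u_def le_max_iff_disj)
  moreover have "u t = V t s x"
    using assms(2) z(1) by (auto simp: u_def)
  ultimately show ?thesis
    unfolding unstable_space_def by blast
qed

lemma perturbed_green_stable: "perturbed_green s s x \<in> stable_space s"
proof -
  have "norm (V t s (perturbed_green s s x)) \<le> perturbed_bound s * norm x" if "t \<ge> s" for t
    using norm_perturbed_green_le[of t s x] perturbed_green_forward[of s s t x] that by simp
  then show ?thesis by (auto simp: stable_space_def)
qed

lemma perturbed_Q_inverse_unstable:
  assumes "t \<le> s"
  shows "perturbed_Q_inverse t s x \<in> unstable_space t"
proof -
  have "norm (perturbed_Q_inverse p s x) \<le> perturbed_bound s * norm x" if "p \<le> t" for p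
    using that assms by (intro norm_perturbed_Q_inverse_le) simp
  moreover have "perturbed_Q_inverse p s x = V p r (perturbed_Q_inverse r s x)" if "r \<le> p" "p \<le> t" for p r
    using that assms by (intro perturbed_Q_inverse_orbit) auto
  ultimately show ?thesis
    unfolding unstable_space_def by (intro CollectI exI[of _ "\<lambda>p. perturbed_Q_inverse p s x"] exI[of _ "perturbed_bound s * norm x"]) auto
qed

definition perturbed_P :: "real \<Rightarrow> 'a \<Rightarrow>\<^sub>L 'a" where
  "perturbed_P s = Blinfun (perturbed_green s s)"

lemma perturbed_P_apply: "perturbed_P s x = perturbed_green s s x"
proof -
  have lin: "perturbed_green s s (c *\<^sub>R x + z) = c *\<^sub>R perturbed_green s s x + perturbed_green s s z" for c x z
    by (rule perturbed_green_linear)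
  have "bounded_linear (perturbed_green s s)"
  proof (rule bounded_linear_intro)
    show "perturbed_green s s (x + z) = perturbed_green s s x + perturbed_green s s z" for x z
      using lin[of 1 x z] by simp
    have "perturbed_green s s 0 = 0" using lin[of 1 0 0] by simp
    then show "perturbed_green s s (c *\<^sub>R x) = c *\<^sub>R perturbed_green s s x" for c x
      using lin[of c x 0] by simp
    show "norm (perturbed_green s s x) \<le> norm x * perturbed_bound s" for x
      using norm_perturbed_green[of s s x] by (simp add: mult.commute)
  qed
  then show ?thesis
    unfolding perturbed_P_def by (simp add: bounded_linear_Blinfun_apply)
qed

lemma norm_perturbed_P: "norm (perturbed_P s) \<le> perturbed_bound s"
  using norm_perturbed_green[of s s] perturbed_bound_pos[of s]
  by (intro norm_blinfun_bound) (auto simp: perturbed_P_apply less_imp_le)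

text \<open>
  Every \<open>x\<close> has a decomposition into a stable and an unstable part, given by the perturbed Green function,
  and the decomposition is unique.  All algebraic properties of the projection follow from this.
\<close>

lemma perturbed_P_unique:
  assumes "a \<in> stable_space s" "b \<in> unstable_space s"
  shows "perturbed_P s (a + b) = a"
proof -
  let ?x = "a + b"
  have "a - perturbed_green s s ?x \<in> stable_space s"
    using assms(1) perturbed_green_stable by (rule stable_space_diff)
  moreover have "a - perturbed_green s s ?x = perturbed_Q_inverse s s ?x - b"
    by (simp add: perturbed_Q_inverse_refl)
  moreover have "perturbed_Q_inverse s s ?x - b \<in> unstable_space s"
    using perturbed_Q_inverse_unstable[of s s ?x] assms(2) by (auto intro: unstable_space_diff)
  ultimately have "a - perturbed_green s s ?x = 0"
    by (metis stable_Int_unstable)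
  then show ?thesis by (simp add: perturbed_P_apply)
qed

lemma null_space_perturbed_P: "null_space (perturbed_P s) = unstable_space s"
proof
  show "null_space (perturbed_P s) \<subseteq> unstable_space s"
    using perturbed_Q_inverse_unstable[of s s]
    by (auto simp: null_space_def perturbed_P_apply perturbed_Q_inverse_refl) (metis diff_zero)
  have "0 \<in> stable_space s" by (auto simp: stable_space_def)
  then show "unstable_space s \<subseteq> null_space (perturbed_P s)"
    using perturbed_P_unique[of 0] by (auto simp: null_space_def)
qed

lemma perturbed_P_idem: "perturbed_P s (perturbed_P s x) = perturbed_P s x"
proof -
  have "0 \<in> null_space (perturbed_P s)"
    by (simp add: null_space_def)
  then have "0 \<in> unstable_space s"
    unfolding null_space_perturbed_P .
  from perturbed_P_unique[OF perturbed_green_stable this] show ?thesis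
    by (simp add: perturbed_P_apply)
qed

lemma perturbed_P_commute:
  assumes "s \<le> t"
  shows "V t s (perturbed_P s x) = perturbed_P t (V t s x)"
proof -
  have "V t s (perturbed_green s s x) \<in> stable_space t"
    using perturbed_green_stable assms by (rule stable_space_forward)
  moreover have "V t s (perturbed_Q_inverse s s x) \<in> unstable_space t"
    using perturbed_Q_inverse_unstable[of s s x] assms by (auto intro: unstable_space_forward)
  ultimately have "perturbed_P t (V t s (perturbed_green s s x) + V t s (perturbed_Q_inverse s s x)) = V t s (perturbed_green s s x)"
    by (rule perturbed_P_unique)
  then show ?thesis
    by (simp add: perturbed_Q_inverse_refl perturbed_P_apply blinfun.diff_right)
qed

text \<open>
  A vector in the kernel starts a forward orbit that vanishes after time \<open>t\<close> and so is bounded.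
  Surjectivity is built into the definition of the unstable space by backward orbits.
\<close>

lemma V_bij_unstable:
  assumes "s \<le> t"
  shows "bij_betw (V t s) (unstable_space s) (unstable_space t)"
  unfolding bij_betw_def
proof
  show "inj_on (V t s) (unstable_space s)"
  proof (rule inj_onI)
    fix x y assume xy: "x \<in> unstable_space s" "y \<in> unstable_space s" "V t s x = V t s y"
    then have d: "x - y \<in> unstable_space s" "V t s (x - y) = 0"
      by (auto intro: unstable_space_diff simp: blinfun.diff_right)
    have "bounded ((\<lambda>p. V p s (x - y)) ` {s..t})"
      by (intro compact_imp_bounded compact_continuous_image V_continuous_interval) simp
    then obtain D where D: "\<And>p. p \<in> {s..t} \<Longrightarrow> norm (V p s (x - y)) \<le> D"
      unfolding bounded_iff by blast
    have "norm (V p s (x - y)) \<le> max D 0" if "p \<ge> s" for p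
    proof (cases "p \<le> t")
      case True
      then show ?thesis using D[of p] that by auto
    next
      case False
      then show ?thesis using V.U_comp[OF assms, of p "x - y"] d(2) by simp
    qed
    then have "x - y \<in> stable_space s" by (auto simp: stable_space_def)
    with d(1) show "x = y" using stable_Int_unstable by fastforce
  qed
  show "V t s ` unstable_space s = unstable_space t"
  proof
    show "V t s ` unstable_space s \<subseteq> unstable_space t"
      using assms by (auto intro: unstable_space_forward)
    show "unstable_space t \<subseteq> V t s ` unstable_space s"
    proof
      fix x assume "x \<in> unstable_space t"
      then obtain z C where z: "z t = x" "\<And>r p. r \<le> p \<Longrightarrow> p \<le> t \<Longrightarrow> z p = V p r (z r)" "\<And>p. p \<le> t \<Longrightarrow> norm (z p) \<le> C"
        unfolding unstable_space_def by blast
      have "z s \<in> unstable_space s"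
        unfolding unstable_space_def using z(2,3) assms by (intro CollectI exI[of _ z] exI[of _ C]) auto
      then show "x \<in> V t s ` unstable_space s"
        using z(1) z(2)[of s t] assms by auto
    qed
  qed
qed

lemma perturbed_Q_inverse_backward:
  assumes "t \<le> s"
  shows "backward_evolution V perturbed_P t s ((id_blinfun - perturbed_P s) x) = perturbed_Q_inverse t s x"
proof -
  have "(id_blinfun - perturbed_P s) x = V s t (perturbed_Q_inverse t s x)"
    using perturbed_Q_inverse_orbit[OF assms, of s x]
    by (simp add: blinfun.diff_left perturbed_P_apply perturbed_Q_inverse_refl)
  then show ?thesis
    unfolding backward_evolution_def null_space_perturbed_P
    using V_bij_unstable[OF assms] perturbed_Q_inverse_unstable[OF assms, of x]
    by (simp add: bij_betw_def inv_into_f_f)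
qed

text \<open>
  From the right, \<open>\<hat>P(t)x = \<hat>P(t)(x - V(t,s)x) + V(t,s)\<hat>P(s)x\<close> with \<open>\<hat>P\<close> locally bounded.  From the left the
  same argument would need \<open>V(s,t)y - y\<close> to be small for all \<open>y = \<hat>P(t)x\<close> at once; there the complementary
  projections are written as \<open>x - \<hat>P(t)x = R(t,s)V(s,t)x\<close>, where \<open>R(t,s)\<close> is the backward evolution
  after the complementary projection at \<open>s\<close>, bounded uniformly in \<open>t \<le> s\<close> and strongly continuous in \<open>t\<close>.
\<close>

lemma perturbed_P_continuous: "continuous_on UNIV (\<lambda>t. perturbed_P t x)"
proof -
  have V_lim: "((\<lambda>t. V t s v) \<longlongrightarrow> v) (at_right s)" for s v
  proof -
    have "continuous_on UNIV (\<lambda>t. V (max t s) s v)"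
      by (intro V.U_continuous continuous_intros) auto
    then have "isCont (\<lambda>t. V (max t s) s v) s"
      by (simp add: continuous_on_eq_continuous_at)
    then have "((\<lambda>t. V (max t s) s v) \<longlongrightarrow> v) (at s)"
      unfolding isCont_def by simp
    then have "((\<lambda>t. V (max t s) s v) \<longlongrightarrow> v) (at_right s)"
      by (auto intro: tendsto_mono at_le)
    moreover have "\<forall>\<^sub>F t in at_right s. V (max t s) s v = V t s v"
      by (auto simp: eventually_at_filter max_def)
    ultimately show ?thesis
      by (rule Lim_transform_eventually)
  qed
  have V_lim': "((\<lambda>t. V s t x) \<longlongrightarrow> x) (at_left s)" for s
  proof -
    have "continuous_on UNIV (\<lambda>t. V s (min s t) x)"
      by (intro V.U_continuous continuous_intros) auto
    then have "isCont (\<lambda>t. V s (min s t) x) s"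
      by (simp add: continuous_on_eq_continuous_at)
    then have "((\<lambda>t. V s (min s t) x) \<longlongrightarrow> x) (at s)"
      unfolding isCont_def by simp
    then have "((\<lambda>t. V s (min s t) x) \<longlongrightarrow> x) (at_left s)"
      by (auto intro: tendsto_mono at_le)
    moreover have "\<forall>\<^sub>F t in at_left s. V s (min s t) x = V s t x"
      by (auto simp: eventually_at_filter min_def)
    ultimately show ?thesis
      by (rule Lim_transform_eventually)
  qed
  have "isCont (\<lambda>t. perturbed_P t x) s" for s
  proof -
    have right: "((\<lambda>t. perturbed_P t x) \<longlongrightarrow> perturbed_P s x) (at_right s)"
    proof -
      have "((\<lambda>t. perturbed_P t (x - V t s x)) \<longlongrightarrow> 0) (at_right s)"
      proof (rule Lim_null_comparison)
        define M where "M = perturbed_bound (\<bar>s\<bar> + 1)"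
        have "\<forall>\<^sub>F t in at_right s. t < s + 1"
          by (auto simp: eventually_at_right[of s "s + 1"] intro: exI[of _ "s + 1"])
        moreover have "\<forall>\<^sub>F t in at_right s. s < t"
          by (auto simp: eventually_at_filter)
        ultimately show "\<forall>\<^sub>F t in at_right s. norm (perturbed_P t (x - V t s x)) \<le> M * norm (x - V t s x)"
        proof eventually_elim
          fix t assume "t < s + 1" "s < t"
          then have "perturbed_bound t \<le> M"
            using q dichotomy_constants unfolding M_def perturbed_bound_def
            by (intro mult_left_mono) (auto intro!: mult_left_mono)
          then have "norm (perturbed_P t) \<le> M"
            using norm_perturbed_P[of t] by linarith
          then show "norm (perturbed_P t (x - V t s x)) \<le> M * norm (x - V t s x)"
            by (meson norm_blinfun mult_right_mono norm_ge_zero order_trans)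
        qed
        have "((\<lambda>t. M * norm (x - V t s x)) \<longlongrightarrow> M * norm (x - x)) (at_right s)"
          by (intro tendsto_intros V_lim)
        then show "((\<lambda>t. M * norm (x - V t s x)) \<longlongrightarrow> 0) (at_right s)" by simp
      qed
      from tendsto_add[OF this V_lim[of s "perturbed_P s x"]]
      have "((\<lambda>t. perturbed_P t (x - V t s x) + V t s (perturbed_P s x)) \<longlongrightarrow> perturbed_P s x) (at_right s)"
        by simp
      moreover have "\<forall>\<^sub>F t in at_right s. perturbed_P t (x - V t s x) + V t s (perturbed_P s x) = perturbed_P t x"
        by (auto simp: eventually_at_filter perturbed_P_commute blinfun.diff_right)
      ultimately show ?thesis
        by (rule Lim_transform_eventually)
    qed
    have left: "((\<lambda>t. perturbed_P t x) \<longlongrightarrow> perturbed_P s x) (at_left s)"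
    proof -
      have Q: "x - perturbed_P t x = perturbed_Q_inverse t s (V s t x - x) + perturbed_Q_inverse t s x" if "t < s" for t
      proof -
        have "V s t (perturbed_Q_inverse t t x) = V s t (perturbed_Q_inverse t s (V s t x))"
          using that perturbed_Q_inverse_orbit[of t s s "V s t x"] perturbed_P_commute[of t s x]
          by (simp add: perturbed_Q_inverse_refl perturbed_P_apply blinfun.diff_right)
        then have "perturbed_Q_inverse t t x = perturbed_Q_inverse t s (V s t x)"
          using V_bij_unstable[of t s] perturbed_Q_inverse_unstable[of t s "V s t x"] perturbed_Q_inverse_unstable[of t t x] that
          by (auto simp: bij_betw_def inj_on_def)
        then show ?thesis
          by (simp add: perturbed_Q_inverse_refl perturbed_P_apply perturbed_Q_inverse_diff)
      qed
      have "((\<lambda>t. perturbed_Q_inverse t s (V s t x - x)) \<longlongrightarrow> 0) (at_left s)"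
      proof (rule Lim_null_comparison)
        have "\<forall>\<^sub>F t in at_left s. t < s"
          by (auto simp: eventually_at_filter)
        then show "\<forall>\<^sub>F t in at_left s. norm (perturbed_Q_inverse t s (V s t x - x)) \<le> perturbed_bound s * norm (V s t x - x)"
          by eventually_elim (intro norm_perturbed_Q_inverse_le, simp)
        have "((\<lambda>t. perturbed_bound s * norm (V s t x - x)) \<longlongrightarrow> perturbed_bound s * norm (x - x)) (at_left s)"
          by (intro tendsto_intros V_lim')
        then show "((\<lambda>t. perturbed_bound s * norm (V s t x - x)) \<longlongrightarrow> 0) (at_left s)" by simp
      qed
      moreover have "((\<lambda>t. perturbed_Q_inverse t s x) \<longlongrightarrow> perturbed_Q_inverse s s x) (at_left s)"
      proof -
        have "((\<lambda>t. perturbed_Q_inverse t s x) \<longlongrightarrow> perturbed_Q_inverse s s x) (at s within {..s})"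
          using perturbed_Q_inverse_continuous[of s x] by (simp add: continuous_on_def)
        then show ?thesis
          by (rule tendsto_mono[rotated]) (auto intro: at_le)
      qed
      ultimately have "((\<lambda>t. x - (perturbed_Q_inverse t s (V s t x - x) + perturbed_Q_inverse t s x)) \<longlongrightarrow>
          x - (0 + perturbed_Q_inverse s s x)) (at_left s)"
        by (intro tendsto_intros)
      then have "((\<lambda>t. x - (perturbed_Q_inverse t s (V s t x - x) + perturbed_Q_inverse t s x)) \<longlongrightarrow> perturbed_P s x) (at_left s)"
        by (simp add: perturbed_Q_inverse_refl perturbed_P_apply)
      moreover have "\<forall>\<^sub>F t in at_left s. x - (perturbed_Q_inverse t s (V s t x - x) + perturbed_Q_inverse t s x) = perturbed_P t x"
        by (auto simp: eventually_at_filter Q[symmetric])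
      ultimately show ?thesis
        by (rule Lim_transform_eventually)
    qed
    from left right show ?thesis
      unfolding isCont_def by (rule filterlim_split_at)
  qed
  then show ?thesis
    by (simp add: continuous_on_eq_continuous_at)
qed

theorem perturbed_dichotomy_with:
  "nonuniform_exp_dichotomy_with UNIV V perturbed_P \<beta> (K / (1 - q)) \<epsilon>"
  unfolding nonuniform_exp_dichotomy_with_def
proof (intro conjI ballI allI impI)
  show "0 < K / (1 - q)"
    using q dichotomy_constants by simp
  show "perturbed_P t o\<^sub>L perturbed_P t = perturbed_P t" for t
    by (rule blinfun_eqI) (simp add: perturbed_P_idem)
  fix t s :: real
  show "V t s o\<^sub>L perturbed_P s = perturbed_P t o\<^sub>L V t s" if "s \<le> t"
    using that by (intro blinfun_eqI) (simp add: perturbed_P_commute)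
  show "bij_betw (V t s) (null_space (perturbed_P s)) (null_space (perturbed_P t))" if "s \<le> t"
    using that unfolding null_space_perturbed_P by (rule V_bij_unstable)
  show "norm (V t s o\<^sub>L perturbed_P s) \<le> K / (1 - q) * exp (- \<beta> * (t - s) + \<epsilon> * \<bar>s\<bar>)" if "s \<le> t"
  proof (rule norm_blinfun_bound)
    show "norm ((V t s o\<^sub>L perturbed_P s) x) \<le> K / (1 - q) * exp (- \<beta> * (t - s) + \<epsilon> * \<bar>s\<bar>) * norm x" for x
      using norm_perturbed_green[of t s x] perturbed_green_forward[of s s t x] that
      unfolding exp_add perturbed_bound_def by (simp add: perturbed_P_apply mult_ac)
    show "0 \<le> K / (1 - q) * exp (- \<beta> * (t - s) + \<epsilon> * \<bar>s\<bar>)"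
      using q dichotomy_constants by simp
  qed
  show "norm (backward_evolution V perturbed_P t s ((id_blinfun - perturbed_P s) x)) \<le>
      K / (1 - q) * exp (- \<beta> * (s - t) + \<epsilon> * \<bar>s\<bar>) * norm x" if "t \<le> s" for x
    using norm_perturbed_Q_inverse[OF that, of x]
    unfolding perturbed_Q_inverse_backward[OF that] perturbed_bound_def exp_add by (simp add: mult_ac)
qed (use \<beta> dichotomy_constants perturbed_P_continuous in auto)

end

theorem theorem3p1:
  fixes A B :: "real \<Rightarrow> 'a::banach \<Rightarrow>\<^sub>L 'a"
    and U :: "real \<Rightarrow> real \<Rightarrow> 'a \<Rightarrow>\<^sub>L 'a"
    and P :: "real \<Rightarrow> 'a \<Rightarrow>\<^sub>L 'a"
    and \<alpha> \<beta> \<epsilon> K :: real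
    and b :: "real \<Rightarrow> real"
    and \<theta> :: ennreal
  assumes "evolution_family UNIV U"
    and "generates_on UNIV A U"
    and "\<And>x. strongly_measurable lebesgue (\<lambda>t. B t x)"
    and "(\<lambda>t. norm (B t)) \<in> borel_measurable lebesgue"
    and "\<alpha> > 0" and "K > 0"
    and "nonuniform_exp_dichotomy_with UNIV U P \<alpha> K \<epsilon>"
    and "\<beta> > 0" and "0 \<le> \<epsilon>" and "\<epsilon> < \<alpha> - \<beta>"
    and "\<And>t. b t = norm (B t) * exp (\<epsilon> * \<bar>t\<bar>)"
    and "\<theta> = (SUP t::real. \<integral>\<^sup>+\<tau>. ennreal (exp (- (\<alpha> - \<beta>) * \<bar>t - \<tau>\<bar>) * b \<tau>) \<partial>lebesgue)"
    and "\<theta> < ennreal (1 / K)"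
  shows "perturbed_admits_nonuniform_exp_dichotomy UNIV U B"
proof -
  have b_eq: "b = (\<lambda>t. norm (B t) * exp (\<epsilon> * \<bar>t\<bar>))"
    using assms(11) by blast
  let ?k = "\<lambda>t \<tau>. exp (- (\<alpha> - \<beta>) * \<bar>t - \<tau>\<bar>) * b \<tau>"
  have cont: "(\<lambda>\<tau>. exp (- (\<alpha> - \<beta>) * \<bar>t - \<tau>\<bar>)) \<in> borel_measurable lebesgue"
    "(\<lambda>\<tau>. exp (\<epsilon> * \<bar>\<tau>\<bar>)) \<in> borel_measurable lebesgue" for t :: real
    by (intro borel_measurable_lebesgue_continuous continuous_intros)+
  have k_meas: "?k t \<in> borel_measurable lebesgue" for t
    unfolding b_eq by (intro borel_measurable_times cont assms(4))
  have fin: "\<theta> < \<infinity>"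
    using assms(13) by (simp add: order.strict_trans[OF _ ennreal_less_top])
  have le: "(\<integral>\<^sup>+\<tau>. ennreal (?k t \<tau>) \<partial>lebesgue) \<le> \<theta>" for t
    unfolding assms(12) by (rule SUP_upper) simp
  define q where "q = K * enn2real \<theta>"
  have q: "0 \<le> q" "q < 1"
  proof -
    show "0 \<le> q" using assms(6) by (simp add: q_def)
    have "ennreal (enn2real \<theta>) < ennreal (1 / K)"
      using assms(13) fin by simp
    then have "enn2real \<theta> < 1 / K"
      by (simp add: ennreal_less_iff)
    then show "q < 1"
      using assms(6) by (simp add: q_def field_simps)
  qed
  have small: "(\<integral>\<^sup>+\<tau>. ennreal (K * exp (- (\<alpha> - \<beta>) * \<bar>t - \<tau>\<bar>) * (norm (B \<tau>) * exp (\<epsilon> * \<bar>\<tau>\<bar>))) \<partial>lebesgue) \<le> ennreal q" for t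
  proof -
    have "(\<integral>\<^sup>+\<tau>. ennreal (K * exp (- (\<alpha> - \<beta>) * \<bar>t - \<tau>\<bar>) * (norm (B \<tau>) * exp (\<epsilon> * \<bar>\<tau>\<bar>))) \<partial>lebesgue) =
        (\<integral>\<^sup>+\<tau>. ennreal K * ennreal (?k t \<tau>) \<partial>lebesgue)"
      using assms(6) by (intro nn_integral_cong) (simp add: b_eq ennreal_mult'[symmetric] mult.assoc)
    also have "\<dots> = ennreal K * (\<integral>\<^sup>+\<tau>. ennreal (?k t \<tau>) \<partial>lebesgue)"
      using k_meas[of t] by (intro nn_integral_cmult) simp
    also have "\<dots> \<le> ennreal K * \<theta>"
      using le by (intro mult_left_mono) auto
    also have "\<dots> = ennreal q"
      using assms(6) fin by (simp add: q_def ennreal_mult)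
    finally show ?thesis .
  qed
  have local: "(\<integral>\<^sup>+\<tau>. ennreal (norm (B \<tau>)) * indicator {c..d} \<tau> \<partial>lebesgue) < \<infinity>" for c d
  proof -
    \<comment> \<open>on \<open>[c,d]\<close> the kernel at time \<open>0\<close> is at least \<open>exp(-m) \<parallel>B\<parallel>\<close>\<close>
    define m where "m = (\<alpha> - \<beta>) * (\<bar>c\<bar> + \<bar>d\<bar>)"
    have "(\<integral>\<^sup>+\<tau>. ennreal (norm (B \<tau>)) * indicator {c..d} \<tau> \<partial>lebesgue) \<le>
        (\<integral>\<^sup>+\<tau>. ennreal (exp m) * ennreal (?k 0 \<tau>) \<partial>lebesgue)"
    proof (intro nn_integral_mono)
      fix \<tau>
      show "ennreal (norm (B \<tau>)) * indicator {c..d} \<tau> \<le> ennreal (exp m) * ennreal (?k 0 \<tau>)"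
      proof (cases "\<tau> \<in> {c..d}")
        case True
        have "(\<alpha> - \<beta>) * \<bar>\<tau>\<bar> \<le> m"
          unfolding m_def using True assms(9,10) by (intro mult_left_mono) auto
        moreover have "0 \<le> \<epsilon> * \<bar>\<tau>\<bar>"
          using assms(9) by simp
        ultimately have "1 \<le> exp (m + - (\<alpha> - \<beta>) * \<bar>0 - \<tau>\<bar> + \<epsilon> * \<bar>\<tau>\<bar>)"
          by (simp add: algebra_simps)
        then have "norm (B \<tau>) * 1 \<le> norm (B \<tau>) * exp (m + - (\<alpha> - \<beta>) * \<bar>0 - \<tau>\<bar> + \<epsilon> * \<bar>\<tau>\<bar>)"
          by (intro mult_left_mono) auto
        also have "\<dots> = exp m * ?k 0 \<tau>"
          unfolding exp_add b_eq by (simp add: mult_ac)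
        finally show ?thesis
          using True by (simp add: ennreal_mult'[symmetric] ennreal_leI)
      qed simp
    qed
    also have "\<dots> = ennreal (exp m) * (\<integral>\<^sup>+\<tau>. ennreal (?k 0 \<tau>) \<partial>lebesgue)"
      using k_meas[of 0] by (intro nn_integral_cmult) simp
    also have "\<dots> < \<infinity>"
      using le_less_trans[OF le[of 0] fin] by (simp add: ennreal_mult_less_top)
    finally show ?thesis .
  qed
  interpret perturbed_dichotomy U B P \<alpha> K \<epsilon> \<beta> q
    by unfold_locales (use assms q small local in auto)
  show ?thesis
    unfolding perturbed_admits_nonuniform_exp_dichotomy_def
  proof (intro conjI allI impI)
    show "\<exists>V. perturbed_evolution_family UNIV U B V"
      by (rule perturbed_evolution_family_exists)
    fix V assume "perturbed_evolution_family UNIV U B V"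
    then interpret perturbed_dichotomy_flow U B P \<alpha> K \<epsilon> \<beta> q V
      by unfold_locales
    show "admits_nonuniform_exp_dichotomy UNIV V"
      unfolding admits_nonuniform_exp_dichotomy_def using perturbed_dichotomy_with by blast
  qed
qed

end
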